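(* Let $p > 7$ be a prime with $p \equiv 2$ or $3 \pmod 5$. Then $|\mathrm{Solv}(\mathrm{PSL}(2, p))|$ equals: (1) $\frac{5}{2}p^2 + \frac{5}{2}p + 2$ if $p \equiv 1 \pmod{24}$; (2) $2p^2 + p + 2$ if $p \equiv 5 \pmod{24}$; (3) $\frac{5}{2}p^2 + \frac{1}{2}p + 2$ if $p \equiv 7 \pmod{24}$; (4) $2p^2 + 2$ if $p \equiv 11 \pmod{24}$; (5) $2p^2 + 2p + 2$ if $p \equiv 13 \pmod{24}$; (6) $\frac{5}{2}p^2 + \frac{3}{2}p + 2$ if $p \equiv 17 \pmod{24}$; (7) $2p^2 + p + 2$ if $p \equiv 19 \pmod{24}$; (8) $\frac{5}{2}p^2 - \frac{1}{2}p + 2$ if $p \equiv 23 \pmod{24}$.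
   Context: For a finite group $G$ and $x \in G$, the solvabilizer of $x$ in $G$ is $\mathrm{Sol}_G(x) = \{y \in G : \langle x, y \rangle \text{ is solvable}\}$. $\mathrm{Solv}(G) = \{\mathrm{Sol}_G(x) : x \in G\}$ is the set of distinct solvabilizers of elements of $G$, and $|\mathrm{Solv}(G)|$ is its cardinality. *)

theory Defs
  imports Complex_Main "HOL-Computational_Algebra.Primes" "HOL-Algebra.Solvable_Groups" "HOL-Algebra.Coset" "HOL-Algebra.Generated_Groups"
begin

text \<open>2x2 matrices over Z/pZ, represented as quadruples (a,b,c,d) of integers in {0..<p},
  standing for the matrix [[a,b],[c,d]]; arithmetic is reduced mod p.\<close>

type_synonym mat2 = "int \<times> int \<times> int \<times> int"

definition mat2_mult :: "int \<Rightarrow> mat2 \<Rightarrow> mat2 \<Rightarrow> mat2" where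
  "mat2_mult p A B = (case A of (a, b, c, d) \<Rightarrow> case B of (e, f, g, h) \<Rightarrow>
     ((a*e + b*g) mod p, (a*f + b*h) mod p, (c*e + d*g) mod p, (c*f + d*h) mod p))"

definition SL2 :: "int \<Rightarrow> mat2 monoid" where
  "SL2 p = \<lparr> carrier = {(a, b, c, d). a \<in> {0..<p} \<and> b \<in> {0..<p} \<and> c \<in> {0..<p} \<and> d \<in> {0..<p}
                                   \<and> (a*d - b*c) mod p = 1},
            mult = mat2_mult p,
            one = (1, 0, 0, 1) \<rparr>"

definition SL2_center :: "int \<Rightarrow> mat2 set" where
  "SL2_center p = {(1, 0, 0, 1), (p - 1, 0, 0, p - 1)}"

definition PSL2 :: "int \<Rightarrow> mat2 set monoid" where
  "PSL2 p = SL2 p Mod SL2_center p"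

definition Sol :: "('a, 'b) monoid_scheme \<Rightarrow> 'a \<Rightarrow> 'a set" where
  "Sol G x = {y \<in> carrier G. solvable (G\<lparr>carrier := generate G {x, y}\<rparr>)}"

definition Solv :: "('a, 'b) monoid_scheme \<Rightarrow> 'a set set" where
  "Solv G = Sol G ` carrier G"

end

theory Submission
  imports Defs "HOL-Number_Theory.Number_Theory"
begin

text \<open>A solvable subgroup of \<open>PSL2 p\<close> has a nontrivial abelian normal subgroup. If this contains an
  element of order greater than 2, the group stabilizes a line of traceless matrices; otherwise it does
  so too or normalizes a Klein four-group, and then its elements have trace \<open>t\<close> with \<open>t\<^sup>2\<close> equal to
  0, 1, 2 or 4. Hence the solvabilizer of a generic element (\<open>t\<^sup>2\<close> different from 0, 1, 2) depends only on its
  axis, the line spanned by its traceless part, and testing membership against generic elements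
  recovers the axis of \<open>x\<close> from the solvabilizer of \<open>x\<close>. Elements of order 3 and 4 are
  told apart from the others on their axis by partners that generate with them a tetrahedral or
  octahedral group. So the nontrivial solvabilizers correspond to the \<open>p\<^sup>2 + p + 1\<close> axes, the involutions
  and the cyclic subgroups of order 3 and 4; all but the axes are counted as pairs of inverse matrices of
  trace 0, 1 and \<open>sqrt 2\<close>.\<close>

section \<open>Solvable groups\<close>

text \<open>Every noncentral element has an axis over the prime field itself, whether its
  eigenvalues are distinct there, equal, or conjugate in the quadratic extension. Lines of traceless
  matrices therefore treat the three types alike: the stabilizer of a line of nonzero determinant is
  the normalizer of a torus, that of a null line is a Borel subgroup. The axes are the points of a
  projective plane, hence their number. The squares 0, 1, 2, 4 come from conjugation by
  \<open>Z\<close>: it permutes three orthogonal lines up to sign, with determinant 1, so its trace,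
  which is the square of \<open>tr Z\<close> minus 1, is -1, 0, 1 or 3. The bound p > 7 ensures that
  every axis carries a generic element; for p = 7 the tori, of order 3 and 4, carry none. Each of
  the special traces contributes p(p+1)/2 or p(p-1)/2 solvabilizers, according to whether the
  eigenvalues lie in the prime field. The trace sqrt 2 occurs only for p = 1 or 7 mod 8, which makes
  the leading coefficient 5/2 instead of 2.\<close>

lemma (in group) solvable_subgroup_iff:
  assumes "subgroup K G"
  shows "solvable (G\<lparr>carrier := K\<rparr>) \<longleftrightarrow> (\<exists>n. (derived G ^^ n) K = {\<one>})"
proof -
  have "(derived (G\<lparr>carrier := K\<rparr>) ^^ n) K = (derived G ^^ n) K \<and> (derived G ^^ n) K \<subseteq> K" for n
    by (induction n) (auto simp: derived_consistent[OF _ assms] dest: derived_incl[OF _ assms])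
  then show ?thesis
    using group.solvable_iff_trivial_derived_seq[OF subgroup_imp_group[OF assms]] by simp
qed

text \<open>By induction the i-th derived subgroup lies in \<open>S i\<close>. Solvability can thus
  be shown by exhibiting explicit subgroups, without computing a derived group.\<close>

lemma (in group) solvable_generate_chain:
  fixes S :: "nat \<Rightarrow> 'a set"
  assumes S: "\<And>i. subgroup (S i) G" and triv: "S n = {\<one>}"
    and comm: "\<And>i a b. \<lbrakk>a \<in> S i; b \<in> S i\<rbrakk> \<Longrightarrow> a \<otimes> b \<otimes> inv a \<otimes> inv b \<in> S (Suc i)"
    and X: "X \<subseteq> S 0"
  shows "solvable (G\<lparr>carrier := generate G X\<rparr>)"
proof -
  have K: "subgroup (generate G X) G"
    using generate_is_subgroup[of X] X subgroup.subset[OF S[of 0]] by blast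
  have "(derived G ^^ i) (generate G X) \<subseteq> S i" for i
  proof (induction i)
    case 0
    then show ?case using generate_subgroup_incl[OF X S] by simp
  next
    case (Suc i)
    have "derived G (S i) \<subseteq> S (Suc i)"
      unfolding derived_def by (rule generate_subgroup_incl[OF _ S]) (auto intro: comm)
    with mono_derived[OF Suc] show ?case by simp
  qed
  then have "(derived G ^^ n) (generate G X) = {\<one>}"
    using triv subgroup.one_closed[OF exp_of_derived_is_subgroup[OF K, of n]] by auto
  then show ?thesis using solvable_subgroup_iff[OF K] by blast
qed

lemma (in group) exp_of_derived_normal:
  assumes "subgroup K G"
  shows "(derived G ^^ n) K \<lhd> G\<lparr>carrier := K\<rparr>"
proof (induction n)
  case 0
  then show ?case using group.normal_self[OF subgroup_imp_group[OF assms]] by simp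
next
  case (Suc n)
  then have "(derived G ^^ n) K \<subseteq> K"
    using subgroup.subset[OF normal.axioms(1)] by force
  then show ?case
    using group.derived_is_normal[OF subgroup_imp_group[OF assms] Suc] derived_consistent[OF _ assms]
    by simp
qed

text \<open>\<open>A\<close> is the last nontrivial term of the derived series: abelian because its
  derived subgroup is trivial, and normal like every term of the series.\<close>

lemma (in group) solvable_abelian_normal:
  assumes K: "subgroup K G" and "solvable (G\<lparr>carrier := K\<rparr>)" and "K \<noteq> {\<one>}"
  obtains A where "subgroup A G" "A \<noteq> {\<one>}"
    "\<And>a b. \<lbrakk>a \<in> A; b \<in> A\<rbrakk> \<Longrightarrow> a \<otimes> b = b \<otimes> a"
    "\<And>x a. \<lbrakk>x \<in> K; a \<in> A\<rbrakk> \<Longrightarrow> x \<otimes> a \<otimes> inv x \<in> A"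
proof -
  define n where "n = (LEAST n. (derived G ^^ n) K = {\<one>})"
  have "\<exists>n. (derived G ^^ n) K = {\<one>}" using assms(2) solvable_subgroup_iff[OF K] by simp
  then have n: "(derived G ^^ n) K = {\<one>}" unfolding n_def by (rule LeastI_ex)
  with assms(3) have "n \<noteq> 0" by (metis funpow_0)
  then obtain m where m: "n = Suc m" using not0_implies_Suc by blast
  let ?A = "(derived G ^^ m) K"
  have d: "derived G ?A = {\<one>}" using n unfolding m by simp
  have A: "subgroup ?A G" by (rule exp_of_derived_is_subgroup[OF K])
  have ntriv: "?A \<noteq> {\<one>}" using m not_less_Least[of m "\<lambda>n. (derived G ^^ n) K = {\<one>}"] unfolding n_def by simp
  have abel: "a \<otimes> b = b \<otimes> a" if "a \<in> ?A" "b \<in> ?A" for a b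
  proof -
    have c: "a \<in> carrier G" "b \<in> carrier G" using that subgroup.subset[OF A] by auto
    have "a \<otimes> b \<otimes> inv a \<otimes> inv b \<in> derived G ?A"
      unfolding derived_def[of G ?A] by (intro generate.incl UN_I[OF that(1)] UN_I[OF that(2)] singletonI)
    then have "(a \<otimes> b) \<otimes> inv (b \<otimes> a) = \<one>" using c unfolding d by (simp add: inv_mult_group m_assoc)
    then show ?thesis using c inv_equality[of "a \<otimes> b" "inv (b \<otimes> a)"] by simp
  qed
  have conj: "x \<otimes> a \<otimes> inv x \<in> ?A" if "x \<in> K" "a \<in> ?A" for x a
    using normal.inv_op_closed2[OF exp_of_derived_normal[OF K, of m], of x a] that
      m_inv_consistent[OF K, of x] by simp
  show thesis by (rule that[OF A ntriv]) (rule abel conj; assumption)+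
qed

section \<open>Two-by-two matrices modulo a prime\<close>

text \<open>Unreduced integer matrices form a ring, so identities are proved by the simplifier;
  congruence modulo p is kept apart as a relation on them.\<close>

datatype mat = Mat int int int int

instantiation mat :: ring_1
begin
definition zero_mat where "0 = Mat 0 0 0 0"
definition one_mat where "1 = Mat 1 0 0 1"
fun plus_mat where "Mat a b c d + Mat e f g h = Mat (a + e) (b + f) (c + g) (d + h)"
fun minus_mat where "Mat a b c d - Mat e f g h = Mat (a - e) (b - f) (c - g) (d - h)"
fun uminus_mat where "- Mat a b c d = Mat (- a) (- b) (- c) (- d)"
fun times_mat where "Mat a b c d * Mat e f g h = Mat (a*e + b*g) (a*f + b*h) (c*e + d*g) (c*f + d*h)"
instance
proof
  fix A B C :: mat
  show "A + B + C = A + (B + C)" "A * B * C = A * (B * C)" "A * (B + C) = A * B + A * C"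
    "(A + B) * C = A * C + B * C"
    by (cases A; cases B; cases C; simp add: algebra_simps)+
  show "A + B = B + A" "A - B = A + - B" by (cases A; cases B; simp add: algebra_simps)+
  show "0 + A = A" "1 * A = A" "A * 1 = A" "- A + A = 0" "(0::mat) \<noteq> 1"
    by (cases A; simp add: zero_mat_def one_mat_def)+
qed
end

fun sm :: "int \<Rightarrow> mat \<Rightarrow> mat" (infixr "*s" 75) where
  "k *s Mat a b c d = Mat (k*a) (k*b) (k*c) (k*d)"

fun tr :: "mat \<Rightarrow> int" where "tr (Mat a b c d) = a + d"
fun dt :: "mat \<Rightarrow> int" where "dt (Mat a b c d) = a*d - b*c"
fun adj :: "mat \<Rightarrow> mat" where "adj (Mat a b c d) = Mat d (-b) (-c) a"
text \<open>For determinant 1, \<open>dt (bracket X Y)\<close> is 2 minus the trace of the group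
  commutator, so its vanishing is the classical criterion for a common eigenvector.\<close>

definition bracket :: "mat \<Rightarrow> mat \<Rightarrow> mat" where "bracket A B = A * B - B * A"

lemma mult_sm [simp]: "A * (k *s B) = k *s (A * B)" "(k *s A) * B = k *s (A * B)"
  by (cases A; cases B; simp add: algebra_simps)+
lemma sm_sm [simp]: "k *s l *s A = (k * l) *s A" by (cases A) simp
lemma sm_simps [simp]: "1 *s A = A" "0 *s A = 0" "k *s 0 = 0" by (cases A; simp add: zero_mat_def)+
lemma sm_distrib: "k *s (A + B) = k *s A + k *s B" "(k + l) *s A = k *s A + l *s A"
   "k *s (A - B) = k *s A - k *s B" "k *s (- A) = - (k *s A)" "(- k) *s A = - (k *s A)"
   "(k - l) *s A = k *s A - l *s A"
  by (cases A; cases B; simp add: algebra_simps)+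
lemma tr_simps [simp]: "tr (A + B) = tr A + tr B" "tr (A - B) = tr A - tr B" "tr (k *s A) = k * tr A"
   "tr (- A) = - tr A" "tr 1 = 2" "tr 0 = 0"
  by (cases A; cases B; simp add: algebra_simps one_mat_def zero_mat_def)+
lemma tr_mult_commute: "tr (A * B) = tr (B * A)"
  by (cases A; cases B) (simp add: algebra_simps)
lemma dt_mult [simp]: "dt (A * B) = dt A * dt B"
  by (cases A; cases B) (simp add: algebra_simps)
lemma dt_simps [simp]: "dt (k *s A) = k^2 * dt A" "dt (- A) = dt A" "dt 1 = 1" "dt 0 = 0" "dt (adj A) = dt A"
  by (cases A; simp add: one_mat_def zero_mat_def power2_eq_square algebra_simps)+
lemma adj_simps [simp]: "adj (A * B) = adj B * adj A" "adj (adj A) = A" "tr (adj A) = tr A"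
   "adj (- A) = - adj A" "adj 1 = 1" "adj (k *s A) = k *s adj A"
  by (cases A; cases B; simp add: one_mat_def algebra_simps)+
lemma mult_adj: "A * adj A = dt A *s 1" "adj A * A = dt A *s 1"
  by (cases A; simp add: one_mat_def algebra_simps)+
lemma adj_eq: "adj A = tr A *s 1 - A" by (cases A) (simp add: one_mat_def)
text \<open>Polarized Cayley-Hamilton. For traceless matrices, orthogonality under the trace form
  therefore means anticommuting.\<close>

lemma anticommutator: "A * B + B * A = tr A *s B + tr B *s A + (tr (A * B) - tr A * tr B) *s 1"
  by (cases A; cases B) (simp add: one_mat_def algebra_simps)
lemma cayley_hamilton: "A * A = tr A *s A - dt A *s 1"
  by (cases A) (simp add: one_mat_def algebra_simps)
text \<open>The bracket acts as a cross product: it is traceless and orthogonal to both factors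
  under the trace form.\<close>

lemma tr_bracket [simp]: "tr (bracket A B) = 0" "tr (A * bracket A B) = 0" "tr (B * bracket A B) = 0"
  by (cases A; cases B; simp add: bracket_def algebra_simps)+

section \<open>Reduction modulo p; \<open>SL2\<close> and \<open>PSL2\<close> in terms of integer
  matrices\<close>

definition red :: "int \<Rightarrow> mat \<Rightarrow> mat2" where
  "red p A = (case A of Mat a b c d \<Rightarrow> (a mod p, b mod p, c mod p, d mod p))"

definition unred :: "mat2 \<Rightarrow> mat" where
  "unred x = (case x of (a, b, c, d) \<Rightarrow> Mat a b c d)"

lemma red_M: "red p (Mat a b c d) = (a mod p, b mod p, c mod p, d mod p)" by (simp add: red_def)
lemma red_unred_red [simp]: "red p (unred (red p A)) = red p A" by (cases A) (simp add: red_def unred_def)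

lemma mat2_mult_red: "mat2_mult p x y = red p (unred x * unred y)"
  by (cases x; cases y) (simp add: mat2_mult_def red_def unred_def)

text \<open>The element of \<open>PSL2 p\<close> represented by \<open>A\<close>, as a coset of the
  centre; see \<open>center_coset\<close>.\<close>

definition cl :: "int \<Rightarrow> mat \<Rightarrow> mat2 set" where
  "cl p A = {red p A, red p (- A)}"

locale psl =
  fixes p :: int
  assumes prime_p: "prime p" and p_gt: "p > 7"
begin

lemmas cong_arith = cong_add cong_diff cong_mult cong_refl

definition eqm :: "mat \<Rightarrow> mat \<Rightarrow> bool" (infix "\<approx>" 50) where "A \<approx> B \<longleftrightarrow> red p A = red p B"

lemma eqm_iff: "Mat a b c d \<approx> Mat e f g h \<longleftrightarrow> p dvd a - e \<and> p dvd b - f \<and> p dvd c - g \<and> p dvd d - h"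
  by (auto simp: eqm_def red_def mod_eq_dvd_iff)

lemma eqm_refl [simp, intro]: "A \<approx> A" by (simp add: eqm_def)
lemma eqm_sym: "A \<approx> B \<Longrightarrow> B \<approx> A" by (simp add: eqm_def)
lemma eqm_trans [trans]: "A \<approx> B \<Longrightarrow> B \<approx> C \<Longrightarrow> A \<approx> C" by (simp add: eqm_def)
lemma eqm_add: "A \<approx> B \<Longrightarrow> C \<approx> E \<Longrightarrow> A + C \<approx> B + E"
  by (cases A; cases B; cases C; cases E) (auto simp: eqm_def red_def intro: mod_add_cong)
lemma eqm_diff: "A \<approx> B \<Longrightarrow> C \<approx> E \<Longrightarrow> A - C \<approx> B - E"
  by (cases A; cases B; cases C; cases E) (auto simp: eqm_def red_def intro: mod_diff_cong)
lemma eqm_uminus: "A \<approx> B \<Longrightarrow> - A \<approx> - B"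
  by (cases A; cases B) (auto simp: eqm_def red_def intro: mod_minus_cong)
lemma eqm_mult: "A \<approx> B \<Longrightarrow> C \<approx> E \<Longrightarrow> A * C \<approx> B * E"
  by (cases A; cases B; cases C; cases E)
    (auto simp: eqm_def red_def intro!: mod_add_cong mod_mult_cong)
lemma eqm_sm: "A \<approx> B \<Longrightarrow> [k = l] (mod p) \<Longrightarrow> k *s A \<approx> l *s B"
  by (cases A; cases B) (auto simp: eqm_def red_def cong_def intro: mod_mult_cong)
lemma eqm_adj: "A \<approx> B \<Longrightarrow> adj A \<approx> adj B"
  by (cases A; cases B) (auto simp: eqm_def red_def intro: mod_minus_cong)
lemma eqm_tr: "A \<approx> B \<Longrightarrow> [tr A = tr B] (mod p)"
  by (cases A; cases B) (auto simp: eqm_def red_def cong_def intro: mod_add_cong)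
lemma eqm_dt: "A \<approx> B \<Longrightarrow> [dt A = dt B] (mod p)"
  by (cases A; cases B) (auto simp: eqm_def red_def cong_def intro!: mod_diff_cong mod_mult_cong)
lemma eqm_bracket: "A \<approx> B \<Longrightarrow> C \<approx> E \<Longrightarrow> bracket A C \<approx> bracket B E"
  by (simp add: bracket_def eqm_mult eqm_diff)

definition SL :: "mat \<Rightarrow> bool" where "SL A \<longleftrightarrow> [dt A = 1] (mod p)"

lemma SL_mult: "SL A \<Longrightarrow> SL B \<Longrightarrow> SL (A * B)" unfolding SL_def by (metis cong_mult dt_mult mult_1)
lemma SL_simps [simp]: "SL (adj A) \<longleftrightarrow> SL A" "SL (- A) \<longleftrightarrow> SL A" "SL 1" by (simp_all add: SL_def)
lemma SL_eqm: "A \<approx> B \<Longrightarrow> SL A \<Longrightarrow> SL B" unfolding SL_def by (metis cong_sym cong_trans eqm_dt)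

lemma adj_inv: assumes "SL A" shows "A * adj A \<approx> 1" "adj A * A \<approx> 1"
  using eqm_sm[OF eqm_refl[of 1] assms[unfolded SL_def]] by (simp_all add: mult_adj)

lemma unred_red: "unred (red p A) \<approx> A" by (simp add: eqm_def)
lemma SL_unred_red [simp]: "SL (unred (red p A)) \<longleftrightarrow> SL A" using SL_eqm unred_red eqm_sym by blast

lemma red_eqI: "A \<approx> B \<Longrightarrow> red p A = red p B" by (simp add: eqm_def)

lemma carrier_SL2: "carrier (SL2 p) = red p ` Collect SL"
proof -
  have p1: "1 < p" using p_gt by simp
  have *: "x mod p = x \<longleftrightarrow> 0 \<le> x \<and> x < p" for x
    using p1 by (metis mod_pos_pos_trivial pos_mod_bound pos_mod_sign order_less_trans zero_less_one)
  have in_carrier: "x \<in> carrier (SL2 p) \<longleftrightarrow> red p (unred x) = x \<and> SL (unred x)" for x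
  proof -
    obtain a b c d where x: "x = (a, b, c, d)" by (cases x)
    show ?thesis using p1 by (auto simp: x SL2_def red_def unred_def SL_def cong_def *)
  qed
  show ?thesis
  proof (rule equalityI; rule subsetI)
    fix x assume "x \<in> carrier (SL2 p)"
    then show "x \<in> red p ` Collect SL" unfolding in_carrier by (intro image_eqI[of _ _ "unred x"]) simp_all
  next
    fix x assume "x \<in> red p ` Collect SL"
    then obtain A where "x = red p A" "SL A" by blast
    then show "x \<in> carrier (SL2 p)" by (simp add: in_carrier)
  qed
qed

lemma mult_SL2: "red p A \<otimes>\<^bsub>SL2 p\<^esub> red p B = red p (A * B)"
  by (simp add: SL2_def mat2_mult_red) (rule red_eqI[OF eqm_mult[OF unred_red unred_red]])
lemma one_SL2: "\<one>\<^bsub>SL2 p\<^esub> = red p 1" using p_gt by (simp add: SL2_def one_mat_def red_def)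

lemma group_SL2: "group (SL2 p)"
proof (rule groupI)
  show "\<one>\<^bsub>SL2 p\<^esub> \<in> carrier (SL2 p)" unfolding carrier_SL2 one_SL2 by simp
next
  fix x y assume "x \<in> carrier (SL2 p)" "y \<in> carrier (SL2 p)"
  then obtain A B where "x = red p A" "y = red p B" "SL A" "SL B" unfolding carrier_SL2 by blast
  then show "x \<otimes>\<^bsub>SL2 p\<^esub> y \<in> carrier (SL2 p)" by (simp add: mult_SL2 carrier_SL2 SL_mult)
next
  fix x y z assume "x \<in> carrier (SL2 p)" "y \<in> carrier (SL2 p)" "z \<in> carrier (SL2 p)"
  then obtain A B C where "x = red p A" "y = red p B" "z = red p C" unfolding carrier_SL2 by blast
  then show "x \<otimes>\<^bsub>SL2 p\<^esub> y \<otimes>\<^bsub>SL2 p\<^esub> z = x \<otimes>\<^bsub>SL2 p\<^esub> (y \<otimes>\<^bsub>SL2 p\<^esub> z)"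
    by (simp add: mult_SL2 mult.assoc)
next
  fix x assume x: "x \<in> carrier (SL2 p)"
  then obtain A where A: "x = red p A" "SL A" by (auto simp: carrier_SL2)
  show "\<one>\<^bsub>SL2 p\<^esub> \<otimes>\<^bsub>SL2 p\<^esub> x = x" by (simp add: mult_SL2 one_SL2 A)
  show "\<exists>y\<in>carrier (SL2 p). y \<otimes>\<^bsub>SL2 p\<^esub> x = \<one>\<^bsub>SL2 p\<^esub>"
  proof (rule bexI)
    show "red p (adj A) \<otimes>\<^bsub>SL2 p\<^esub> x = \<one>\<^bsub>SL2 p\<^esub>"
      using adj_inv(2)[OF A(2)] by (simp add: mult_SL2 one_SL2 A eqm_def)
    show "red p (adj A) \<in> carrier (SL2 p)" using A by (simp add: carrier_SL2)
  qed
qed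

lemma center_cl: "SL2_center p = cl p 1"
  using p_gt by (simp add: SL2_center_def cl_def one_mat_def red_M zmod_minus1)

lemma center_coset: "SL2_center p #>\<^bsub>SL2 p\<^esub> red p A = cl p A"
  "red p A <#\<^bsub>SL2 p\<^esub> SL2_center p = cl p A"
  by (simp_all add: r_coset_def l_coset_def center_cl cl_def mult_SL2 insert_commute)

lemma center_normal: "SL2_center p \<lhd> SL2 p"
proof -
  interpret group "SL2 p" by (rule group_SL2)
  have "subgroup (SL2_center p) (SL2 p)"
  proof (rule subgroupI)
    show c: "SL2_center p \<subseteq> carrier (SL2 p)" by (simp add: center_cl cl_def carrier_SL2)
    show "SL2_center p \<noteq> {}" by (simp add: SL2_center_def)
    show "\<And>a b. a \<in> SL2_center p \<Longrightarrow> b \<in> SL2_center p \<Longrightarrow> a \<otimes>\<^bsub>SL2 p\<^esub> b \<in> SL2_center p"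
      by (auto simp: center_cl cl_def mult_SL2)
    fix a assume a: "a \<in> SL2_center p"
    then have "a \<otimes>\<^bsub>SL2 p\<^esub> a = \<one>\<^bsub>SL2 p\<^esub>" by (auto simp: center_cl cl_def mult_SL2 one_SL2)
    then show "inv\<^bsub>SL2 p\<^esub> a \<in> SL2_center p"
      using a c by (metis inv_equality subsetD)
  qed
  then show ?thesis
    by (rule normalI) (auto simp: carrier_SL2 center_coset)
qed

lemma group_PSL2: "group (PSL2 p)"
  unfolding PSL2_def by (rule normal.factorgroup_is_group[OF center_normal])

lemma carrier_PSL2: "carrier (PSL2 p) = cl p ` Collect SL"
  by (simp add: PSL2_def carrier_FactGroup carrier_SL2 center_coset image_image)

lemma cl_in: "SL A \<Longrightarrow> cl p A \<in> carrier (PSL2 p)" by (simp add: carrier_PSL2)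

lemma one_PSL2: "\<one>\<^bsub>PSL2 p\<^esub> = cl p 1" by (simp add: PSL2_def center_cl)

lemma cl_mult: assumes "SL A" "SL B" shows "cl p A \<otimes>\<^bsub>PSL2 p\<^esub> cl p B = cl p (A * B)"
proof -
  interpret normal "SL2_center p" "SL2 p" by (rule center_normal)
  have "red p A \<in> carrier (SL2 p)" "red p B \<in> carrier (SL2 p)" using assms by (simp_all add: carrier_SL2)
  from rcos_sum[OF this] show ?thesis
    by (simp add: center_coset PSL2_def mult_SL2)
qed

lemma cl_eq_iff: "cl p A = cl p B \<longleftrightarrow> A \<approx> B \<or> A \<approx> - B"
proof -
  have "A \<approx> - B \<Longrightarrow> - A \<approx> B" "A \<approx> B \<Longrightarrow> - A \<approx> - B" using eqm_uminus by fastforce+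
  then show ?thesis unfolding cl_def eqm_def doubleton_eq_iff by auto
qed

lemma cl_inv: assumes "SL A" shows "inv\<^bsub>PSL2 p\<^esub> cl p A = cl p (adj A)"
proof -
  interpret group "PSL2 p" by (rule group_PSL2)
  have "cl p (adj A) \<otimes>\<^bsub>PSL2 p\<^esub> cl p A = \<one>\<^bsub>PSL2 p\<^esub>"
    using assms adj_inv(2)[OF assms] by (simp add: cl_mult one_PSL2 cl_eq_iff)
  then show ?thesis using assms by (intro inv_equality) (simp_all add: cl_in)
qed

section \<open>Divisibility by p, scalar matrices and centralizers\<close>

lemma p_dvd_mult [simp]: "p dvd a * b \<longleftrightarrow> p dvd a \<or> p dvd b"
  using prime_p by (rule prime_dvd_mult_iff)
lemma p_dvd_power [simp]: "p dvd a ^ 2 \<longleftrightarrow> p dvd a"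
  by (simp add: power2_eq_square)

lemma not_p_dvd: "0 < k \<Longrightarrow> k < p \<Longrightarrow> \<not> p dvd k" by (rule zdvd_not_zless)

lemma not_p_dvd_numerals [simp]:
  "\<not> p dvd 1" "\<not> p dvd 2" "\<not> p dvd 3" "\<not> p dvd 4" "\<not> p dvd 6" "\<not> p dvd 7" "\<not> p dvd 8"
proof -
  show "\<not> p dvd 1" "\<not> p dvd 2" "\<not> p dvd 3" "\<not> p dvd 4" "\<not> p dvd 6" "\<not> p dvd 7"
    using p_gt by (simp_all add: not_p_dvd)
  \<comment> \<open>The bound p > 7 alone does not exclude p = 8; primality does.\<close>
  have "p dvd 8 \<longleftrightarrow> p dvd 2 * 4" by simp
  then show "\<not> p dvd 8" using \<open>\<not> p dvd 2\<close> \<open>\<not> p dvd 4\<close> p_dvd_mult by blast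
qed

lemma inverse_mod_p:
  assumes "\<not> p dvd a"
  obtains b where "[a * b = 1] (mod p)"
  using assms prime_p cong_solve_coprime_int[of a p] prime_imp_coprime[of p a]
  by (metis coprime_commute)

lemma p_not_unit [simp]: "\<bar>p\<bar> \<noteq> 1" "p \<noteq> 1" using p_gt by simp_all

lemma cong_dvd_iff: "[a = b] (mod p) \<Longrightarrow> p dvd a \<longleftrightarrow> p dvd b"
  by (rule cong_dvd_iff)

lemma inverse_not_dvd: "[a * b = 1] (mod p) \<Longrightarrow> \<not> p dvd a \<and> \<not> p dvd b"
  using cong_dvd_iff[of "a * b" 1] not_p_dvd_numerals(1) p_dvd_mult by blast

text \<open>With \<open>i\<close> inverse to \<open>r\<close>, this turns the vanishing of a 2 by 2
  minor into proportionality with the explicit factor \<open>v * i\<close>.\<close>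

lemma divide_mod_p:
  assumes "p dvd r * i - 1" "p dvd u * r - v * s" shows "p dvd u - v * i * s"
proof -
  have "u - v * i * s = i * (u * r - v * s) - u * (r * i - 1)" by (simp add: algebra_simps)
  then show ?thesis using assms by (metis dvd_diff dvd_mult)
qed

definition central :: "mat \<Rightarrow> bool" where "central A \<longleftrightarrow> (\<exists>k. A \<approx> k *s 1)"

lemma central_iff: "central (Mat a b c d) \<longleftrightarrow> p dvd b \<and> p dvd c \<and> p dvd a - d"
proof
  assume "central (Mat a b c d)"
  then obtain k where "Mat a b c d \<approx> k *s 1" by (auto simp: central_def)
  then show "p dvd b \<and> p dvd c \<and> p dvd a - d"
    using dvd_diff[of p "a - k" "d - k"] by (auto simp: one_mat_def eqm_iff)
next
  assume "p dvd b \<and> p dvd c \<and> p dvd a - d"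
  then have "Mat a b c d \<approx> d *s 1" by (simp add: one_mat_def eqm_iff)
  then show "central (Mat a b c d)" unfolding central_def by blast
qed

lemma central_eqm: "A \<approx> B \<Longrightarrow> central A \<longleftrightarrow> central B"
  unfolding central_def by (meson eqm_sym eqm_trans)

lemma central_uminus [simp]: "central (- A) \<longleftrightarrow> central A"
proof (cases A)
  case (Mat a b c d)
  have "p dvd d - a \<longleftrightarrow> p dvd a - d" by (rule dvd_diff_commute)
  then show ?thesis by (simp add: Mat central_iff)
qed

lemma eqm_0_iff: "Mat a b c d \<approx> 0 \<longleftrightarrow> p dvd a \<and> p dvd b \<and> p dvd c \<and> p dvd d"
  by (simp add: zero_mat_def eqm_iff)

lemma eqm_diff_iff: "A \<approx> B \<longleftrightarrow> A - B \<approx> 0"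
  by (cases A; cases B) (simp add: zero_mat_def eqm_iff)

lemma sm_eqm_0: "k *s A \<approx> 0 \<longleftrightarrow> p dvd k \<or> A \<approx> 0"
  by (cases A) (auto simp: eqm_0_iff)

lemma traceless_central:
  assumes "p dvd tr V" shows "central V \<longleftrightarrow> V \<approx> 0"
proof (cases V)
  case (Mat a b c d)
  have "p dvd a - d \<longleftrightarrow> p dvd a \<and> p dvd d"
  proof
    assume "p dvd a - d"
    with assms have "p dvd (a - d) + (a + d)" "p dvd (a + d) - (a - d)" unfolding Mat tr.simps by (blast intro: dvd_add dvd_diff)+
    moreover have "(a - d) + (a + d) = 2 * a" "(a + d) - (a - d) = 2 * d" by simp_all
    ultimately show "p dvd a \<and> p dvd d" by (metis p_dvd_mult not_p_dvd_numerals(2))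
  qed (simp add: dvd_diff)
  then show ?thesis by (auto simp: Mat central_iff eqm_0_iff)
qed

lemma SL_central:
  assumes "SL A" "central A" shows "A \<approx> 1 \<or> A \<approx> - 1"
proof -
  obtain k where k: "A \<approx> k *s 1" using assms by (auto simp: central_def)
  then have "[k^2 = 1] (mod p)" using eqm_dt[OF k] assms(1) unfolding SL_def by (simp add: cong_def)
  then have "p dvd k^2 - 1" by (simp add: cong_iff_dvd_diff)
  moreover have "k^2 - 1 = (k - 1) * (k + 1)" by (simp add: power2_eq_square algebra_simps)
  ultimately have "p dvd k - 1 \<or> p dvd k + 1" by simp
  then have "k *s 1 \<approx> 1 \<or> k *s 1 \<approx> - 1" by (auto simp: one_mat_def eqm_iff)
  with k show ?thesis using eqm_trans by blast
qed

lemma cl_one_iff: "SL A \<Longrightarrow> cl p A = cl p 1 \<longleftrightarrow> central A"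
  unfolding cl_eq_iff
proof (intro iffI; (elim disjE)?)
  assume "SL A"
  then show "central A \<Longrightarrow> A \<approx> 1 \<or> A \<approx> - 1" by (rule SL_central)
  show "A \<approx> 1 \<Longrightarrow> central A" unfolding central_def by (intro exI[of _ 1]) simp
  show "A \<approx> - 1 \<Longrightarrow> central A" unfolding central_def by (intro exI[of _ "-1"]) (simp add: sm_distrib)
qed

text \<open>Commuting means that the vectors (b, c, a - d) of the two matrices have vanishing 2 by 2
  minors. The vector of a nonscalar \<open>X\<close> has an invertible coordinate, and dividing by
  it gives \<open>k\<close>.\<close>

lemma commute_imp_affine:
  assumes "\<not> central X" "X * Y \<approx> Y * X"
  obtains k l where "Y \<approx> k *s X + l *s 1"
proof -
  obtain a b c d where X: "X = Mat a b c d" by (cases X)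
  obtain e f g h where Y: "Y = Mat e f g h" by (cases Y)
  have m: "p dvd b * g - c * f" "p dvd f * (a - d) - b * (e - h)" "p dvd c * (e - h) - g * (a - d)"
    using assms(2) unfolding X Y times_mat.simps eqm_iff by (simp_all add: algebra_simps)
  have "\<exists>k. p dvd f - k * b \<and> p dvd g - k * c \<and> p dvd (e - h) - k * (a - d)"
  proof -
    have aux: "\<exists>k. p dvd v1 - k * u1 \<and> p dvd v2 - k * u2 \<and> p dvd v3 - k * u3"
      if "\<not> p dvd u1" and d: "p dvd v2 * u1 - v1 * u2" "p dvd v3 * u1 - v1 * u3" for u1 u2 u3 v1 v2 v3
    proof -
      obtain i where "[u1 * i = 1] (mod p)" using inverse_mod_p \<open>\<not> p dvd u1\<close> by blast
      then have "p dvd u1 * i - 1" by (simp add: cong_iff_dvd_diff)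
      note divide_mod_p[OF this]
      from this[OF d(1)] this[OF d(2)] this[of v1 v1 u1] show ?thesis by (intro exI[of _ "v1 * i"]) simp
    qed
    note m' = m[THEN dvd_diff_commute[THEN iffD1]]
    consider "\<not> p dvd b" | "\<not> p dvd c" | "\<not> p dvd a - d" using assms(1) by (auto simp: X central_iff)
    then show ?thesis
    proof cases
      case 1
      show ?thesis using aux[where ?u1.0=b and ?v1.0=f and ?u2.0=c and ?v2.0=g and ?u3.0="a-d" and ?v3.0="e-h"] 1 m(1) m'(2)
        by (simp add: mult.commute)
    next
      case 2
      show ?thesis using aux[where ?u1.0=c and ?v1.0=g and ?u2.0=b and ?v2.0=f and ?u3.0="a-d" and ?v3.0="e-h"] 2 m(3) m'(1)
        by (simp add: mult.commute conj_ac)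
    next
      case 3
      show ?thesis using aux[where ?u1.0="a-d" and ?v1.0="e-h" and ?u2.0=b and ?v2.0=f and ?u3.0=c and ?v3.0=g] 3 m(2) m'(3)
        by (simp add: mult.commute conj_ac)
    qed
  qed
  then obtain k where k: "p dvd f - k * b" "p dvd g - k * c" "p dvd (e - h) - k * (a - d)" by blast
  have "p dvd - ((e - h) - k * (a - d))" using k(3) by (simp only: dvd_minus_iff)
  then have "Y \<approx> k *s X + (e - k * a) *s 1"
    using k by (simp add: X Y one_mat_def eqm_iff algebra_simps)
  then show thesis by (rule that)
qed

text \<open>A nonzero nilpotent \<open>V\<close> is a product u w of a column and a row with w u =
  0. The trace condition says w X u = 0, so X u lies in the kernel of w, which is spanned by
  u.\<close>

lemma null_eigen:
  assumes "p dvd tr V" "p dvd dt V" "\<not> V \<approx> 0" "p dvd tr (X * V)"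
  obtains l where "X * V \<approx> l *s V"
proof -
  obtain h b c h' where V: "V = Mat h b c h'" by (cases V)
  obtain x y z w where X: "X = Mat x y z w" by (cases X)
  have "p dvd h + h'" using assms(1) by (simp add: V)
  then have "p dvd h' + h" by (simp add: add.commute)
  then have V0: "V \<approx> Mat h b c (- h)" by (simp add: V eqm_iff)
  define n where "n = h * h + b * c"
  define q where "q = x * h + y * c + z * b - w * h"
  have "p dvd dt (Mat h b c (- h))" using eqm_dt[OF V0] assms(2) cong_dvd_iff by blast
  moreover have "dt (Mat h b c (- h)) = - n" by (simp add: n_def)
  ultimately have n: "p dvd n" by (metis dvd_minus_iff)
  have "p dvd tr (X * Mat h b c (- h))"
    using eqm_tr[OF eqm_mult[OF eqm_refl[of X] V0]] assms(4) cong_dvd_iff by blast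
  then have q: "p dvd q" by (simp add: X q_def algebra_simps)
  have "\<not> p dvd b \<or> \<not> p dvd c"
  proof (rule ccontr)
    assume "\<not> ?thesis"
    then have bc: "p dvd b" "p dvd c" by auto
    have "h * h = n - b * c" by (simp add: n_def)
    then have "p dvd h * h" using n bc by (metis dvd_diff dvd_mult)
    then have "p dvd h" by simp
    with bc have "Mat h b c (- h) \<approx> 0" by (simp add: eqm_0_iff)
    with V0 assms(3) show False using eqm_trans by blast
  qed
  then have "\<exists>l. X * Mat h b c (- h) \<approx> l *s Mat h b c (- h)"
  proof
    assume "\<not> p dvd b"
    then obtain i where "[b * i = 1] (mod p)" using inverse_mod_p by blast
    then have i: "p dvd b * i - 1" by (simp add: cong_iff_dvd_diff)
    \<comment> \<open>The entry \<open>b\<close> serves as pivot. Each minor formed by an entry of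
      the product and one of \<open>V\<close> is a combination of \<open>n\<close> and
      \<open>q\<close>, both divisible by p; the last argument given to \<open>pull\<close> is this
      combination.\<close>
    have pull: "p dvd u - v * i * s" if "u * b - v * s = r" "p dvd r" for u v s r
      using divide_mod_p[OF i] that by simp
    define v where "v = x * b - y * h"
    have "p dvd (x * h + y * c) - v * i * h"
      by (rule pull[of _ _ _ "y * n"], simp add: v_def n_def algebra_simps, use n q in simp)
    moreover have "p dvd (x * b - y * h) - v * i * b"
      by (rule pull[of _ _ _ "0"], simp add: v_def algebra_simps, use n q in simp)
    moreover have "p dvd (z * h + w * c) - v * i * c"
      by (rule pull[of _ _ _ "h * q + (w - x) * n"], simp add: v_def n_def q_def algebra_simps, use n q in simp)
    moreover have "p dvd (z * b - w * h) - v * i * (- h)"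
      by (rule pull[of _ _ _ "b * q - y * n"], simp add: v_def n_def q_def algebra_simps, use n q in simp)
    ultimately have "X * Mat h b c (- h) \<approx> (v * i) *s Mat h b c (- h)" by (simp add: X eqm_iff)
    then show ?thesis by blast
  next
    assume "\<not> p dvd c"
    then obtain i where "[c * i = 1] (mod p)" using inverse_mod_p by blast
    then have i: "p dvd c * i - 1" by (simp add: cong_iff_dvd_diff)
    have pull: "p dvd u - v * i * s" if "u * c - v * s = r" "p dvd r" for u v s r
      using divide_mod_p[OF i] that by simp
    define v where "v = z * h + w * c"
    have "p dvd (x * h + y * c) - v * i * h"
      by (rule pull[of _ _ _ "c * q - z * n"], simp add: v_def n_def q_def algebra_simps, use n q in simp)
    moreover have "p dvd (x * b - y * h) - v * i * b"
      by (rule pull[of _ _ _ "- (h * q + (w - x) * n)"], simp add: v_def n_def q_def algebra_simps, use n q in simp)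
    moreover have "p dvd (z * h + w * c) - v * i * c"
      by (rule pull[of _ _ _ "0"], simp add: v_def algebra_simps, use n q in simp)
    moreover have "p dvd (z * b - w * h) - v * i * (- h)"
      by (rule pull[of _ _ _ "z * n"], simp add: v_def n_def q_def algebra_simps, use n q in simp)
    ultimately have "X * Mat h b c (- h) \<approx> (v * i) *s Mat h b c (- h)" by (simp add: X eqm_iff)
    then show ?thesis by blast
  qed
  then obtain l where "X * Mat h b c (- h) \<approx> l *s Mat h b c (- h)" ..
  with eqm_mult[OF eqm_refl[of X] V0] eqm_sm[OF eqm_sym[OF V0], of l l] have "X * V \<approx> l *s V"
    using eqm_trans by (meson cong_refl)
  then show thesis by (rule that)
qed

section \<open>Conjugation and stabilized lines\<close>

text \<open>For \<open>X\<close> of determinant 1 this says that conjugation by \<open>X\<close>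
  takes \<open>V\<close> to \<open>k *s W\<close>; the form avoids the inverse of
  \<open>X\<close>.\<close>

definition intertwines :: "int \<Rightarrow> mat \<Rightarrow> mat \<Rightarrow> mat \<Rightarrow> bool" where
  "intertwines k X V W \<longleftrightarrow> X * V \<approx> k *s (W * X)"

lemma intertwines_mult:
  assumes "intertwines k X W Z" "intertwines l Y V W"
  shows "intertwines (k * l) (X * Y) V Z"
proof -
  have "X * Y * V \<approx> X * (l *s (W * Y))"
    using assms(2) eqm_mult[OF eqm_refl[of X]] unfolding intertwines_def mult.assoc by blast
  also have "X * (l *s (W * Y)) = l *s (X * W * Y)" by (simp add: mult.assoc)
  also have "\<dots> \<approx> l *s ((k *s (Z * X)) * Y)"
    using assms(1) unfolding intertwines_def by (intro eqm_sm eqm_mult) simp_all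
  finally show ?thesis by (simp add: intertwines_def mult.assoc mult.commute)
qed

lemma intertwines_adj:
  assumes "SL X" "intertwines k X V W" "[k * l = 1] (mod p)"
  shows "intertwines l (adj X) W V"
proof -
  have "adj X * W \<approx> adj X * W * (X * adj X)"
    using eqm_mult[OF eqm_refl[of "adj X * W"] eqm_sym[OF adj_inv(1)[OF assms(1)]]] by simp
  also have "\<dots> \<approx> (l * k) *s (adj X * W * (X * adj X))"
    using eqm_sm[OF eqm_refl assms(3), of "adj X * W * (X * adj X)"] by (simp add: mult.commute eqm_sym)
  also have "\<dots> = l *s (adj X * (k *s (W * X)) * adj X)" by (simp add: mult.assoc)
  also have "\<dots> \<approx> l *s (adj X * (X * V) * adj X)"
    using eqm_sym[OF assms(2)[unfolded intertwines_def]] by (intro eqm_sm eqm_mult) simp_all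
  also have "\<dots> \<approx> l *s (1 * V * adj X)"
    unfolding mult.assoc[symmetric] using adj_inv(2)[OF assms(1)] by (intro eqm_sm eqm_mult) simp_all
  finally show ?thesis by (simp add: intertwines_def)
qed

lemma intertwines_cong: "intertwines k X V W \<Longrightarrow> [k = l] (mod p) \<Longrightarrow> intertwines l X V W"
  unfolding intertwines_def using eqm_trans eqm_sm[OF eqm_refl] by blast

lemma intertwines_one: "intertwines 1 1 V V" by (simp add: intertwines_def)

lemma SL_commutator: "SL X \<Longrightarrow> SL Y \<Longrightarrow> SL (X * Y * adj X * adj Y)" by (simp add: SL_mult)

lemma cl_commutator:
  assumes "SL A" "SL B"
  shows "cl p A \<otimes>\<^bsub>PSL2 p\<^esub> cl p B \<otimes>\<^bsub>PSL2 p\<^esub> inv\<^bsub>PSL2 p\<^esub> cl p A \<otimes>\<^bsub>PSL2 p\<^esub> inv\<^bsub>PSL2 p\<^esub> cl p B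
    = cl p (A * B * adj A * adj B)"
  using assms by (simp add: cl_inv cl_mult SL_mult)

text \<open>Transfers \<open>solvable_generate_chain\<close> to sets of matrices; the last set need
  only consist of scalars, since these are trivial in \<open>PSL2 p\<close>.\<close>

lemma solvable_matrix_chain:
  fixes T :: "nat \<Rightarrow> mat set"
  assumes D: "\<And>i A. A \<in> T i \<Longrightarrow> SL A" and one: "\<And>i. 1 \<in> T i"
    and mult: "\<And>i A B. \<lbrakk>A \<in> T i; B \<in> T i\<rbrakk> \<Longrightarrow> A * B \<in> T i"
    and adj: "\<And>i A. A \<in> T i \<Longrightarrow> adj A \<in> T i"
    and comm: "\<And>i A B. \<lbrakk>A \<in> T i; B \<in> T i\<rbrakk> \<Longrightarrow> A * B * adj A * adj B \<in> T (Suc i)"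
    and triv: "\<And>A. A \<in> T n \<Longrightarrow> central A"
    and "X \<in> T 0" "Y \<in> T 0"
  shows "solvable ((PSL2 p)\<lparr>carrier := generate (PSL2 p) {cl p X, cl p Y}\<rparr>)"
proof -
  interpret group "PSL2 p" by (rule group_PSL2)
  show ?thesis
  proof (rule solvable_generate_chain[where S = "\<lambda>i. cl p ` T i" and n = n])
    fix i
    show "subgroup (cl p ` T i) (PSL2 p)"
    proof (rule subgroupI)
      show "cl p ` T i \<subseteq> carrier (PSL2 p)" using D by (auto simp: cl_in)
      show "cl p ` T i \<noteq> {}" using one by blast
    next
      fix a assume "a \<in> cl p ` T i"
      then show "inv\<^bsub>PSL2 p\<^esub> a \<in> cl p ` T i" using adj by (auto simp: cl_inv D)
    next
      fix a b assume "a \<in> cl p ` T i" "b \<in> cl p ` T i"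
      then show "a \<otimes>\<^bsub>PSL2 p\<^esub> b \<in> cl p ` T i" using mult by (auto simp: cl_mult D)
    qed
  next
    fix i a b assume "a \<in> cl p ` T i" "b \<in> cl p ` T i"
    then show "a \<otimes>\<^bsub>PSL2 p\<^esub> b \<otimes>\<^bsub>PSL2 p\<^esub> inv\<^bsub>PSL2 p\<^esub> a \<otimes>\<^bsub>PSL2 p\<^esub> inv\<^bsub>PSL2 p\<^esub> b \<in> cl p ` T (Suc i)"
      using comm by (auto simp: cl_commutator D)
  next
    have "cl p A = cl p 1" if "A \<in> T n" for A using triv[OF that] cl_one_iff[OF D[OF that]] by simp
    then have "cl p ` T n \<subseteq> {cl p 1}" by blast
    moreover have "cl p 1 \<in> cl p ` T n" using one by (rule imageI)
    ultimately show "cl p ` T n = {\<one>\<^bsub>PSL2 p\<^esub>}" unfolding one_PSL2 by blast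
  next
    show "{cl p X, cl p Y} \<subseteq> cl p ` T 0" using assms by simp
  qed
qed

lemma commuting_commutator:
  assumes "SL X" "SL Y" "X * Y \<approx> Y * X" shows "X * Y * adj X * adj Y \<approx> 1"
proof -
  have "X * Y * adj X * adj Y \<approx> Y * X * adj X * adj Y"
    by (intro eqm_mult[OF _ eqm_refl] assms(3))
  also have "\<dots> = Y * (X * adj X) * adj Y" by (simp add: mult.assoc)
  also have "\<dots> \<approx> Y * 1 * adj Y"
    by (intro eqm_mult[OF _ eqm_refl] eqm_mult[OF eqm_refl] adj_inv(1)[OF assms(1)])
  also have "\<dots> \<approx> 1" using adj_inv(1)[OF assms(2)] by simp
  finally show ?thesis .
qed

text \<open>Conjugation by \<open>X\<close> maps the line of \<open>V\<close> to itself;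
  \<open>l\<close> witnesses that the scalar \<open>k\<close> is a unit.\<close>

definition stabilizes :: "mat \<Rightarrow> mat \<Rightarrow> bool" where
  "stabilizes X V \<longleftrightarrow> (\<exists>k l. [k * l = 1] (mod p) \<and> intertwines k X V V)"

lemma stabilizes_one: "stabilizes 1 V"
  unfolding stabilizes_def by (intro exI[of _ 1]) (simp add: intertwines_one)

lemma stabilizes_mult: assumes "stabilizes X V" "stabilizes Y V" shows "stabilizes (X * Y) V"
proof -
  obtain k l m n where "[k * l = 1] (mod p)" "[m * n = 1] (mod p)" "intertwines k X V V" "intertwines m Y V V"
    using assms unfolding stabilizes_def by blast
  then have "intertwines (k * m) (X * Y) V V" "[(k * m) * (l * n) = 1] (mod p)"
    using cong_mult[of "k * l" 1 p "m * n" 1] by (simp_all add: intertwines_mult mult_ac)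
  then show ?thesis unfolding stabilizes_def by blast
qed

lemma stabilizes_adj: "SL X \<Longrightarrow> stabilizes X V \<Longrightarrow> stabilizes (adj X) V"
  unfolding stabilizes_def by (metis intertwines_adj mult.commute)

text \<open>The action on the line is through scalars, which commute, so a commutator acts by
  1.\<close>

lemma stabilizes_commutator:
  assumes "SL X" "SL Y" "stabilizes X V" "stabilizes Y V"
  shows "intertwines 1 (X * Y * adj X * adj Y) V V"
proof -
  obtain k l m n where kl: "[k * l = 1] (mod p)" "[m * n = 1] (mod p)" and "intertwines k X V V" "intertwines m Y V V"
    using assms unfolding stabilizes_def by blast
  then have "intertwines (k * m * l * n) (X * Y * adj X * adj Y) V V"
    using assms(1,2) by (intro intertwines_mult intertwines_adj)
  moreover have "[k * m * l * n = 1] (mod p)" using cong_mult[OF kl] by (simp add: mult_ac)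
  ultimately show ?thesis by (rule intertwines_cong)
qed

text \<open>Both matrices lie in the commutative algebra generated by \<open>V\<close>.\<close>

lemma centralizer_abelian:
  assumes "\<not> central V" "V * X \<approx> X * V" "V * Y \<approx> Y * V" shows "X * Y \<approx> Y * X"
proof -
  obtain k l m n where X: "X \<approx> k *s V + l *s 1" and Y: "Y \<approx> m *s V + n *s 1"
    using commute_imp_affine[OF assms(1,2)] commute_imp_affine[OF assms(1,3)] by metis
  have "(k *s V + l *s 1) * (m *s V + n *s 1) = (m *s V + n *s 1) * (k *s V + l *s 1)"
    by (simp add: algebra_simps sm_distrib)
  with eqm_mult[OF X Y] have "X * Y \<approx> (m *s V + n *s 1) * (k *s V + l *s 1)" by simp
  then show ?thesis using eqm_sym[OF eqm_mult[OF Y X]] by (rule eqm_trans)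
qed

text \<open>The stabilizer of the line is metabelian: its commutators centralize \<open>V\<close>,
  and the centralizer of a nonscalar matrix is abelian.\<close>

lemma common_line_solvable:
  assumes "SL X" "SL Y" "\<not> central V" "stabilizes X V" "stabilizes Y V"
  shows "solvable ((PSL2 p)\<lparr>carrier := generate (PSL2 p) {cl p X, cl p Y}\<rparr>)"
proof -
  define T where "T i = (if i = 0 then {A. SL A \<and> stabilizes A V} else
     if i = 1 then {A. SL A \<and> intertwines 1 A V V} else {A. A \<approx> 1})" for i :: nat
  show ?thesis
  proof (rule solvable_matrix_chain[where T = T and n = 2])
    fix i A assume "A \<in> T i"
    then show "SL A" "adj A \<in> T i"
      using SL_eqm[OF eqm_sym, of A 1] intertwines_adj[of A 1 V V 1] eqm_adj[of A 1]
      by (auto simp: T_def stabilizes_adj split: if_splits)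
  next
    fix i show "1 \<in> T i" by (simp add: T_def stabilizes_one intertwines_one)
  next
    fix i A B assume AB: "A \<in> T i" "B \<in> T i"
    then show "A * B \<in> T i"
      using intertwines_mult[of 1 A V V 1 B V] eqm_mult[of A 1 B 1]
      by (auto simp: T_def stabilizes_mult SL_mult split: if_splits)
    consider "i = 0" | "i = 1" | "i \<ge> 2" by linarith
    then show "A * B * adj A * adj B \<in> T (Suc i)"
    proof cases
      case 1
      then show ?thesis using AB by (simp add: T_def stabilizes_commutator SL_commutator)
    next
      case 2
      then have "A * V \<approx> V * A" "B * V \<approx> V * B" using AB by (simp_all add: T_def intertwines_def)
      then have "A * B \<approx> B * A" using centralizer_abelian[OF assms(3) eqm_sym eqm_sym] eqm_sym by blast
      then show ?thesis using AB 2 by (simp add: T_def commuting_commutator)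
    next
      case 3
      then have "A \<approx> 1" "B \<approx> 1" using AB by (auto simp: T_def)
      then have "A * B * adj A * adj B \<approx> 1 * 1 * adj 1 * adj 1" by (intro eqm_mult eqm_adj)
      then show ?thesis using 3 by (simp add: T_def)
    qed
  next
    fix A assume "A \<in> T 2"
    then show "central A" unfolding central_def by (intro exI[of _ 1]) (simp add: T_def)
  qed (use assms in \<open>simp_all add: T_def\<close>)
qed

section \<open>Pairs generating a solvable group\<close>

text \<open>For noncentral matrices this says that the two matrices stabilize a common line of traceless matrices.\<close>

definition special :: "mat \<Rightarrow> mat \<Rightarrow> bool" where
  "special X Y \<longleftrightarrow> p dvd dt (bracket X Y) \<or> (p dvd tr X \<and> p dvd tr Y) \<or>
     (p dvd tr X \<and> p dvd tr (X * Y)) \<or> (p dvd tr Y \<and> p dvd tr (X * Y))"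

lemma bracket_swap: "bracket Y X = - bracket X Y" by (simp add: bracket_def)

lemma special_sym: "special X Y \<longleftrightarrow> special Y X"
  unfolding special_def by (auto simp: bracket_swap[of X Y] tr_mult_commute)

lemma p_dvd_eqm: "A \<approx> B \<Longrightarrow> p dvd tr A \<longleftrightarrow> p dvd tr B" "A \<approx> B \<Longrightarrow> p dvd dt A \<longleftrightarrow> p dvd dt B"
  using eqm_tr eqm_dt cong_dvd_iff by blast+

lemma sm_cong_0: "p dvd k \<Longrightarrow> k *s A \<approx> 0" by (simp add: sm_eqm_0)

lemma eqm_add_0: "A \<approx> B \<Longrightarrow> C \<approx> 0 \<Longrightarrow> A + C \<approx> B"
  using eqm_add[of A B C 0] by simp

lemma anticommute:
  assumes "p dvd tr A" "p dvd tr B" "p dvd tr (A * B)" shows "A * B \<approx> - (B * A)"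
proof -
  have "A * B + B * A \<approx> 0"
    unfolding anticommutator using assms
    by (intro eqm_add_0 sm_cong_0 dvd_diff dvd_mult)
  then show ?thesis by (subst eqm_diff_iff) simp
qed

lemma traceless_stabilizes:
  assumes "p dvd tr X" "p dvd tr V" "p dvd tr (X * V)" shows "stabilizes X V"
  unfolding stabilizes_def intertwines_def using anticommute[OF assms]
  by (intro exI[of _ "-1"]) (simp add: sm_distrib)

text \<open>\<open>V\<close> absorbs \<open>X\<close> on the left with the eigenvalue
  \<open>l\<close> and on the right with the other root \<open>tr X - l\<close> of the
  characteristic polynomial. The two roots are inverse to each other, so conjugation scales
  \<open>V\<close> by the square of \<open>l\<close>.\<close>

lemma null_stabilizes:
  assumes "SL X" "p dvd tr V" "p dvd dt V" "\<not> V \<approx> 0" "p dvd tr (X * V)"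
  obtains l where "X * V \<approx> l *s V" "p dvd l\<^sup>2 - tr X * l + 1" "stabilizes X V"
proof -
  obtain l where l: "X * V \<approx> l *s V" using null_eigen[OF assms(2-5)] .
  have "X * (X * V) \<approx> X * (l *s V)" by (rule eqm_mult[OF eqm_refl l])
  also have "\<dots> \<approx> l *s l *s V" using eqm_sm[OF l cong_refl, of l] by simp
  finally have xx: "X * (X * V) \<approx> (l * l) *s V" by simp
  have "X * (X * V) = tr X *s (X * V) - dt X *s V"
    using cayley_hamilton[of X] by (metis mult.assoc mult.left_neutral mult_sm(2) left_diff_distrib)
  also have "\<dots> \<approx> tr X *s (l *s V) - 1 *s V"
    using l assms(1) unfolding SL_def by (intro eqm_diff eqm_sm) simp_all
  finally have "(l * l) *s V - (tr X *s (l *s V) - 1 *s V) \<approx> 0"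
    using xx by (metis eqm_diff_iff eqm_sym eqm_trans)
  then have "(l\<^sup>2 - tr X * l + 1) *s V \<approx> 0" by (simp add: sm_distrib power2_eq_square algebra_simps)
  with assms(4) have e: "p dvd l\<^sup>2 - tr X * l + 1" by (simp add: sm_eqm_0)
  have "V * X \<approx> (tr X - l) *s V"
  proof -
    have "V * X = tr X *s V + tr V *s X + (tr (X * V) - tr X * tr V) *s 1 - X * V"
      using anticommutator[of X V] by (simp add: algebra_simps)
    also have "\<dots> \<approx> tr X *s V - l *s V"
      using assms(2,5) l by (intro eqm_diff eqm_add_0 sm_cong_0 dvd_diff dvd_mult) auto
    finally show ?thesis by (simp add: sm_distrib)
  qed
  then have vx: "(l * l) *s (V * X) \<approx> (l * l) *s (tr X - l) *s V" by (rule eqm_sm) simp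
  have u: "[l * (tr X - l) = 1] (mod p)"
  proof -
    have "p dvd - (l\<^sup>2 - tr X * l + 1)" using e by (simp only: dvd_minus_iff)
    then show ?thesis by (simp add: cong_iff_dvd_diff power2_eq_square algebra_simps)
  qed
  have "(l * l) *s (tr X - l) *s V \<approx> l *s V"
    using eqm_sm[OF eqm_refl[of "l *s V"] u] by (simp add: mult_ac)
  with vx l have "intertwines (l * l) X V V" unfolding intertwines_def
    using eqm_trans eqm_sym by blast
  moreover have "[(l * l) * ((tr X - l) * (tr X - l)) = 1] (mod p)"
    using cong_mult[OF u u] by (simp add: mult_ac)
  ultimately have "stabilizes X V" unfolding stabilizes_def by blast
  with l e show thesis by (rule that)
qed

lemma commute_stabilizes: "X * V \<approx> V * X \<Longrightarrow> stabilizes X V"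
  unfolding stabilizes_def intertwines_def by (intro exI[of _ 1]) simp

lemma stabilizes_self: "stabilizes X X" by (rule commute_stabilizes) simp

lemma bracket_eqm_0: "bracket X Y \<approx> 0 \<longleftrightarrow> X * Y \<approx> Y * X"
  by (simp add: bracket_def eqm_diff_iff[of "X * Y"])

lemma central_affine: "central (k *s A + l *s 1) \<longleftrightarrow> p dvd k \<or> central A"
proof (cases A)
  case (Mat a b c d)
  have "k * a + l - (k * d + l) = k * (a - d)" by (simp add: algebra_simps)
  then have "p dvd k * a + l - (k * d + l) \<longleftrightarrow> p dvd k \<or> p dvd a - d" by (metis p_dvd_mult)
  then show ?thesis by (auto simp: Mat central_iff one_mat_def)
qed

text \<open>A bracket that is nonzero and singular is a null vector orthogonal to both matrices,
  hence a common line; if both matrices are traceless, both anticommute with their bracket. If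
  \<open>X\<close> and \<open>X * Y\<close> are traceless, \<open>X\<close> anticommutes with the
  traceless part of \<open>Y\<close>. If the bracket vanishes, \<open>X\<close> itself spans a
  common line.\<close>

lemma special_common_line:
  assumes D: "SL X" "SL Y" and "\<not> central X" "\<not> central Y" and "special X Y"
  obtains V where "\<not> central V" "stabilizes X V" "stabilizes Y V"
proof -
  have half: thesis if "\<not> central Y" "p dvd tr X" "p dvd tr (X * Y)" and
     *: "\<And>V. \<lbrakk>\<not> central V; stabilizes X V; stabilizes Y V\<rbrakk> \<Longrightarrow> thesis" for X Y thesis
  proof (rule *)
    \<comment> \<open>Twice the traceless part of \<open>Y\<close>; the factor 2 avoids a
      division.\<close>
    let ?V = "2 *s Y - tr Y *s 1"
    show "stabilizes Y ?V" by (rule commute_stabilizes) (simp add: algebra_simps)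
    have "p dvd tr (X * ?V)" using that by (simp add: algebra_simps)
    with that show "stabilizes X ?V" by (intro traceless_stabilizes) simp_all
    show "\<not> central ?V"
      using central_affine[of 2 Y "- tr Y"] that(1) by (simp add: sm_distrib)
  qed
  consider (U) "p dvd dt (bracket X Y) \<or> p dvd tr X \<and> p dvd tr Y" |
    (x) "p dvd tr X" "p dvd tr (X * Y)" | (y) "p dvd tr Y" "p dvd tr (X * Y)"
    using assms(5) unfolding special_def by blast
  then show thesis
  proof cases
    case U
    let ?U = "bracket X Y"
    show thesis
    proof (cases "?U \<approx> 0")
      case True
      then show thesis using that[of X] assms(3) stabilizes_self commute_stabilizes eqm_sym bracket_eqm_0 by blast
    next
      case False
      have "stabilizes X ?U" "stabilizes Y ?U"
        using U null_stabilizes[OF D(1) _ _ False] null_stabilizes[OF D(2) _ _ False] traceless_stabilizes[of _ ?U]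
        by (metis dvd_0_right tr_bracket)+
      moreover have "\<not> central ?U" using traceless_central[of ?U] False by simp
      ultimately show thesis using that by blast
    qed
  next
    case x
    then show thesis using half[OF assms(4)] that by blast
  next
    case y
    then show thesis using half[OF assms(3), of Y] that by (metis tr_mult_commute)
  qed
qed

abbreviation gen_solvable :: "mat \<Rightarrow> mat \<Rightarrow> bool" where
  "gen_solvable X Y \<equiv> solvable ((PSL2 p)\<lparr>carrier := generate (PSL2 p) {cl p X, cl p Y}\<rparr>)"

lemma special_solvable:
  assumes "SL X" "SL Y" "\<not> central X" "\<not> central Y" "special X Y"
  shows "gen_solvable X Y"
  using special_common_line[OF assms] common_line_solvable[OF assms(1,2)] by blast

text \<open>The symmetric group on three lines is encoded as the group of affine maps of the integers modulo 3.\<close>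

definition permutes :: "(int \<Rightarrow> mat) \<Rightarrow> int \<Rightarrow> int \<Rightarrow> mat \<Rightarrow> bool" where
  "permutes V e j A \<longleftrightarrow> (\<forall>i. \<exists>k l. [k * l = 1] (mod p) \<and> intertwines k A (V i) (V (e * i + j)))"

context
  fixes V :: "int \<Rightarrow> mat"
  assumes periodic: "\<And>i j. [i = j] (mod 3) \<Longrightarrow> V i = V j"
begin

lemma permutes_cong:
  assumes "permutes V e j A" "[e = e'] (mod 3)" "[j = j'] (mod 3)"
  shows "permutes V e' j' A"
proof -
  have "V (e' * i + j') = V (e * i + j)" for i
    using assms(2,3) by (intro periodic cong_add cong_mult) (simp_all add: cong_sym)
  with assms(1) show ?thesis unfolding permutes_def by simp
qed

lemma permutes_one: "permutes V 1 0 1"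
  unfolding permutes_def by (intro allI exI[of _ 1]) (simp add: intertwines_one)

lemma permutes_mult:
  assumes "permutes V e j A" "permutes V f m B"
  shows "permutes V (e * f) (e * m + j) (A * B)"
  unfolding permutes_def
proof
  fix i
  obtain k l where 1: "[k * l = 1] (mod p)" "intertwines k B (V i) (V (f * i + m))"
    using assms(2) unfolding permutes_def by blast
  obtain k' l' where 2: "[k' * l' = 1] (mod p)" "intertwines k' A (V (f * i + m)) (V (e * (f * i + m) + j))"
    using assms(1) unfolding permutes_def by blast
  have "intertwines (k' * k) (A * B) (V i) (V (e * (f * i + m) + j))"
    using 1 2 by (intro intertwines_mult)
  moreover have "[(k' * k) * (l' * l) = 1] (mod p)" using cong_mult[OF 1(1) 2(1)] by (simp add: mult_ac)
  moreover have "e * (f * i + m) + j = e * f * i + (e * m + j)" by (simp add: algebra_simps)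
  ultimately show "\<exists>k l. [k * l = 1] (mod p) \<and> intertwines k (A * B) (V i) (V (e * f * i + (e * m + j)))"
    by metis
qed

text \<open>Since \<open>e\<close> is its own inverse modulo 3, the inverse of i -> e i + j is i ->
  e i - e j.\<close>

lemma permutes_adj:
  assumes "SL A" "permutes V e j A" "[e * e = 1] (mod 3)"
  shows "permutes V e (- e * j) (adj A)"
  unfolding permutes_def
proof
  fix i
  let ?i = "e * i + - e * j"
  obtain k l where 1: "[k * l = 1] (mod p)" "intertwines k A (V ?i) (V (e * ?i + j))"
    using assms(2) unfolding permutes_def by blast
  have "[(e * e) * (i - j) + j = 1 * (i - j) + j] (mod 3)" by (intro cong_add cong_mult assms(3) cong_refl)
  moreover have "(e * e) * (i - j) + j = e * ?i + j" by (simp add: algebra_simps)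
  ultimately have "V (e * ?i + j) = V i" by (intro periodic) simp
  then have "intertwines l (adj A) (V i) (V ?i)" using intertwines_adj[OF assms(1) 1(2,1)] by simp
  then show "\<exists>k l. [k * l = 1] (mod p) \<and> intertwines k (adj A) (V i) (V (e * i + - e * j))"
    using 1(1) by (metis mult.commute)
qed

lemma permutes_stabilizes: "permutes V 1 0 A \<Longrightarrow> stabilizes A (V i)"
  unfolding permutes_def stabilizes_def by (metis add.right_neutral mult_1)

text \<open>The chain mirrors S4 > A4 > V4 > 1: all affine maps of the three indices, the
  translations, the matrices stabilizing each line, and those centralizing each \<open>V i\<close>.
  The last are scalar because \<open>V 0\<close> and \<open>V 1\<close> do not commute.\<close>

lemma frame_solvable:
  assumes "\<not> V 0 * V 1 \<approx> V 1 * V 0" and "SL X" "SL Y"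
    and X: "permutes V e j X" "[e * e = 1] (mod 3)" and Y: "permutes V f m Y" "[f * f = 1] (mod 3)"
  shows "gen_solvable X Y"
proof -
  define T where "T i = {A. SL A \<and> (if i = 0 then \<exists>e j. [e * e = 1] (mod 3) \<and> permutes V e j A
     else if i = 1 then \<exists>j. permutes V 1 j A else if i = 2 then permutes V 1 0 A
     else \<forall>i. intertwines 1 A (V i) (V i))}" for i :: nat
  have T0I: "\<lbrakk>SL A; [e * e = 1] (mod 3); permutes V e j A\<rbrakk> \<Longrightarrow> A \<in> T 0" for A e j
    unfolding T_def by auto
  have T1I: "\<lbrakk>SL A; permutes V 1 j A\<rbrakk> \<Longrightarrow> A \<in> T 1" for A j
    unfolding T_def by auto
  have T2: "A \<in> T 2 \<longleftrightarrow> SL A \<and> permutes V 1 0 A" for A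
    unfolding T_def by auto
  have T3: "i > 2 \<Longrightarrow> A \<in> T i \<longleftrightarrow> SL A \<and> (\<forall>n. intertwines 1 A (V n) (V n))" for A i
    unfolding T_def by auto
  have T0E: "\<lbrakk>A \<in> T 0; \<And>e j. \<lbrakk>[e * e = 1] (mod 3); permutes V e j A\<rbrakk> \<Longrightarrow> thesis\<rbrakk> \<Longrightarrow> thesis" for A thesis
    unfolding T_def by auto
  have T1E: "\<lbrakk>A \<in> T 1; \<And>j. permutes V 1 j A \<Longrightarrow> thesis\<rbrakk> \<Longrightarrow> thesis" for A thesis
    unfolding T_def by auto
  have TD: "A \<in> T i \<Longrightarrow> SL A" for A i by (simp add: T_def)
  have cases: "i = 0 \<or> i = 1 \<or> i = 2 \<or> i > 2" for i :: nat by linarith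
  show ?thesis
  proof (rule solvable_matrix_chain[where T = T and n = 3])
    fix i A assume "A \<in> T i" then show "SL A" by (rule TD)
  next
    fix i show "1 \<in> T i"
      using cases[of i] T0I[of 1 1 0] T1I[of 1 0] permutes_one by (auto simp: T2 T3 intertwines_one)
  next
    fix i A B assume A: "A \<in> T i" and B: "B \<in> T i"
    note D = TD[OF A] TD[OF B]
    note D' = SL_mult[OF D] SL_commutator[OF D]
    from cases[of i] show "A * B \<in> T i"
    proof (elim disjE)
      assume i: "i = 0"
      obtain e j where e: "[e * e = 1] (mod 3)" "permutes V e j A" using A unfolding i by (rule T0E)
      obtain f m where f: "[f * f = 1] (mod 3)" "permutes V f m B" using B unfolding i by (rule T0E)
      have "[(e * f) * (e * f) = 1] (mod 3)" using cong_mult[OF e(1) f(1)] by (simp add: mult_ac)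
      then show ?thesis unfolding i using permutes_mult[OF e(2) f(2)] by (rule T0I[OF D'(1)])
    next
      assume i: "i = 1"
      obtain j where j: "permutes V 1 j A" using A unfolding i by (rule T1E)
      obtain m where m: "permutes V 1 m B" using B unfolding i by (rule T1E)
      show ?thesis unfolding i using T1I[OF D'(1)] permutes_mult[OF j m] by simp
    next
      assume i: "i = 2"
      then show ?thesis using permutes_mult[of 1 0 A 1 0 B] A B D' by (simp add: T2)
    next
      assume i: "i > 2"
      then show ?thesis using intertwines_mult[of 1 A "V n" "V n" 1 B "V n" for n] A B D' by (simp add: T3)
    qed
    from cases[of i] show "A * B * adj A * adj B \<in> T (Suc i)"
    proof (elim disjE)
      assume i: "i = 0"
      obtain e j where e: "[e * e = 1] (mod 3)" "permutes V e j A" using A unfolding i by (rule T0E)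
      obtain f m where f: "[f * f = 1] (mod 3)" "permutes V f m B" using B unfolding i by (rule T0E)
      have "[e * f * e * f = 1] (mod 3)" using cong_mult[OF e(1) f(1)] by (simp add: mult_ac)
      then have "\<exists>n. permutes V 1 n (A * B * adj A * adj B)"
        using permutes_cong[OF permutes_mult[OF permutes_mult[OF permutes_mult[OF e(2) f(2)]
          permutes_adj[OF D(1) e(2,1)]] permutes_adj[OF D(2) f(2,1)]] _ cong_refl] by blast
      then show ?thesis unfolding i using T1I[OF D'(2)] by auto
    next
      assume i: "i = 1"
      obtain j where j: "permutes V 1 j A" using A unfolding i by (rule T1E)
      obtain m where m: "permutes V 1 m B" using B unfolding i by (rule T1E)
      have "permutes V 1 0 (A * B * adj A * adj B)"
        using permutes_mult[OF permutes_mult[OF permutes_mult[OF j m] permutes_adj[OF D(1) j]] permutes_adj[OF D(2) m]]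
        by simp
      then have "A * B * adj A * adj B \<in> T 2" using D'(2) unfolding T2 by blast
      then show ?thesis unfolding i by (simp add: numeral_2_eq_2)
    next
      assume i: "i = 2"
      then have "intertwines 1 (A * B * adj A * adj B) (V n) (V n)" for n
        using stabilizes_commutator[OF D] permutes_stabilizes A B by (simp add: T2)
      then show ?thesis using i D'(2) by (simp add: T3)
    next
      assume i: "i > 2"
      have "stabilizes A (V n)" "stabilizes B (V n)" for n
        using A B i commute_stabilizes by (simp_all add: T3 intertwines_def)
      then have "intertwines 1 (A * B * adj A * adj B) (V n) (V n)" for n
        using stabilizes_commutator[OF D] by blast
      then show ?thesis using i D'(2) by (simp add: T3)
    qed
  next
    fix i A assume A: "A \<in> T i"
    note D = TD[OF A]
    have D': "SL (adj A)" using D by simp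
    from cases[of i] show "adj A \<in> T i"
    proof (elim disjE)
      assume i: "i = 0"
      obtain e j where e: "[e * e = 1] (mod 3)" "permutes V e j A" using A unfolding i by (rule T0E)
      show ?thesis unfolding i using T0I[OF D' e(1) permutes_adj[OF D e(2,1)]] .
    next
      assume i: "i = 1"
      obtain j where j: "permutes V 1 j A" using A unfolding i by (rule T1E)
      show ?thesis unfolding i using T1I[OF D' permutes_adj[OF D j]] by simp
    next
      assume i: "i = 2"
      then show ?thesis using permutes_adj[of A 1 0] A D by (simp add: T2)
    next
      assume i: "i > 2"
      then show ?thesis using intertwines_adj[of A 1 "V n" "V n" 1 for n] A D by (simp add: T3)
    qed
  next
    fix A assume "A \<in> T 3"
    then have "A * V 0 \<approx> V 0 * A" "A * V 1 \<approx> V 1 * A" by (simp_all add: T3 intertwines_def)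
    then show "central A" using centralizer_abelian[of A "V 0" "V 1"] assms(1) by blast
  next
    show "X \<in> T 0" using T0I[OF assms(2) X(2,1)] .
    show "Y \<in> T 0" using T0I[OF assms(3) Y(2,1)] .
  qed
qed

end

section \<open>Tetrahedral and octahedral pairs\<close>

lemma intertwines_unitI:
  assumes "\<not> p dvd a" "\<not> p dvd b" "a *s (X * V) \<approx> b *s (W * X)"
  shows "\<exists>k l. [k * l = 1] (mod p) \<and> intertwines k X V W"
proof -
  obtain i where i: "[a * i = 1] (mod p)" using inverse_mod_p[OF assms(1)] .
  obtain j where j: "[b * j = 1] (mod p)" using inverse_mod_p[OF assms(2)] .
  have "i *s a *s (X * V) \<approx> i *s b *s (W * X)" by (rule eqm_sm[OF assms(3) cong_refl])
  moreover have "i *s a *s (X * V) \<approx> X * V"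
    using eqm_sm[OF eqm_refl i, of "X * V"] by (simp add: mult.commute)
  ultimately have "intertwines (i * b) X V W" unfolding intertwines_def using eqm_sym eqm_trans by (metis sm_sm)
  moreover have "[(i * b) * (a * j) = 1] (mod p)" using cong_mult[OF i j] by (simp add: mult_ac)
  ultimately show ?thesis by blast
qed

lemma intertwines_eqmI: "X * V \<approx> W * X \<Longrightarrow> \<exists>k l. [k * l = 1] (mod p) \<and> intertwines k X V W"
  by (rule intertwines_unitI[of 1 1]) simp_all

lemma permutesI:
  assumes per: "\<And>i j. [i = j] (mod 3) \<Longrightarrow> V i = V j"
    and "\<And>i. i \<in> {0, 1, 2} \<Longrightarrow> \<exists>k l. [k * l = 1] (mod p) \<and> intertwines k A (V i) (V (e * i + j))"
  shows "permutes V e j A"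
  unfolding permutes_def
proof
  fix i :: int
  have "V (i mod 3) = V i" "V (e * (i mod 3) + j) = V (e * i + j)"
    by (intro per cong_add cong_mult; simp)+
  moreover have "i mod 3 \<in> {0, 1, 2}" by auto
  ultimately show "\<exists>k l. [k * l = 1] (mod p) \<and> intertwines k A (V i) (V (e * i + j))"
    using assms(2)[of "i mod 3"] by simp
qed

lemma anticommuting_not_commuting:
  assumes "A * B \<approx> - (B * A)" "\<not> p dvd dt A" "\<not> p dvd dt B" shows "\<not> A * B \<approx> B * A"
proof
  assume "A * B \<approx> B * A"
  then have "A * B + A * B \<approx> B * A + - (B * A)" using assms(1) by (intro eqm_add)
  moreover have "A * B + A * B = 2 *s (A * B)" by (cases "A * B") simp
  ultimately have "A * B \<approx> 0" by (simp add: sm_eqm_0)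
  then have "p dvd dt (A * B)" using p_dvd_eqm(2)[of "A * B" 0] by simp
  with assms(2,3) show False by simp
qed

lemma SL_not_dvd: "SL A \<Longrightarrow> \<not> p dvd dt A" unfolding SL_def using cong_dvd_iff by fastforce

lemma tr_conj: "tr (X * Y * adj X) = dt X * tr Y" "tr (adj X * Y * X) = dt X * tr Y"
  by (cases X; cases Y; simp add: algebra_simps)+

text \<open>The trace form between \<open>Y\<close> and its conjugate by \<open>X\<close>, in terms
  of the traces of the pair; it decides whether the conjugate line is orthogonal to that of
  \<open>Y\<close>.\<close>

lemma tr_mult_conj:
  "tr (Y * (X * Y * adj X)) = tr (X * Y) * (tr X * tr Y - tr (X * Y)) - dt Y * (tr X * tr X - 2 * dt X)"
  "tr (Y * (adj X * Y * X)) = tr (X * Y) * (tr X * tr Y - tr (X * Y)) - dt Y * (tr X * tr X - 2 * dt X)"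
  by (cases X; cases Y; simp add: algebra_simps)+

text \<open>The prescribed traces make the involution \<open>Y\<close> orthogonal to its conjugates
  under \<open>X\<close>, which has order 3. So \<open>X\<close> permutes three lines cyclically,
  and \<open>Y\<close> fixes its own line and negates the other two matrices.\<close>

lemma tetrahedral_solvable:
  assumes D: "SL X" "SL Y" and t: "[tr X = 1] (mod p)" "[tr Y = 0] (mod p)" "[tr (X * Y) = 1] (mod p)"
  shows "gen_solvable X Y"
proof -
  define V where "V i = (if i mod 3 = 0 then Y else if i mod 3 = 1 then X * Y * adj X else adj X * Y * X)" for i :: int
  have per: "V i = V j" if "[i = j] (mod 3)" for i j using that by (simp add: V_def cong_def)
  have V: "V 0 = Y" "V 1 = X * Y * adj X" "V 2 = adj X * Y * X" "V 3 = Y" by (simp_all add: V_def)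
  have "[tr (X * Y) * (tr X * tr Y - tr (X * Y)) - dt Y * (tr X * tr X - 2 * dt X) = 1 * (1 * 0 - 1) - 1 * (1 * 1 - 2 * 1)] (mod p)"
    using D t unfolding SL_def by (intro cong_diff cong_mult cong_refl)
  then have tr0: "p dvd tr (Y * (X * Y * adj X))" "p dvd tr (Y * (adj X * Y * X))"
    unfolding tr_mult_conj by (simp_all add: cong_0_iff)
  have "p dvd tr Y" using t(2) by (simp add: cong_0_iff)
  then have anti: "Y * (X * Y * adj X) \<approx> - ((X * Y * adj X) * Y)" "Y * (adj X * Y * X) \<approx> - ((adj X * Y * X) * Y)"
    using tr0 by (intro anticommute; simp add: tr_conj)+
  have xx: "X * X \<approx> - adj X"
  proof -
    have "X * X \<approx> 1 *s X - 1 *s 1"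
      unfolding cayley_hamilton using t(1) D(1) unfolding SL_def by (intro eqm_diff eqm_sm eqm_refl)
    moreover have "- adj X \<approx> - (1 *s 1 - X)"
      unfolding adj_eq using t(1) by (intro eqm_uminus eqm_diff eqm_sm eqm_refl)
    ultimately show ?thesis using eqm_sym eqm_trans by (metis minus_diff_eq sm_simps(1))
  qed
  have "permutes V 1 1 X"
  proof (rule permutesI[OF per])
    fix i :: int assume "i \<in> {0, 1, 2}"
    then consider "i = 0" | "i = 1" | "i = 2" by blast
    then show "\<exists>k l. [k * l = 1] (mod p) \<and> intertwines k X (V i) (V (1 * i + 1))"
    proof cases
      case 1
      have "X * Y * (adj X * X) \<approx> X * Y * 1" by (rule eqm_mult[OF eqm_refl adj_inv(2)[OF D(1)]])
      then have "X * Y \<approx> (X * Y * adj X) * X" using eqm_sym by (simp add: mult.assoc)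
      then show ?thesis using intertwines_eqmI by (simp add: 1 V)
    next
      case 2
      have "X * (X * Y * adj X) = (X * X) * (Y * adj X)" by (simp add: mult.assoc)
      also have "\<dots> \<approx> - adj X * (Y * adj X)" by (rule eqm_mult[OF xx eqm_refl])
      also have "\<dots> = (adj X * Y) * - adj X" by (simp add: mult.assoc)
      also have "\<dots> \<approx> (adj X * Y) * (X * X)" by (rule eqm_mult[OF eqm_refl eqm_sym[OF xx]])
      finally show ?thesis using intertwines_eqmI by (simp add: 2 V mult.assoc)
    next
      case 3
      have "(X * adj X) * (Y * X) \<approx> 1 * (Y * X)" by (rule eqm_mult[OF adj_inv(1)[OF D(1)] eqm_refl])
      then show ?thesis using intertwines_eqmI by (simp add: 3 V mult.assoc)
    qed
  qed
  moreover have "permutes V 1 0 Y"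
  proof (rule permutesI[OF per])
    fix i :: int assume "i \<in> {0, 1, 2}"
    moreover have *: "\<exists>k l. [k * l = 1] (mod p) \<and> intertwines k Y W W" if "Y * W \<approx> - (W * Y)" for W
      using that by (intro intertwines_unitI[of 1 "-1"]) (simp_all add: sm_distrib)
    moreover have "\<exists>k l. [k * l = 1] (mod p) \<and> intertwines k Y Y Y" by (rule intertwines_eqmI) simp
    ultimately have "\<exists>k l. [k * l = 1] (mod p) \<and> intertwines k Y (V i) (V i)"
      using *[OF anti(1)] *[OF anti(2)] unfolding insert_iff empty_iff by (elim disjE) (simp_all only: V)
    then show "\<exists>k l. [k * l = 1] (mod p) \<and> intertwines k Y (V i) (V (1 * i + 0))" by simp
  qed
  moreover have "\<not> V 0 * V 1 \<approx> V 1 * V 0"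
    using anticommuting_not_commuting[OF anti(1)] SL_not_dvd[OF D(2)] SL_not_dvd[OF D(1)] by (simp add: V)
  ultimately show ?thesis using frame_solvable[OF per _ D, where e = 1 and j = 1 and f = 1 and m = 0] by simp
qed

text \<open>\<open>I\<close> and \<open>J\<close>, twice the traceless parts of \<open>X\<close> and
  \<open>Y\<close>, anticommute and both have square -2, so \<open>I\<close>, \<open>J\<close>,
  \<open>I * J\<close> is a quaternion frame up to scaling. Then \<open>2 *s X = r *s 1 + I\<close>
  is a quarter turn about \<open>I\<close> that exchanges the lines of \<open>J\<close> and
  \<open>I * J\<close>; likewise \<open>Y\<close> about \<open>J\<close>.\<close>

lemma octahedral_solvable:
  assumes D: "SL X" "SL Y" and r: "[r * r = 2] (mod p)"
    and t: "[tr X = r] (mod p)" "[tr Y = r] (mod p)" "[tr (X * Y) = 1] (mod p)"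
  shows "gen_solvable X Y"
proof -
  define I where "I = 2 *s X - r *s 1"
  define J where "J = 2 *s Y - r *s 1"
  have X2: "2 *s X = r *s 1 + I" and Y2: "2 *s Y = r *s 1 + J" by (simp_all add: I_def J_def)
  have rd: "\<not> p dvd r"
  proof
    assume "p dvd r"
    then have "p dvd r * r" by simp
    then show False using r cong_dvd_iff by (metis not_p_dvd_numerals(2))
  qed
  have tr0: "p dvd tr I" "p dvd tr J"
    using t cong_scalar_left[of _ _ p 2] by (auto simp: I_def J_def cong_iff_dvd_diff mult.commute)
  have dt_shift: "dt (2 *s A - r *s 1) = 4 * dt A - 2 * r * tr A + r * r" for A
    by (cases A) (simp add: one_mat_def algebra_simps)
  have dt2: "[dt I = 2] (mod p)" "[dt J = 2] (mod p)"
  proof -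
    have *: "[dt (2 *s A - r *s 1) = 2] (mod p)" if "SL A" "[tr A = r] (mod p)" for A
    proof -
      have "[4 * dt A - 2 * r * tr A + r * r = 4 * 1 - 2 * r * r + r * r] (mod p)"
        using that unfolding SL_def by (intro cong_arith)
      also have "4 * 1 - 2 * r * r + r * r = 4 - r * r" by simp
      also have "[4 - r * r = 4 - 2] (mod p)" by (intro cong_diff cong_refl r)
      finally show ?thesis by (simp add: dt_shift)
    qed
    show "[dt I = 2] (mod p)" "[dt J = 2] (mod p)" unfolding I_def J_def using * D t by blast+
  qed
  have sq: "A * A \<approx> - (2 *s 1)" if "p dvd tr A" "[dt A = 2] (mod p)" for A
  proof -
    have "A * A \<approx> 0 - 2 *s 1"
      unfolding cayley_hamilton using that by (intro eqm_diff eqm_sm eqm_refl sm_cong_0)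
    then show ?thesis by simp
  qed
  have II: "I * I \<approx> - (2 *s 1)" and JJ: "J * J \<approx> - (2 *s 1)" using sq tr0 dt2 by blast+
  have "tr (I * J) = 4 * tr (X * Y) - 2 * r * tr X - 2 * r * tr Y + 2 * (r * r)"
    by (simp add: I_def J_def algebra_simps)
  also have "[\<dots> = 4 * 1 - 2 * r * r - 2 * r * r + 2 * (r * r)] (mod p)"
    using t by (intro cong_arith)
  also have "4 * 1 - 2 * r * r - 2 * r * r + 2 * (r * r) = 4 - 2 * (r * r)" by simp
  also have "[4 - 2 * (r * r) = 4 - 2 * 2] (mod p)" by (intro cong_diff cong_mult cong_refl r)
  finally have "p dvd tr (I * J)" by (simp add: cong_0_iff)
  then have IJ: "I * J \<approx> - (J * I)" using tr0 by (intro anticommute)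
  then have JI: "J * I \<approx> - (I * J)" using eqm_uminus eqm_sym by fastforce
  have rr: "r *s r *s A \<approx> 2 *s A" for A using eqm_sm[OF eqm_refl r] by simp
  have IIJ: "I * (I * J) \<approx> - (2 *s J)" using eqm_mult[OF II eqm_refl[of J]] by (simp add: mult.assoc)
  have IJJ: "(I * J) * J \<approx> - (2 *s I)" using eqm_mult[OF eqm_refl[of I] JJ] by (simp add: mult.assoc)
  have IJI: "(I * J) * I \<approx> 2 *s J"
  proof -
    have "(I * J) * I \<approx> I * (- (I * J))" using eqm_mult[OF eqm_refl[of I] JI] by (simp add: mult.assoc)
    also have "\<dots> \<approx> 2 *s J" using eqm_uminus[OF IIJ] by simp
    finally show ?thesis .
  qed
  have JIJ: "J * (I * J) \<approx> 2 *s I"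
  proof -
    have "J * (I * J) \<approx> (- (I * J)) * J" using eqm_mult[OF JI eqm_refl[of J]] by (simp add: mult.assoc)
    also have "\<dots> \<approx> 2 *s I" using eqm_uminus[OF IJJ] by simp
    finally show ?thesis .
  qed
  define V where "V i = (if i mod 3 = 0 then I else if i mod 3 = 1 then J else I * J)" for i :: int
  have per: "V i = V j" if "[i = j] (mod 3)" for i j using that by (simp add: V_def cong_def)
  have V: "V 0 = I" "V 1 = J" "V 2 = I * J" "V (-1) = I * J" "V (-2) = J" by (simp_all add: V_def)
  have X1: "(2 * r) *s (X * J) \<approx> 2 *s ((I * J) * X)"
  proof -
    have "(2 * r) *s (X * J) = r *s ((2 *s X) * J)" by (simp add: mult.commute)
    also have "\<dots> = r *s r *s J + r *s (I * J)" unfolding X2 by (simp add: algebra_simps sm_distrib)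
    also have "\<dots> \<approx> 2 *s J + r *s (I * J)" by (intro eqm_add rr eqm_refl)
    also have "\<dots> \<approx> (I * J) * I + r *s (I * J)" by (intro eqm_add eqm_sym[OF IJI] eqm_refl)
    also have "\<dots> = (I * J) * (2 *s X)" unfolding X2 by (simp add: algebra_simps sm_distrib)
    finally show ?thesis by simp
  qed
  have X2': "2 *s (X * (I * J)) \<approx> (- (2 * r)) *s (J * X)"
  proof -
    have "2 *s (X * (I * J)) = (2 *s X) * (I * J)" by simp
    also have "\<dots> = r *s (I * J) + I * (I * J)" unfolding X2 by (simp add: algebra_simps sm_distrib)
    also have "\<dots> \<approx> r *s (- (J * I)) + - (2 *s J)" by (intro eqm_add eqm_sm IJ IIJ cong_refl)
    also have "\<dots> \<approx> r *s (- (J * I)) + - (r *s r *s J)" by (intro eqm_add eqm_refl eqm_uminus eqm_sym[OF rr])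
    also have "\<dots> = (- r) *s (J * (2 *s X))" unfolding X2 by (simp add: algebra_simps sm_distrib)
    finally show ?thesis by (simp add: mult.commute)
  qed
  have Y1: "(2 * r) *s (Y * I) \<approx> (- 2) *s ((I * J) * Y)"
  proof -
    have "(2 * r) *s (Y * I) = r *s ((2 *s Y) * I)" by (simp add: mult.commute)
    also have "\<dots> = r *s r *s I + r *s (J * I)" unfolding Y2 by (simp add: algebra_simps sm_distrib)
    also have "\<dots> \<approx> 2 *s I + r *s (- (I * J))" by (intro eqm_add eqm_sm rr JI cong_refl)
    also have "\<dots> \<approx> - ((I * J) * J) + r *s (- (I * J))"
      using eqm_uminus[OF eqm_sym[OF IJJ]] by (intro eqm_add eqm_refl) simp
    also have "\<dots> = (- 1) *s ((I * J) * (2 *s Y))" unfolding Y2 by (simp add: algebra_simps sm_distrib)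
    finally show ?thesis by simp
  qed
  have Y2': "2 *s (Y * (I * J)) \<approx> (2 * r) *s (I * Y)"
  proof -
    have "2 *s (Y * (I * J)) = (2 *s Y) * (I * J)" by simp
    also have "\<dots> = r *s (I * J) + J * (I * J)" unfolding Y2 by (simp add: algebra_simps sm_distrib)
    also have "\<dots> \<approx> r *s (I * J) + 2 *s I" by (intro eqm_add JIJ eqm_refl)
    also have "\<dots> \<approx> r *s (I * J) + r *s r *s I" by (intro eqm_add eqm_refl eqm_sym[OF rr])
    also have "\<dots> = r *s (I * (2 *s Y))" unfolding Y2 by (simp add: algebra_simps sm_distrib)
    finally show ?thesis by (simp add: mult.commute)
  qed
  have XI: "X * I = I * X" and YJ: "Y * J = J * Y" by (simp_all add: I_def J_def algebra_simps)
  have rd2: "\<not> p dvd 2 * r" "\<not> p dvd - (2 * r)" "\<not> p dvd - 2" using rd by simp_all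
  have "permutes V (-1) 0 X"
  proof (rule permutesI[OF per])
    fix i :: int assume "i \<in> {0, 1, 2}"
    then consider "i = 0" | "i = 1" | "i = 2" by blast
    then show "\<exists>k l. [k * l = 1] (mod p) \<and> intertwines k X (V i) (V ((-1) * i + 0))"
    proof cases
      case 1
      show ?thesis using intertwines_eqmI[of X I I] by (simp add: 1 V XI)
    next
      case 2
      show ?thesis using intertwines_unitI[OF _ _ X1] rd2 by (simp add: 2 V)
    next
      case 3
      show ?thesis using intertwines_unitI[OF _ _ X2'] rd2 by (simp add: 3 V)
    qed
  qed
  moreover have "permutes V (-1) 2 Y"
  proof (rule permutesI[OF per])
    fix i :: int assume "i \<in> {0, 1, 2}"
    then consider "i = 0" | "i = 1" | "i = 2" by blast
    then show "\<exists>k l. [k * l = 1] (mod p) \<and> intertwines k Y (V i) (V ((-1) * i + 2))"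
    proof cases
      case 1
      show ?thesis using intertwines_unitI[OF _ _ Y1] rd2 by (simp add: 1 V)
    next
      case 2
      show ?thesis using intertwines_eqmI[of Y J J] by (simp add: 2 V YJ)
    next
      case 3
      show ?thesis using intertwines_unitI[OF _ _ Y2'] rd2 by (simp add: 3 V)
    qed
  qed
  moreover have "\<not> V 0 * V 1 \<approx> V 1 * V 0"
    using anticommuting_not_commuting[OF IJ] cong_dvd_iff[OF dt2(1)] cong_dvd_iff[OF dt2(2)] by (simp add: V)
  ultimately show ?thesis using frame_solvable[OF per _ D, where e = "-1" and j = 0 and f = "-1" and m = 2] by simp
qed

section \<open>Classification of solvable pairs\<close>

text \<open>Let conjugation scale \<open>V\<close> by \<open>k\<close>. Comparing traces gives k = 1
  or tr(XV) = 0, comparing determinants gives k = 1 or -1 or dt V = 0; for k = -1 and tr(XV) = 0 the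
  anticommutator forces tr X = 0.\<close>

lemma stabilizes_cases:
  assumes "SL X" "stabilizes X V" "p dvd tr V" "\<not> V \<approx> 0"
  shows "X * V \<approx> V * X \<or> (p dvd tr (X * V) \<and> (p dvd tr X \<or> p dvd dt V))"
proof -
  obtain k where k: "X * V \<approx> k *s (V * X)"
    using assms(2) unfolding stabilizes_def intertwines_def by blast
  have one: "X * V \<approx> V * X" if "p dvd k - 1"
    using eqm_trans[OF k eqm_sm[OF eqm_refl, of k 1]] that by (simp add: cong_iff_dvd_diff)
  have "[tr (X * V) = k * tr (X * V)] (mod p)"
    using eqm_tr[OF k] by (simp add: tr_mult_commute[of V X])
  then have "p dvd tr (X * V) - k * tr (X * V)" by (simp only: cong_iff_dvd_diff)
  moreover have "tr (X * V) - k * tr (X * V) = - ((k - 1) * tr (X * V))" by (simp add: algebra_simps)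
  ultimately have t: "p dvd k - 1 \<or> p dvd tr (X * V)" by (simp only: dvd_minus_iff p_dvd_mult)
  have "p dvd dt X * dt V - k\<^sup>2 * (dt V * dt X)"
    using eqm_dt[OF k] by (simp add: cong_iff_dvd_diff)
  moreover have "dt X * dt V - k\<^sup>2 * (dt V * dt X) = - (dt X * (dt V * ((k - 1) * (k + 1))))"
    by (simp add: algebra_simps power2_eq_square)
  ultimately have d: "p dvd dt V \<or> p dvd k - 1 \<or> p dvd k + 1"
    using SL_not_dvd[OF assms(1)] by (simp only: dvd_minus_iff p_dvd_mult) blast
  have "p dvd tr X" if "p dvd k + 1" "p dvd tr (X * V)"
  proof -
    have "k *s (V * X) \<approx> (-1) *s (V * X)"
      using that(1) by (intro eqm_sm) (simp_all add: cong_iff_dvd_diff)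
    then have "X * V \<approx> - (V * X)" using eqm_trans[OF k] by (simp add: sm_distrib)
    then have "X * V + V * X \<approx> 0" by (simp add: eqm_diff_iff[of "X * V"])
    moreover have "X * V + V * X \<approx> tr X *s V"
      unfolding anticommutator using assms(3) that(2)
      by (intro eqm_add_0 sm_cong_0 dvd_diff dvd_mult) auto
    ultimately have "tr X *s V \<approx> 0" using eqm_sym eqm_trans by blast
    then show ?thesis using assms(4) by (simp add: sm_eqm_0)
  qed
  then show ?thesis using one t d by blast
qed

lemma dvd_dt_if_annihilates:
  assumes "A * V \<approx> 0" "\<not> V \<approx> 0" shows "p dvd dt A"
proof -
  have "(adj A * A) * V \<approx> 0" using eqm_mult[OF eqm_refl[of "adj A"] assms(1)] by (simp add: mult.assoc)
  then have "dt A *s V \<approx> 0" by (simp add: mult_adj)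
  then show ?thesis using assms(2) by (simp add: sm_eqm_0)
qed

text \<open>Converse of \<open>special_common_line\<close>. If \<open>X\<close> commutes with
  \<open>V\<close> it is affine in \<open>V\<close>, so the conditions on \<open>X\<close> and
  \<open>Y\<close> reduce to conditions on \<open>V\<close> and \<open>Y\<close>. If both have the
  null \<open>V\<close> as an eigenvector, the bracket annihilates \<open>V\<close> and is
  singular.\<close>

lemma common_line_special:
  assumes D: "SL X" "SL Y" and c: "\<not> central X" "\<not> central Y"
    and V: "p dvd tr V" "\<not> V \<approx> 0" and s: "stabilizes X V" "stabilizes Y V"
  shows "special X Y"
proof -
  have nV: "\<not> central V" using V traceless_central by blast
  have half: "special X Y" if comm: "X * V \<approx> V * X" and YV: "p dvd tr (Y * V)" and "p dvd tr Y \<or> p dvd dt V" for X Y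
  proof -
    obtain k l where X: "X \<approx> k *s V + l *s 1" using commute_imp_affine[OF nV eqm_sym[OF comm]] .
    have "bracket X Y \<approx> bracket (k *s V + l *s 1) Y" by (rule eqm_bracket[OF X eqm_refl])
    also have "bracket (k *s V + l *s 1) Y = k *s bracket V Y" by (simp add: bracket_def algebra_simps sm_distrib)
    finally have "p dvd dt (bracket X Y) \<longleftrightarrow> p dvd k\<^sup>2 * dt (bracket V Y)" using p_dvd_eqm(2)[of "bracket X Y" "k *s bracket V Y"] by simp
    moreover have "p dvd dt (bracket V Y)" if "p dvd dt V"
    proof -
      have "V * Y + Y * V \<approx> tr Y *s V"
        using anticommutator[of Y V] V(1) YV
          eqm_add_0[OF eqm_add_0[OF eqm_refl[of "tr Y *s V"] sm_cong_0[OF V(1), of Y]] sm_cong_0[of "tr (Y * V) - tr Y * tr V" 1]]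
        by (simp add: add.commute)
      then have "(V * Y + V * Y) - (V * Y + Y * V) \<approx> (V * Y + V * Y) - tr Y *s V"
        by (intro eqm_diff eqm_refl)
      then have "bracket V Y \<approx> V * (Y + Y - tr Y *s 1)" by (simp add: bracket_def algebra_simps)
      from p_dvd_eqm(2)[OF this] that show ?thesis by simp
    qed
    moreover have "p dvd tr (X * Y)" if "p dvd tr Y"
    proof -
      have "X * Y \<approx> (k *s V + l *s 1) * Y" by (rule eqm_mult[OF X eqm_refl])
      from p_dvd_eqm(1)[OF this] that YV tr_mult_commute[of V Y] show ?thesis by (simp add: algebra_simps)
    qed
    ultimately show ?thesis using that(3) unfolding special_def by auto
  qed
  have X: "X * V \<approx> V * X \<or> (p dvd tr (X * V) \<and> (p dvd tr X \<or> p dvd dt V))"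
    by (rule stabilizes_cases[OF D(1) s(1) V])
  have Y: "Y * V \<approx> V * Y \<or> (p dvd tr (Y * V) \<and> (p dvd tr Y \<or> p dvd dt V))"
    by (rule stabilizes_cases[OF D(2) s(2) V])
  consider "X * V \<approx> V * X" "Y * V \<approx> V * Y"
    | "X * V \<approx> V * X" "p dvd tr (Y * V)" "p dvd tr Y \<or> p dvd dt V"
    | "Y * V \<approx> V * Y" "p dvd tr (X * V)" "p dvd tr X \<or> p dvd dt V"
    | "p dvd tr X" "p dvd tr Y"
    | "p dvd dt V" "p dvd tr (X * V)" "p dvd tr (Y * V)" using X Y by blast
  then show ?thesis
  proof cases
    case 1
    then have "X * Y \<approx> Y * X" using centralizer_abelian[OF nV] eqm_sym by blast
    then have "bracket X Y \<approx> 0" by (simp add: bracket_eqm_0)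
    then show ?thesis unfolding special_def using p_dvd_eqm(2)[of _ 0] by simp
  next
    case 2 then show ?thesis using half c by blast
  next
    case 3 then show ?thesis using half[of Y X] c special_sym by blast
  next
    case 4 then show ?thesis by (simp add: special_def)
  next
    case 5
    obtain k where k: "X * V \<approx> k *s V" using null_eigen[OF V(1) 5(1) V(2) 5(2)] .
    obtain l where l: "Y * V \<approx> l *s V" using null_eigen[OF V(1) 5(1) V(2) 5(3)] .
    have *: "A * (B * V) \<approx> (m * n) *s V" if "A * V \<approx> m *s V" "B * V \<approx> n *s V" for A B m n
    proof -
      have "A * (B * V) \<approx> A * (n *s V)" by (rule eqm_mult[OF eqm_refl that(2)])
      also have "A * (n *s V) = n *s (A * V)" by simp
      also have "\<dots> \<approx> n *s m *s V" by (rule eqm_sm[OF that(1) cong_refl])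
      finally show ?thesis by (simp add: mult.commute)
    qed
    have "bracket X Y * V \<approx> 0"
      using eqm_diff[OF *[OF k l] *[OF l k]] by (simp add: bracket_def algebra_simps)
    then show ?thesis unfolding special_def using dvd_dt_if_annihilates V(2) by blast
  qed
qed

text \<open>Fricke identity, made homogeneous by determinants: tr ABC and tr ACB = tr BAC are the
  roots of a quadratic whose coefficients involve only the traces of the factors and of their
  pairwise products; this is its constant term.\<close>

lemma fricke:
  "tr (A * B * C) * tr (B * A * C) = tr A * tr A * dt B * dt C + tr B * tr B * dt A * dt C + tr C * tr C * dt A * dt B
    + tr (A * B) * tr (A * B) * dt C + tr (B * C) * tr (B * C) * dt A + tr (C * A) * tr (C * A) * dt B
    - tr A * tr B * tr (A * B) * dt C - tr B * tr C * tr (B * C) * dt A - tr C * tr A * tr (C * A) * dt B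
    + tr (A * B) * tr (B * C) * tr (C * A) - 4 * dt A * dt B * dt C"
  by (cases A; cases B; cases C) (simp add: algebra_simps)

text \<open>Up to sign, the traces of the elements of order 2, 3 and 4 of \<open>PSL2 p\<close>.\<close>

definition small_order :: "int \<Rightarrow> bool" where
  "small_order t \<longleftrightarrow> p dvd t \<or> p dvd t * t - 1 \<or> p dvd t * t - 2"

text \<open>If one sign is -1, then \<open>Z\<close> anticommutes with an invertible matrix and is
  traceless. Otherwise \<open>Z\<close> centralizes two matrices that do not commute and is
  scalar.\<close>

lemma two_fixed_lines:
  assumes "SL V" "SL W" "V * W \<approx> - (W * V)" "SL Z"
    and "Z * V * adj Z \<approx> V \<or> Z * V * adj Z \<approx> - V" "Z * W * adj Z \<approx> W \<or> Z * W * adj Z \<approx> - W"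
  shows "p dvd tr Z \<or> central Z"
proof -
  have *: "Z * U \<approx> U' * Z" if "Z * U * adj Z \<approx> U'" for U U'
  proof -
    have "Z * U * (adj Z * Z) \<approx> U' * Z" using eqm_mult[OF that eqm_refl[of Z]] by (simp add: mult.assoc)
    moreover have "Z * U * (adj Z * Z) \<approx> Z * U" using eqm_mult[OF eqm_refl[of "Z * U"] adj_inv(2)[OF assms(4)]] by simp
    ultimately show ?thesis using eqm_sym eqm_trans by blast
  qed
  have neg: "p dvd tr Z" if "Z * U * adj Z \<approx> - U" "SL U" for U
  proof -
    have "Z * (U * adj U) \<approx> (- (U * Z)) * adj U"
      using eqm_mult[OF *[OF that(1)] eqm_refl[of "adj U"]] by (simp add: mult.assoc)
    from eqm_tr[OF this] have "[dt U * tr Z = - (dt U * tr Z)] (mod p)"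
      by (simp add: mult_adj tr_conj)
    then have "p dvd 2 * (dt U * tr Z)" by (simp add: cong_iff_dvd_diff)
    then show ?thesis using SL_not_dvd[OF that(2)] by simp
  qed
  have "central Z" if "Z * V * adj Z \<approx> V" "Z * W * adj Z \<approx> W"
    using centralizer_abelian[of Z V W] *[OF that(1)] *[OF that(2)] anticommuting_not_commuting[OF assms(3)]
      SL_not_dvd[OF assms(1)] SL_not_dvd[OF assms(2)] by blast
  then show ?thesis using neg assms by blast
qed

text \<open>The square of \<open>tr Z\<close> is read off from how \<open>Z\<close> permutes three
  mutually orthogonal lines, without listing the elements of the octahedral group.\<close>

lemma klein_normalizer_trace:
  assumes D: "SL A" "SL B" "SL Z" and t: "p dvd tr A" "p dvd tr B" and AB: "A * B \<approx> - (B * A)"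
    and Z: "\<And>W. W \<in> {A, B, A * B} \<Longrightarrow> \<exists>W' \<in> {A, B, A * B}. Z * W * adj Z \<approx> W' \<or> Z * W * adj Z \<approx> - W'"
  shows "small_order (tr Z) \<or> central Z"
proof -
  let ?F = "{A, B, A * B}"
  \<comment> \<open>\<open>q W\<close> is 4, 0 or 2 according to whether \<open>Z\<close> fixes \<open>W\<close>, negates it, or moves its line.\<close>
  define q where "q W = tr Z * tr Z + tr (Z * W) * tr (Z * W)" for W
  define fixed where "fixed W \<longleftrightarrow> Z * W * adj Z \<approx> W \<or> Z * W * adj Z \<approx> - W" for W
  have "[tr (A * B) = - tr (A * B)] (mod p)" using eqm_tr[OF AB] by (simp add: tr_mult_commute)
  then have "p dvd 2 * tr (A * B)" by (simp add: cong_iff_dvd_diff)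
  then have tAB: "p dvd tr (A * B)" by simp
  have DF: "SL W" "p dvd tr W" if "W \<in> ?F" for W using that D SL_mult t tAB by auto
  have sq: "W * W \<approx> - 1" if "SL W" "p dvd tr W" for W
    unfolding cayley_hamilton using eqm_diff[OF sm_cong_0[OF that(2), of W] eqm_sm[OF eqm_refl[of 1] that(1)[unfolded SL_def]]] by simp
  have orth: "p dvd tr (W * W') \<or> W = W'" if "W \<in> ?F" "W' \<in> ?F" for W W'
  proof -
    have "A * (A * B) \<approx> - B" using eqm_mult[OF sq[OF D(1) t(1)] eqm_refl[of B]] by (simp add: mult.assoc)
    from p_dvd_eqm(1)[OF this] have 1: "p dvd tr (A * (A * B))" using t(2) by simp
    have "(A * B) * B \<approx> - A" using eqm_mult[OF eqm_refl[of A] sq[OF D(2) t(2)]] by (simp add: mult.assoc)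
    from p_dvd_eqm(1)[OF this] have 2: "p dvd tr ((A * B) * B)" using t(1) by simp
    show ?thesis using that 1 2 tAB tr_mult_commute[of A B] tr_mult_commute[of "A * B"] by auto
  qed
  have trW: "[tr (W * (Z * W * adj Z)) = 2 - q W] (mod p)" if "W \<in> ?F" for W
  proof -
    have "[tr W = 0] (mod p)" "[dt W = 1] (mod p)" "[dt Z = 1] (mod p)"
      using DF[OF that] D(3) by (simp_all add: SL_def cong_0_iff)
    then have "[tr (Z * W) * (tr Z * tr W - tr (Z * W)) - dt W * (tr Z * tr Z - 2 * dt Z) =
       tr (Z * W) * (tr Z * 0 - tr (Z * W)) - 1 * (tr Z * tr Z - 2 * 1)] (mod p)"
      by (intro cong_diff cong_mult cong_refl)
    then show ?thesis unfolding tr_mult_conj q_def by (simp add: algebra_simps)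
  qed
  have qW: "\<exists>s \<in> {0, 1, 2}. p dvd q W - 2 * s" and qW2: "\<not> fixed W \<Longrightarrow> p dvd q W - 2" if W: "W \<in> ?F" for W
  proof -
    obtain W' where W': "W' \<in> ?F" "Z * W * adj Z \<approx> W' \<or> Z * W * adj Z \<approx> - W'" using Z[OF W] by blast
    have "W * (Z * W * adj Z) \<approx> W * W' \<or> W * (Z * W * adj Z) \<approx> - (W * W')"
      using W'(2) eqm_mult[OF eqm_refl[of W]] by fastforce
    then obtain e where e: "e = 1 \<or> e = - 1" "[tr (W * (Z * W * adj Z)) = e * tr (W * W')] (mod p)"
      using eqm_tr by (metis mult_1 mult_minus_left tr_simps(4))
    then have m: "[2 - q W = e * tr (W * W')] (mod p)" using trW[OF W] cong_sym cong_trans by blast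
    have "p dvd - ((2 - q W) - e * tr (W * W'))" using m by (simp only: cong_iff_dvd_diff dvd_minus_iff)
    moreover have "- ((2 - q W) - e * tr (W * W')) = q W - (2 - e * tr (W * W'))" by simp
    ultimately have *: "p dvd q W - (2 - e * tr (W * W'))" by (simp only:)
    have orthq: "p dvd q W - 2" if "p dvd tr (W * W')"
      using dvd_diff[OF * dvd_mult[OF that, of e]] by simp
    moreover have "\<exists>s\<in>{0, 2}. p dvd q W - 2 * s" if "W = W'"
    proof -
      have "[tr (W * W) = - 2] (mod p)" using eqm_tr[OF sq[OF DF[OF W]]] by simp
      then have w: "p dvd tr (W * W) + 2" by (simp add: cong_iff_dvd_diff)
      have "p dvd q W - (2 - e * tr (W * W))" using * that by (simp only:)
      then have "p dvd (q W - (2 - e * tr (W * W))) - e * (tr (W * W) + 2)" by (rule dvd_diff[OF _ dvd_mult[OF w]])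
      moreover have "(q W - (2 - e * tr (W * W))) - e * (tr (W * W) + 2) = q W - (2 + 2 * e)" by (simp add: algebra_simps)
      ultimately have "p dvd q W - (2 + 2 * e)" by (simp only:)
      then show ?thesis using e(1) by auto
    qed
    ultimately show "\<exists>s \<in> {0, 1, 2}. p dvd q W - 2 * s" using orth[OF W W'(1)] by auto
    show "\<not> fixed W \<Longrightarrow> p dvd q W - 2" using orth[OF W W'(1)] orthq W'(2) unfolding fixed_def by blast
  qed
  \<comment> \<open>Equivalently, the squares of tr Z, tr(ZA), tr(ZB) and tr(ZAB) sum to 4: the
    matrices 1, \<open>A\<close>, \<open>B\<close>, \<open>A * B\<close> are orthogonal for the form
    tr(U adj V), each of norm 2. This is \<open>fricke\<close> combined with tr(BAZ) =
    -tr(ABZ).\<close>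
  have parseval: "p dvd q A + q B + q (A * B) - (2 * (tr Z * tr Z) + 4)"
  proof -
    have "[tr A = 0] (mod p)" "[tr B = 0] (mod p)" "[tr (A * B) = 0] (mod p)"
       "[dt A = 1] (mod p)" "[dt B = 1] (mod p)" "[dt Z = 1] (mod p)"
      using D t tAB by (simp_all add: SL_def cong_0_iff)
    then have "[tr (A * B * Z) * tr (B * A * Z) = 0 * 0 * 1 * 1 + 0 * 0 * 1 * 1 + tr Z * tr Z * 1 * 1
    + 0 * 0 * 1 + tr (B * Z) * tr (B * Z) * 1 + tr (Z * A) * tr (Z * A) * 1
    - 0 * 0 * 0 * 1 - 0 * tr Z * tr (B * Z) * 1 - tr Z * 0 * tr (Z * A) * 1
    + 0 * tr (B * Z) * tr (Z * A) - 4 * 1 * 1 * 1] (mod p)"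
      unfolding fricke by (intro cong_arith)
    then have 1: "[tr (A * B * Z) * tr (B * A * Z) = tr Z * tr Z + tr (Z * B) * tr (Z * B) + tr (Z * A) * tr (Z * A) - 4] (mod p)"
      by (simp add: tr_mult_commute[of B Z])
    have "B * A \<approx> - (A * B)" using eqm_sym[OF eqm_uminus[OF AB]] by simp
    then have "B * A * Z \<approx> - (A * B) * Z" by (rule eqm_mult[OF _ eqm_refl])
    from eqm_tr[OF this] have "[tr (B * A * Z) = - tr (A * B * Z)] (mod p)" by simp
    then have "[tr (A * B * Z) * tr (B * A * Z) = tr (A * B * Z) * - tr (A * B * Z)] (mod p)" by (rule cong_scalar_left)
    then have "[tr Z * tr Z + tr (Z * B) * tr (Z * B) + tr (Z * A) * tr (Z * A) - 4 = tr (A * B * Z) * - tr (A * B * Z)] (mod p)"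
      by (rule cong_trans[OF cong_sym[OF 1]])
    then show ?thesis
      unfolding cong_iff_dvd_diff q_def tr_mult_commute[of Z "A * B"] by (simp add: algebra_simps)
  qed
  \<comment> \<open>Two moved lines contribute 2 each to \<open>parseval\<close>, so the square of
    \<open>tr Z\<close> equals \<open>s\<close> when the third contributes 2 s.\<close>
  have two: "small_order (tr Z)"
    if "p dvd a - 2" "p dvd b - 2" and c: "\<exists>s\<in>{0, 1, 2}. p dvd c - 2 * s" and "p dvd a + b + c - (2 * (tr Z * tr Z) + 4)" for a b c
  proof -
    obtain s :: int where s: "s \<in> {0, 1, 2}" "p dvd c - 2 * s" using c by blast
    have "p dvd ((a - 2) + (b - 2) + (c - 2 * s)) - (a + b + c - (2 * (tr Z * tr Z) + 4))"
      by (intro dvd_diff dvd_add that s)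
    moreover have "((a - 2) + (b - 2) + (c - 2 * s)) - (a + b + c - (2 * (tr Z * tr Z) + 4)) = 2 * (tr Z * tr Z - s)"
      by simp
    ultimately have "p dvd tr Z * tr Z - s" by (metis p_dvd_mult not_p_dvd_numerals(2))
    then show ?thesis using s(1) unfolding small_order_def by (auto split: if_splits)
  qed
  have AAB: "A * (A * B) \<approx> - ((A * B) * A)"
    using eqm_mult[OF eqm_refl[of A] AB] by (simp add: mult.assoc)
  have BAB: "B * (A * B) \<approx> - ((A * B) * B)"
    using eqm_mult[OF eqm_uminus[OF AB] eqm_refl[of B]] eqm_sym by (simp add: mult.assoc)
  note small = SL_mult[OF D(1,2)]
  \<comment> \<open>Among three lines, two are fixed or two are moved.\<close>
  consider "fixed A" "fixed B" | "fixed A" "fixed (A * B)" | "fixed B" "fixed (A * B)"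
    | "\<not> fixed A" "\<not> fixed B" | "\<not> fixed A" "\<not> fixed (A * B)" | "\<not> fixed B" "\<not> fixed (A * B)" by blast
  then show ?thesis
  proof cases
    case 1 then show ?thesis using two_fixed_lines[OF D(1,2) AB D(3)] unfolding fixed_def small_order_def by blast
  next
    case 2 then show ?thesis using two_fixed_lines[OF D(1) small AAB D(3)] unfolding fixed_def small_order_def by blast
  next
    case 3 then show ?thesis using two_fixed_lines[OF D(2) small BAB D(3)] unfolding fixed_def small_order_def by blast
  next
    case 4 then show ?thesis using two[OF _ _ _ parseval] qW2[of A] qW2[of B] qW[of "A * B"] by simp
  next
    case 5 then show ?thesis using two[of "q A" "q (A * B)" "q B"] parseval qW2[of A] qW2[of "A * B"] qW[of B] by (simp add: add_ac)
  next
    case 6 then show ?thesis using two[of "q B" "q (A * B)" "q A"] parseval qW2[of B] qW2[of "A * B"] qW[of A] by (simp add: add_ac)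
  qed
qed

lemma traceless_commuting:
  assumes "SL A" "SL C" "\<not> central A" "p dvd tr A" "p dvd tr C" "A * C \<approx> C * A"
  shows "C \<approx> A \<or> C \<approx> - A"
proof -
  obtain k l where C: "C \<approx> k *s A + l *s 1" using commute_imp_affine[OF assms(3,6)] .
  have "p dvd k * tr A + l * 2" using p_dvd_eqm(1)[OF C] assms(5) by simp
  then have "p dvd l * 2" using assms(4) dvd_add_right_iff dvd_mult by blast
  then have "l *s 1 \<approx> 0" by (intro sm_cong_0) simp
  then have C': "C \<approx> k *s A" using C eqm_trans eqm_add_0[OF eqm_refl] by blast
  have "[k\<^sup>2 * dt A = k\<^sup>2 * 1] (mod p)" using assms(1) unfolding SL_def by (rule cong_scalar_left)
  moreover have "[k\<^sup>2 * dt A = 1] (mod p)" using SL_eqm[OF C' assms(2)] by (simp add: SL_def)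
  ultimately have "[k\<^sup>2 = 1] (mod p)" using cong_trans[OF cong_sym] by fastforce
  then have "p dvd k\<^sup>2 - 1" by (simp only: cong_iff_dvd_diff)
  moreover have "k\<^sup>2 - 1 = (k - 1) * (k + 1)" by (simp add: power2_eq_square algebra_simps)
  ultimately have "[k = 1] (mod p) \<or> [k = - 1] (mod p)" by (simp add: cong_iff_dvd_diff)
  then have "k *s A \<approx> 1 *s A \<or> k *s A \<approx> (- 1) *s A" using eqm_sm[OF eqm_refl] by blast
  then have "k *s A \<approx> A \<or> k *s A \<approx> - A" by (simp add: sm_distrib)
  then show ?thesis using C' eqm_trans by blast
qed

lemma central_conj: assumes "SL Z" shows "central (Z * A * adj Z) \<longleftrightarrow> central A"
proof -
  have *: "central (Z * A * adj Z)" if "central A" "SL Z" for Z A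
  proof -
    obtain k where "A \<approx> k *s 1" using \<open>central A\<close> unfolding central_def by blast
    then have "Z * A * adj Z \<approx> Z * (k *s 1) * adj Z" by (intro eqm_mult eqm_refl)
    also have "\<dots> = k *s (Z * adj Z)" by simp
    also have "\<dots> \<approx> k *s 1" by (rule eqm_sm[OF adj_inv(1)[OF that(2)] cong_refl])
    finally show ?thesis unfolding central_def by blast
  qed
  have "adj Z * (Z * A * adj Z) * Z \<approx> A"
  proof -
    have "adj Z * (Z * A * adj Z) * Z = (adj Z * Z) * A * (adj Z * Z)" by (simp add: mult.assoc)
    also have "\<dots> \<approx> 1 * A * 1" by (intro eqm_mult[OF eqm_mult[OF _ eqm_refl]] adj_inv(2) assms)
    finally show ?thesis by simp
  qed
  then show ?thesis using *[of A Z] *[of "Z * A * adj Z" "adj Z"] assms central_eqm by auto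
qed

text \<open>\<open>N\<close> collects the matrices lying over an abelian normal subgroup. Commuting
  in \<open>PSL2 p\<close> means commuting up to sign, so the Klein four-group case is where the
  sign -1 occurs between noncentral elements of \<open>N\<close>.\<close>

theorem solvable_cases:
  assumes D: "SL X" "SL Y" and c: "\<not> central X" "\<not> central Y" and "gen_solvable X Y"
  shows "special X Y \<or> (small_order (tr X) \<and> small_order (tr Y) \<and> (small_order (tr (X * Y)) \<or> central (X * Y)))"
proof -
  interpret G: group "PSL2 p" by (rule group_PSL2)
  let ?K = "generate (PSL2 p) {cl p X, cl p Y}"
  have K: "subgroup ?K (PSL2 p)" using D by (intro G.generate_is_subgroup) (simp add: cl_in)
  have XK: "cl p X \<in> ?K" and YK: "cl p Y \<in> ?K" by (auto intro: generate.incl)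
  have XYK: "cl p (X * Y) \<in> ?K" using subgroup.m_closed[OF K XK YK] D by (simp add: cl_mult)
  have "?K \<noteq> {\<one>\<^bsub>PSL2 p\<^esub>}" using XK cl_one_iff[OF D(1)] c(1) unfolding one_PSL2 by blast
  then obtain \<A> where \<A>: "subgroup \<A> (PSL2 p)" "\<A> \<noteq> {\<one>\<^bsub>PSL2 p\<^esub>}"
    and abel: "\<And>a b. \<lbrakk>a \<in> \<A>; b \<in> \<A>\<rbrakk> \<Longrightarrow> a \<otimes>\<^bsub>PSL2 p\<^esub> b = b \<otimes>\<^bsub>PSL2 p\<^esub> a"
    and conj: "\<And>x a. \<lbrakk>x \<in> ?K; a \<in> \<A>\<rbrakk> \<Longrightarrow> x \<otimes>\<^bsub>PSL2 p\<^esub> a \<otimes>\<^bsub>PSL2 p\<^esub> inv\<^bsub>PSL2 p\<^esub> x \<in> \<A>"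
    using G.solvable_abelian_normal[OF K assms(5)] by metis
  define N where "N A \<longleftrightarrow> SL A \<and> cl p A \<in> \<A>" for A
  have N_mult: "N (A * B)" if "N A" "N B" for A B
    using that subgroup.m_closed[OF \<A>(1), of "cl p A" "cl p B"] by (simp add: N_def cl_mult SL_mult)
  have N_conj: "N (Z * A * adj Z)" if "SL Z" "cl p Z \<in> ?K" "N A" for Z A
    using that conj[of "cl p Z" "cl p A"] by (simp add: N_def cl_mult cl_inv SL_mult)
  have N_comm: "A * B \<approx> B * A \<or> A * B \<approx> - (B * A)" if "N A" "N B" for A B
    using that abel[of "cl p A" "cl p B"] by (simp add: N_def cl_mult cl_eq_iff)
  have "\<exists>A. N A \<and> \<not> central A"
  proof -
    obtain a where a: "a \<in> \<A>" "a \<noteq> \<one>\<^bsub>PSL2 p\<^esub>" using \<A> subgroup.one_closed by blast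
    then obtain A where "SL A" "a = cl p A" using subgroup.subset[OF \<A>(1)] unfolding carrier_PSL2 by blast
    then show ?thesis using a cl_one_iff unfolding N_def one_PSL2 by blast
  qed
  then obtain A where A: "N A" "\<not> central A" by blast
  show ?thesis
  proof (cases "\<exists>A. N A \<and> \<not> central A \<and> \<not> p dvd tr A")
    case True
    then obtain A where A: "N A" "\<not> central A" "\<not> p dvd tr A" by blast
    \<comment> \<open>The sign -1 would make \<open>A\<close> conjugate to its negative and hence
      traceless.\<close>
    have comm: "A * B \<approx> B * A" if "N B" for B
    proof (rule ccontr)
      assume "\<not> A * B \<approx> B * A"
      then have "A * B \<approx> - (B * A)" using N_comm[OF A(1) that] by blast
      then have "A * B * adj B \<approx> - (B * A) * adj B" by (intro eqm_mult eqm_refl)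
      from eqm_tr[OF this] have "[dt B * tr A = - (dt B * tr A)] (mod p)"
        by (simp add: mult.assoc mult_adj) (simp add: mult.assoc[symmetric] tr_conj)
      then have "p dvd 2 * (dt B * tr A)" by (simp add: cong_iff_dvd_diff)
      then show False using A(3) that SL_not_dvd by (auto simp: N_def)
    qed
    let ?V = "2 *s A - tr A *s 1"
    have V: "p dvd tr ?V" "\<not> ?V \<approx> 0"
      using central_affine[of 2 A "- tr A"] traceless_central[of ?V] A(2) by (simp_all add: sm_distrib)
    have nV: "\<not> central ?V" using V traceless_central by blast
    have stab: "stabilizes Z ?V" if Z: "SL Z" "cl p Z \<in> ?K" for Z
    proof -
      \<comment> \<open>By normality \<open>?W\<close> comes from \<open>N\<close>, so it commutes
        with \<open>?V\<close> and is affine in it; being traceless, it is a multiple of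
        \<open>?V\<close>.\<close>
      let ?W = "Z * ?V * adj Z"
      have "?V * ?W = 4 *s (A * (Z * A * adj Z)) - (2 * tr A) *s (A * (Z * adj Z))
         - (2 * tr A) *s (Z * A * adj Z) + (tr A * tr A) *s (Z * adj Z)"
        by (simp add: algebra_simps sm_distrib)
      also have "\<dots> \<approx> 4 *s ((Z * A * adj Z) * A) - (2 * tr A) *s ((Z * adj Z) * A)
         - (2 * tr A) *s (Z * A * adj Z) + (tr A * tr A) *s (Z * adj Z)"
        using comm[OF N_conj[OF Z A(1)]] by (intro eqm_add eqm_diff eqm_sm cong_refl eqm_refl) (simp_all add: mult_adj)
      also have "\<dots> = ?W * ?V"
        by (simp add: algebra_simps sm_distrib)
      finally have "?V * ?W \<approx> ?W * ?V" .
      then obtain k l where kl: "?W \<approx> k *s ?V + l *s 1" using commute_imp_affine[OF nV] by blast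
      have "p dvd tr ?W" using V(1) by (simp add: tr_conj del: tr_simps)
      then have "p dvd k * tr ?V + l * 2" using p_dvd_eqm(1)[OF kl] by (simp only: tr_simps)
      then have "p dvd l * 2" using V(1) dvd_add_right_iff dvd_mult by blast
      then have "l *s 1 \<approx> 0" by (intro sm_cong_0) simp
      then have W: "?W \<approx> k *s ?V" using kl eqm_trans eqm_add_0[OF eqm_refl] by blast
      have "\<not> p dvd k"
      proof
        assume "p dvd k"
        then have "?W \<approx> 0" using W eqm_trans sm_cong_0 by blast
        then have "central ?W" unfolding central_def by (intro exI[of _ 0]) simp
        then show False using nV central_conj[OF Z(1)] by blast
      qed
      moreover have "Z * ?V \<approx> k *s (?V * Z)"
      proof -
        have "?W * Z = (Z * ?V) * (adj Z * Z)" by (simp only: mult.assoc)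
        moreover have "(Z * ?V) * (adj Z * Z) \<approx> (Z * ?V) * 1" by (rule eqm_mult[OF eqm_refl adj_inv(2)[OF Z(1)]])
        ultimately have "?W * Z \<approx> Z * ?V" by (simp only: mult.right_neutral)
        moreover have "?W * Z \<approx> k *s (?V * Z)" using eqm_mult[OF W eqm_refl[of Z]] by (simp only: mult_sm)
        ultimately show ?thesis by (rule eqm_trans[OF eqm_sym])
      qed
      ultimately show ?thesis unfolding stabilizes_def intertwines_def using inverse_mod_p by blast
    qed
    show ?thesis using common_line_special[OF D c V stab[OF D(1) XK] stab[OF D(2) YK]] by blast
  next
    case False
    then have tr0: "p dvd tr B" if "N B" "\<not> central B" for B using that by blast
    have A0: "p dvd tr A" "SL A" "\<not> A \<approx> 0" using tr0 A traceless_central by (auto simp: N_def)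
    have conj_stab: "stabilizes Z A" if "SL Z" "Z * A * adj Z \<approx> A \<or> Z * A * adj Z \<approx> - A" for Z
    proof -
      have "Z * A * adj Z * Z \<approx> Z * A"
        using eqm_mult[OF eqm_refl[of "Z * A"] adj_inv(2)[OF that(1)]] by (simp add: mult.assoc)
      moreover have "Z * A * adj Z * Z \<approx> A * Z \<or> Z * A * adj Z * Z \<approx> - (A * Z)"
        using that(2) eqm_mult[OF _ eqm_refl[of Z]] by fastforce
      ultimately have "Z * A \<approx> A * Z \<or> Z * A \<approx> - (A * Z)" using eqm_sym eqm_trans by blast
      then show ?thesis using intertwines_eqmI[of Z A A] intertwines_unitI[of 1 "-1" Z A A]
        unfolding stabilizes_def by (auto simp: sm_distrib)
    qed
    show ?thesis
    proof (cases "\<exists>B. N B \<and> \<not> central B \<and> \<not> (B \<approx> A \<or> B \<approx> - A)")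
      case False
      then have "Z * A * adj Z \<approx> A \<or> Z * A * adj Z \<approx> - A" if "SL Z" "cl p Z \<in> ?K" for Z
        using N_conj[OF that A(1)] central_conj[OF that(1)] A(2) by blast
      then show ?thesis using common_line_special[OF D c A0(1,3)] conj_stab D XK YK by blast
    next
      case True
      then obtain B where B: "N B" "\<not> central B" "\<not> (B \<approx> A \<or> B \<approx> - A)" by blast
      have B0: "p dvd tr B" "SL B" using tr0 B by (auto simp: N_def)
      have "\<not> A * B \<approx> B * A" using traceless_commuting[OF A0(2) B0(2) A(2) A0(1) B0(1)] B(3) by blast
      then have AB: "A * B \<approx> - (B * A)" using N_comm A B by blast
      have NAB: "N (A * B)" using N_mult A B by blast
      have cAB: "\<not> central (A * B)"
      proof
        assume "central (A * B)"
        then obtain k where "A * B \<approx> k *s 1" unfolding central_def by blast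
        then have "adj A * (A * B) * A \<approx> adj A * (k *s 1) * A" by (intro eqm_mult eqm_refl)
        also have "\<dots> = k *s (adj A * A)" by simp
        also have "\<dots> \<approx> k *s 1" by (intro eqm_sm adj_inv(2) A0 cong_refl)
        also have "\<dots> \<approx> A * B" by (rule eqm_sym) fact
        finally have "adj A * (A * B) * A \<approx> A * B" .
        moreover have "adj A * (A * B) * A = (adj A * A) * (B * A)" by (simp add: mult.assoc)
        moreover have "(adj A * A) * (B * A) \<approx> 1 * (B * A)" by (intro eqm_mult adj_inv(2) A0 eqm_refl)
        ultimately have "B * A \<approx> A * B" using eqm_sym eqm_trans by (metis mult_1)
        then show False using \<open>\<not> A * B \<approx> B * A\<close> eqm_sym by blast
      qed
      \<comment> \<open>A matrix that anticommutes with both \<open>A\<close> and \<open>B\<close>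
        commutes with \<open>A * B\<close>, and commuting traceless matrices of determinant 1 agree
        up to sign.\<close>
      have all: "\<exists>W\<in>{A, B, A * B}. C \<approx> W \<or> C \<approx> - W" if C: "N C" "\<not> central C" for C
      proof (cases "A * C \<approx> C * A \<or> B * C \<approx> C * B")
        case True
        then show ?thesis
          using traceless_commuting[OF A0(2) _ A(2) A0(1) tr0[OF C]] traceless_commuting[OF B0(2) _ B(2) B0(1) tr0[OF C]] C
          by (auto simp: N_def)
      next
        case False
        then have AC: "A * C \<approx> - (C * A)" and BC: "B * C \<approx> - (C * B)" using N_comm A B C by blast+
        have "(A * B) * C \<approx> A * (- (C * B))" using eqm_mult[OF eqm_refl[of A] BC] by (simp add: mult.assoc)
        also have "\<dots> = - (A * C) * B" by (simp add: mult.assoc)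
        also have "\<dots> \<approx> - (- (C * A)) * B" by (intro eqm_mult eqm_uminus AC eqm_refl)
        finally have "(A * B) * C \<approx> C * (A * B)" by (simp add: mult.assoc)
        then show ?thesis using traceless_commuting[OF _ _ cAB tr0[OF NAB cAB] tr0[OF C]] C NAB by (auto simp: N_def)
      qed
      have "small_order (tr Z) \<or> central Z" if Z: "SL Z" "cl p Z \<in> ?K" for Z
      proof (rule klein_normalizer_trace[OF A0(2) B0(2) Z(1) A0(1) B0(1) AB])
        fix W assume "W \<in> {A, B, A * B}"
        then have "N W" "\<not> central W" using A B NAB cAB by auto
        then show "\<exists>W'\<in>{A, B, A * B}. Z * W * adj Z \<approx> W' \<or> Z * W * adj Z \<approx> - W'"
          using all N_conj[OF Z] central_conj[OF Z(1)] by blast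
      qed
      then show ?thesis using D c XK YK XYK SL_mult by blast
    qed
  qed
qed

section \<open>Generic elements\<close>

lemma root_quadratic_card:
  "card {x \<in> {0..<p}. p dvd x * x + 6 * x + 1} \<le> 2"
proof (cases "{x \<in> {0..<p}. p dvd x * x + 6 * x + 1} = {}")
  case False
  then obtain y where y: "p dvd y * y + 6 * y + 1" by blast
  have "{x \<in> {0..<p}. p dvd x * x + 6 * x + 1} \<subseteq> {y mod p, (- y - 6) mod p}"
  proof
    fix x assume x: "x \<in> {x \<in> {0..<p}. p dvd x * x + 6 * x + 1}"
    then have "p dvd (x * x + 6 * x + 1) - (y * y + 6 * y + 1)" using y by (intro dvd_diff) simp_all
    moreover have "(x * x + 6 * x + 1) - (y * y + 6 * y + 1) = (x - y) * (x - (- y - 6))" by (simp add: algebra_simps)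
    ultimately have "x mod p = y mod p \<or> x mod p = (- y - 6) mod p" by (simp only: p_dvd_mult mod_eq_dvd_iff)
    moreover have "x mod p = x" using x by simp
    ultimately show "x \<in> {y mod p, (- y - 6) mod p}" by auto
  qed
  then have "card {x \<in> {0..<p}. p dvd x * x + 6 * x + 1} \<le> card {y mod p, (- y - 6) mod p}" by (intro card_mono) simp_all
  also have "\<dots> \<le> 2" by (simp add: card_insert_if)
  finally show ?thesis .
next
  case True
  show ?thesis unfolding True by simp
qed

lemma root_linear_card:
  assumes "\<not> p dvd a" shows "card {x \<in> {0..<p}. p dvd a * x + b} \<le> 1"
proof -
  have "x = y" if x: "x \<in> {x \<in> {0..<p}. p dvd a * x + b}" and y: "y \<in> {x \<in> {0..<p}. p dvd a * x + b}" for x y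
  proof -
    have "p dvd (a * x + b) - (a * y + b)" using x y by (intro dvd_diff) simp_all
    moreover have "(a * x + b) - (a * y + b) = a * (x - y)" by (simp add: algebra_simps)
    ultimately have "p dvd x - y" using assms by (simp only: p_dvd_mult) blast
    then have "x mod p = y mod p" by (simp only: mod_eq_dvd_iff)
    then show ?thesis using x y by simp
  qed
  then show ?thesis by (metis (no_types, lifting) One_nat_def card_le_Suc0_iff_eq finite_subset finite_atLeastLessThan_int mem_Collect_eq subsetI)
qed

lemma odd_p: "odd p"
  using prime_p p_gt prime_odd_int by simp

lemma half_squares_inj:
  assumes "\<not> p dvd a"
  shows "inj_on (\<lambda>m. (a * (m * m) + b) mod p) {0..(p - 1) div 2}"
proof (rule inj_onI)
  fix x y assume xy: "x \<in> {0..(p - 1) div 2}" "y \<in> {0..(p - 1) div 2}"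
    and "(a * (x * x) + b) mod p = (a * (y * y) + b) mod p"
  then have "p dvd (a * (x * x) + b) - (a * (y * y) + b)" by (simp only: mod_eq_dvd_iff)
  moreover have "(a * (x * x) + b) - (a * (y * y) + b) = a * ((x - y) * (x + y))" by (simp add: algebra_simps)
  ultimately have "p dvd x - y \<or> p dvd x + y" using assms by (simp only: p_dvd_mult) blast
  moreover have "\<bar>x - y\<bar> < p" "0 \<le> x + y" "x + y < p" using xy odd_p by auto
  ultimately show "x = y"
    using dvd_imp_le_int[of "x - y" p] zdvd_imp_le[of p "x + y"] xy by fastforce
qed

lemma p_cases: "p = 11 \<or> p = 13 \<or> p \<ge> 17"
proof (rule ccontr)
  assume "\<not> ?thesis"
  then have "p = 8 \<or> p = 9 \<or> p = 10 \<or> p = 12 \<or> p = 14 \<or> p = 15 \<or> p = 16" using p_gt by linarith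
  moreover have "\<not> 2 dvd p" using odd_p by simp
  moreover have "\<not> 3 dvd p" using primes_dvd_imp_eq[of 3 p] prime_p p_gt by auto
  ultimately show False by auto
qed

text \<open>The Cayley transform \<open>(1 + m W) / (1 - m W)\<close> of a traceless \<open>W\<close> with \<open>W\<^sup>2 = a\<close> has trace
  \<open>2 (1 + w) / (1 - w)\<close> for \<open>w = a m\<^sup>2\<close>; the factors exclude the traces 0, 1, -1 and the square roots of 2.\<close>

definition good_param :: "int \<Rightarrow> bool" where
  "good_param w \<longleftrightarrow> \<not> p dvd 1 - w \<and> \<not> p dvd 1 + w \<and> \<not> p dvd 3 * w + 1 \<and> \<not> p dvd w + 3 \<and> \<not> p dvd w * w + 6 * w + 1"

lemma good_param_cong:
  assumes "[v = w] (mod p)" "good_param v" shows "good_param w"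
proof -
  have "[1 - v = 1 - w] (mod p)" "[1 + v = 1 + w] (mod p)" "[3 * v + 1 = 3 * w + 1] (mod p)" "[v + 3 = w + 3] (mod p)"
    "[v * v + 6 * v + 1 = w * w + 6 * w + 1] (mod p)"
    using assms(1) by (intro cong_arith; assumption)+
  then show ?thesis using assms(2) cong_dvd_iff unfolding good_param_def by blast
qed

text \<open>The discriminant is 32, twice a square, and 2 is a nonresidue modulo 11 and 13.\<close>

lemma no_root_quadratic:
  assumes "p = 11 \<or> p = 13" shows "{x \<in> {0..<p}. p dvd x * x + 6 * x + 1} = {}"
proof -
  have iv: "{0..<p} \<subseteq> set [0..12]" using assms by auto
  have "\<not> p dvd x * x + 6 * x + 1" if "x \<in> set [0..12]" for x
    using assms that by (elim disjE) (auto simp: upto_rec1 dvd_eq_mod_eq_0)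
  then show ?thesis using iv by blast
qed

text \<open>For invertible \<open>a\<close> the values \<open>a * (m * m)\<close> with nonzero m
  number (p - 1)/2, and at most 4 + 2 of them are bad. This suffices from p = 17 on; for 11 and 13
  the quadratic has no root, leaving at most 4 bad values against 5 and 6.\<close>

lemma exists_good_param: obtains m where "\<not> p dvd m" "good_param (a * (m * m))"
proof (cases "p dvd a")
  case True
  then have "[a * (1 * 1) = 0] (mod p)" by (simp add: cong_0_iff)
  moreover have "good_param 0" by (simp add: good_param_def)
  ultimately have "good_param (a * (1 * 1))" by (metis good_param_cong cong_sym)
  then show thesis using that[of 1] by simp
next
  case False
  show thesis
  proof (rule ccontr)
    assume neg: "\<not> thesis"
    let ?S = "(\<lambda>m. (a * (m * m) + 0) mod p) ` {1..(p - 1) div 2}"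
    let ?R = "\<lambda>b c. {x \<in> {0..<p}. p dvd b * x + c}"
    let ?Q = "{x \<in> {0..<p}. p dvd x * x + 6 * x + 1}"
    have inj: "inj_on (\<lambda>m. (a * (m * m) + 0) mod p) {1..(p - 1) div 2}"
      using half_squares_inj[OF False, of 0] by (rule inj_on_subset) auto
    have fin: "finite {x \<in> {0..<p}. P x}" for P by (rule finite_subset[of _ "{0..<p}"]) auto
    have card_S: "card ?S = nat ((p - 1) div 2)" unfolding card_image[OF inj] by simp
    have "?S \<subseteq> ?R (-1) 1 \<union> ?R 1 1 \<union> ?R 3 1 \<union> ?R 1 3 \<union> ?Q"
    proof
      fix x assume "x \<in> ?S"
      then obtain m where m: "m \<in> {1..(p - 1) div 2}" "x = a * (m * m) mod p" by auto
      have "0 < m" "m < p" using m(1) p_gt by simp_all linarith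
      then have "\<not> p dvd m" by (rule not_p_dvd)
      then have "\<not> good_param (a * (m * m))" using neg that by blast
      moreover have "[x = a * (m * m)] (mod p)" using m(2) by simp
      ultimately have "\<not> good_param x" using good_param_cong by blast
      moreover have "x \<in> {0..<p}" using m(2) p_gt by simp
      ultimately show "x \<in> ?R (-1) 1 \<union> ?R 1 1 \<union> ?R 3 1 \<union> ?R 1 3 \<union> ?Q"
        unfolding good_param_def by (auto simp: add.commute)
    qed
    then have le: "card ?S \<le> card (?R (-1) 1 \<union> ?R 1 1 \<union> ?R 3 1 \<union> ?R 1 3 \<union> ?Q)"
      by (intro card_mono finite_UnI fin)
    have "card (?R (-1) 1 \<union> ?R 1 1 \<union> ?R 3 1 \<union> ?R 1 3 \<union> ?Q) \<le> card (?R (-1) 1) + card (?R 1 1) + card (?R 3 1) + card (?R 1 3) + card ?Q"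
      by (intro order_trans[OF card_Un_le] add_mono order_refl)
    also have "\<dots> \<le> 1 + 1 + 1 + 1 + card ?Q" by (intro add_mono root_linear_card order_refl) simp_all
    finally have bound: "nat ((p - 1) div 2) \<le> 4 + card ?Q" using le card_S by linarith
    show False
    proof (cases "p \<ge> 17")
      case True
      then show False using bound root_quadratic_card by linarith
    next
      case False
      then have p: "p = 11 \<or> p = 13" using p_cases by blast
      moreover have "card ?Q = 0" unfolding no_root_quadratic[OF p] by simp
      ultimately show False using bound by auto
    qed
  qed
qed

definition generic :: "mat \<Rightarrow> bool" where
  "generic X \<longleftrightarrow> SL X \<and> \<not> central X \<and> \<not> small_order (tr X)"

lemma exists_generic:
  assumes "\<not> central V" obtains G where "generic G" "G * V \<approx> V * G"
proof -
  define W where "W = 2 *s V - tr V *s 1"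
  define Q where "Q = - dt W"
  obtain m where m: "\<not> p dvd m" "good_param (Q * (m * m))" using exists_good_param by blast
  define w where "w = Q * (m * m)"
  note good = m(2)[folded w_def, unfolded good_param_def]
  obtain i where i: "[(1 - w) * i = 1] (mod p)" using inverse_mod_p good by blast
  have pi: "\<not> p dvd i" using inverse_not_dvd[OF i] by blast
  have W: "\<not> central W" "tr W = 0"
    using central_affine[of 2 V "- tr V"] assms by (simp_all add: W_def sm_distrib)
  \<comment> \<open>This is (1 + m W)^2 / (1 - w), the Cayley transform of m W, with
    \<open>i\<close> in place of the inverse of 1 - w; it uses that the square of \<open>W\<close>
    is the scalar \<open>Q\<close>.\<close>
  define G where "G = (i * (2 * m)) *s W + (i * (1 + w)) *s 1"
  have dtG: "dt G = i * i * ((1 + w) * (1 + w) + 4 * (m * m) * dt W)"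
  proof (cases W)
    case (Mat a b c d)
    then have "d = - a" using W(2) by simp
    then show ?thesis by (simp add: Mat G_def one_mat_def algebra_simps)
  qed
  have "dt G = ((1 - w) * i) * ((1 - w) * i)"
    unfolding dtG by (simp add: w_def Q_def algebra_simps)
  then have "SL G" unfolding SL_def using cong_mult[OF i i] by simp
  moreover have "\<not> central G" unfolding G_def central_affine using W m pi by simp
  moreover have "\<not> small_order (tr G)"
  proof -
    have t: "tr G = 2 * (i * (1 + w))" unfolding G_def using W(2) by simp
    have sq: "tr G * tr G - c = i * i * (4 * (1 + w) * (1 + w) - c * (1 - w) * (1 - w)) + c * (((1 - w) * i) * ((1 - w) * i) - 1)" for c
      unfolding t by (simp add: algebra_simps)
    have "p dvd ((1 - w) * i) * ((1 - w) * i) - 1" using cong_mult[OF i i] by (simp add: cong_iff_dvd_diff)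
    then have *: "p dvd tr G * tr G - c \<longleftrightarrow> p dvd i * i * (4 * (1 + w) * (1 + w) - c * (1 - w) * (1 - w))" for c
      unfolding sq by (intro dvd_add_left_iff dvd_mult)
    have "\<not> p dvd tr G" using t pi good by simp
    moreover have "4 * (1 + w) * (1 + w) - 1 * (1 - w) * (1 - w) = (3 * w + 1) * (w + 3)" by (simp add: algebra_simps)
    then have "\<not> p dvd tr G * tr G - 1" using *[of 1] pi good by (simp only: p_dvd_mult) blast
    moreover have "4 * (1 + w) * (1 + w) - 2 * (1 - w) * (1 - w) = 2 * (w * w + 6 * w + 1)" by (simp add: algebra_simps)
    then have "\<not> p dvd tr G * tr G - 2" using *[of 2] pi good not_p_dvd_numerals by (simp only: p_dvd_mult) blast
    ultimately show ?thesis unfolding small_order_def by blast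
  qed
  moreover have "G * V = V * G" unfolding G_def W_def by (simp add: algebra_simps sm_distrib)
  ultimately show thesis using that[of G] unfolding generic_def by simp
qed

section \<open>Partners with prescribed traces\<close>

text \<open>Pigeonhole: a u^2 and c - b v^2 each take (p + 1)/2 values, so they share one.\<close>

lemma binary_form_represents:
  assumes "\<not> p dvd a" "\<not> p dvd b"
  obtains u v where "p dvd a * (u * u) + b * (v * v) - c"
proof -
  let ?I = "{0..(p - 1) div 2}"
  let ?f = "\<lambda>u. (a * (u * u) + 0) mod p" and ?g = "\<lambda>v. (- b * (v * v) + c) mod p"
  have inj: "inj_on ?f ?I" "inj_on ?g ?I"
    using assms by (intro half_squares_inj; simp)+
  have "?f ` ?I \<inter> ?g ` ?I \<noteq> {}"
  proof
    assume "?f ` ?I \<inter> ?g ` ?I = {}"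
    then have "card (?f ` ?I \<union> ?g ` ?I) = card (?f ` ?I) + card (?g ` ?I)"
      by (intro card_Un_disjoint finite_imageI) simp_all
    then have "card (?f ` ?I \<union> ?g ` ?I) = card ?I + card ?I"
      by (simp only: card_image[OF inj(1)] card_image[OF inj(2)])
    moreover have "?f ` ?I \<union> ?g ` ?I \<subseteq> {0..<p}" using p_gt by auto
    then have "card (?f ` ?I \<union> ?g ` ?I) \<le> card {0..<p}" by (intro card_mono) simp_all
    moreover have "p = 2 * ((p - 1) div 2) + 1" using odd_p by simp
    ultimately show False using p_gt by simp
  qed
  then obtain u v where "?f u = ?g v" by blast
  then have "p dvd (a * (u * u) + 0) - (- b * (v * v) + c)" by (simp only: mod_eq_dvd_iff)
  then have "p dvd a * (u * u) + b * (v * v) - c" by (simp add: algebra_simps)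
  then show thesis by (rule that)
qed

text \<open>In a basis \<open>e\<close>, \<open>X e\<close> the matrix \<open>X\<close> becomes a companion matrix, for which \<open>Y\<close> can be written down.\<close>

lemma exists_with_traces:
  assumes "SL X" "\<not> central X" and "p dvd s * s - tr X * k * s + k * k - b * s + c * k + 1"
  obtains Y where "SL Y" "[tr Y = b] (mod p)" "[tr (X * Y) = c] (mod p)"
proof -
  obtain x y z w where X: "X = Mat x y z w" by (cases X)
  define P where "P e f = Mat e (x * e + y * f) f (z * e + w * f)" for e f
  have "\<exists>e f. \<not> p dvd dt (P e f)"
  proof -
    \<comment> \<open>The columns of \<open>P e f\<close> are a vector and its image under
      \<open>X\<close>. If (1,0), (0,1) and (1,1) were all eigenvectors, \<open>X\<close> would be
      scalar.\<close>
    have "dt (P 1 0) = z" "dt (P 0 1) = - y" "dt (P 1 1) = z - y + (w - x)" by (simp_all add: P_def)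
    moreover have "\<not> p dvd z \<or> \<not> p dvd y \<or> (p dvd z - y \<and> \<not> p dvd w - x)"
    proof -
      have "p dvd x - w \<longleftrightarrow> p dvd w - x" by (rule dvd_diff_commute)
      then show ?thesis using assms(2) by (auto simp: X central_iff)
    qed
    ultimately show ?thesis using dvd_add_right_iff dvd_minus_iff by metis
  qed
  then obtain e f where q: "\<not> p dvd dt (P e f)" by blast
  let ?P = "P e f"
  obtain i where i: "[dt ?P * i = 1] (mod p)" using inverse_mod_p[OF q] .
  define C where "C = Mat 0 (- dt X) 1 (tr X)"
  \<comment> \<open>The lower row is free; the two trace conditions fix the upper row, and
    determinant 1 becomes the quadratic equation of the hypothesis.\<close>
  define Y0 where "Y0 = Mat (b - s) (c + k - tr X * s) k s"
  define Y where "Y = i *s (?P * Y0 * adj ?P)"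
  have "X * ?P = ?P * C" by (simp add: X P_def C_def algebra_simps)
  then have XY: "X * Y = i *s (?P * (C * Y0) * adj ?P)" unfolding Y_def by (simp add: mult.assoc[symmetric])
  have trY: "[dt ?P * i * r = r] (mod p)" for r using cong_scalar_right[OF i, of r] by simp
  have "tr Y = dt ?P * i * b" by (simp add: Y_def tr_conj) (simp add: Y0_def algebra_simps)
  then have 1: "[tr Y = b] (mod p)" using trY by simp
  have "tr (X * Y) = i * (dt ?P * tr (C * Y0))" unfolding XY by (simp only: tr_simps tr_conj)
  then have "tr (X * Y) = dt ?P * i * tr (C * Y0)" by simp
  moreover have "[tr (C * Y0) = c] (mod p)"
  proof -
    have "tr (C * Y0) = - (dt X * k) + (c + k - tr X * s) + tr X * s" by (simp add: C_def Y0_def)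
    also have "[\<dots> = - (1 * k) + (c + k - tr X * s) + tr X * s] (mod p)"
      using assms(1) unfolding SL_def by (intro cong_add cong_minus_minus_iff[THEN iffD2] cong_mult cong_refl)
    finally show ?thesis by simp
  qed
  ultimately have 2: "[tr (X * Y) = c] (mod p)" using trY cong_trans by fastforce
  have "dt Y0 = - (s * s - tr X * k * s + k * k - b * s + c * k + 1) + 1" by (simp add: Y0_def algebra_simps)
  moreover have "p dvd - (s * s - tr X * k * s + k * k - b * s + c * k + 1)" using assms(3) by (simp only: dvd_minus_iff)
  ultimately have "[dt Y0 = 1] (mod p)" by (simp only: cong_iff_dvd_diff add_diff_cancel)
  moreover have "dt Y = (dt ?P * i) * (dt ?P * i) * dt Y0" by (simp add: Y_def power2_eq_square algebra_simps)
  ultimately have "[dt Y = 1 * 1 * 1] (mod p)" using cong_mult[OF cong_mult[OF i i]] by simp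
  then have "SL Y" by (simp add: SL_def)
  then show thesis using 1 2 by (rule that)
qed

lemma tetrahedral_partner:
  assumes "SL X" "\<not> central X" "[tr X = 1] (mod p)"
  obtains Y where "SL Y" "[tr Y = 0] (mod p)" "[tr (X * Y) = 1] (mod p)"
proof -
  \<comment> \<open>Completing squares: 12 (s^2 - k s + k^2 + k + 1) = 3 (2 s - k)^2 + (3 k + 2)^2 +
    8.\<close>
  obtain u v where uv: "p dvd 3 * (u * u) + 1 * (v * v) - (- 8)" by (rule binary_form_represents[OF not_p_dvd_numerals(3) not_p_dvd_numerals(1)])
  obtain h where h: "[3 * h = 1] (mod p)" using inverse_mod_p[of 3] by auto
  obtain g where g: "[2 * g = 1] (mod p)" using inverse_mod_p[of 2] by auto
  define k where "k = h * (v - 2)"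
  define s where "s = g * (u + k)"
  have "[(3 * h) * (v - 2) = 1 * (v - 2)] (mod p)" by (rule cong_scalar_right[OF h])
  then have k: "[3 * k + 2 = v] (mod p)" using cong_add[of _ _ p 2 2] by (fastforce simp: k_def mult.assoc)
  have "[(2 * g) * (u + k) = 1 * (u + k)] (mod p)" by (rule cong_scalar_right[OF g])
  then have s: "[2 * s - k = u] (mod p)" using cong_diff[of _ _ p k k] by (fastforce simp: s_def mult.assoc)
  have "[3 * ((2 * s - k) * (2 * s - k)) + 1 * ((3 * k + 2) * (3 * k + 2)) - (- 8) = 3 * (u * u) + 1 * (v * v) - (- 8)] (mod p)"
    by (intro cong_arith s k)
  then have "p dvd 3 * ((2 * s - k) * (2 * s - k)) + 1 * ((3 * k + 2) * (3 * k + 2)) - (- 8)" using uv cong_dvd_iff by blast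
  moreover have "3 * ((2 * s - k) * (2 * s - k)) + 1 * ((3 * k + 2) * (3 * k + 2)) - (- 8)
     = 3 * (4 * (s * s - 1 * k * s + k * k - 0 * s + 1 * k + 1))" by (simp add: algebra_simps)
  ultimately have e: "p dvd s * s - 1 * k * s + k * k - 0 * s + 1 * k + 1" by (metis p_dvd_mult not_p_dvd_numerals(3,4))
  have "[s * s - tr X * k * s + k * k - 0 * s + 1 * k + 1 = s * s - 1 * k * s + k * k - 0 * s + 1 * k + 1] (mod p)"
    by (intro cong_arith assms(3))
  then have "p dvd s * s - tr X * k * s + k * k - 0 * s + 1 * k + 1" using e cong_dvd_iff by blast
  then show thesis using exists_with_traces[OF assms(1,2)] that by metis
qed

lemma octahedral_partner:
  assumes "SL X" "\<not> central X" "[r * r = 2] (mod p)" "[tr X = r] (mod p)"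
  obtains Y where "SL Y" "[tr Y = r] (mod p)" "[tr (X * Y) = 1] (mod p)"
proof -
  \<comment> \<open>With r^2 = 2, completing the square in \<open>s\<close> turns four times the
    quadratic of \<open>exists_with_traces\<close> into (2 s - r (k + 1))^2 + 2 k^2 + 2.\<close>
  obtain u k where uv: "p dvd 1 * (u * u) + 2 * (k * k) - (- 2)" by (rule binary_form_represents[OF not_p_dvd_numerals(1) not_p_dvd_numerals(2)])
  obtain g where g: "[2 * g = 1] (mod p)" using inverse_mod_p[of 2] by auto
  define s where "s = g * (u + r * (k + 1))"
  have "[(2 * g) * (u + r * (k + 1)) = 1 * (u + r * (k + 1))] (mod p)" by (rule cong_scalar_right[OF g])
  then have s: "[2 * s - r * (k + 1) = u] (mod p)"
    using cong_diff[of _ _ p "r * (k + 1)" "r * (k + 1)"] by (fastforce simp: s_def mult.assoc)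
  have "[1 * ((2 * s - r * (k + 1)) * (2 * s - r * (k + 1))) - (r * r) * ((k + 1) * (k + 1)) + 4 * k * k + 4 * k + 4
     = 1 * (u * u) - 2 * ((k + 1) * (k + 1)) + 4 * k * k + 4 * k + 4] (mod p)"
    by (intro cong_arith s assms(3))
  moreover have "1 * (u * u) - 2 * ((k + 1) * (k + 1)) + 4 * k * k + 4 * k + 4 = 1 * (u * u) + 2 * (k * k) - (- 2)"
    by (simp add: algebra_simps)
  moreover have "1 * ((2 * s - r * (k + 1)) * (2 * s - r * (k + 1))) - (r * r) * ((k + 1) * (k + 1)) + 4 * k * k + 4 * k + 4
     = 4 * (s * s - r * k * s + k * k - r * s + 1 * k + 1)" by (simp add: algebra_simps)
  ultimately have "p dvd 4 * (s * s - r * k * s + k * k - r * s + 1 * k + 1)" using uv cong_dvd_iff by metis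
  then have e: "p dvd s * s - r * k * s + k * k - r * s + 1 * k + 1" by (metis p_dvd_mult not_p_dvd_numerals(4))
  have "[s * s - tr X * k * s + k * k - r * s + 1 * k + 1 = s * s - r * k * s + k * k - r * s + 1 * k + 1] (mod p)"
    by (intro cong_arith assms(4))
  then have "p dvd s * s - tr X * k * s + k * k - r * s + 1 * k + 1" using e cong_dvd_iff by blast
  then show thesis using exists_with_traces[OF assms(1,2)] that by metis
qed

section \<open>Equality of solvabilizers\<close>

definition SolM :: "mat \<Rightarrow> mat2 set set" where "SolM X = Sol (PSL2 p) (cl p X)"

lemma in_SolM: "SL Y \<Longrightarrow> cl p Y \<in> SolM X \<longleftrightarrow> gen_solvable X Y"
  by (simp add: SolM_def Sol_def cl_in)

lemma SolM_subset: "SolM X \<subseteq> cl p ` Collect SL"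
  by (auto simp: SolM_def Sol_def carrier_PSL2)

lemma SolM_eqI: "(\<And>Y. SL Y \<Longrightarrow> gen_solvable X Y \<longleftrightarrow> gen_solvable X' Y) \<Longrightarrow> SolM X = SolM X'"
  using SolM_subset in_SolM by (intro equalityI subsetI) fastforce+

lemma gen_solvable_sym: "gen_solvable X Y \<longleftrightarrow> gen_solvable Y X"
  by (simp add: insert_commute)

lemma gen_solvable_central:
  assumes "SL X" "SL Y" "central Y" shows "gen_solvable X Y"
proof -
  obtain k where k: "Y \<approx> k *s 1" using assms(3) unfolding central_def by blast
  have *: "V * Y \<approx> Y * V" for V
  proof -
    have "V * Y \<approx> V * (k *s 1)" by (rule eqm_mult[OF eqm_refl k])
    also have "V * (k *s 1) = (k *s 1) * V" by simp
    also have "\<dots> \<approx> Y * V" by (rule eqm_mult[OF eqm_sym[OF k] eqm_refl])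
    finally show ?thesis .
  qed
  have Y: "stabilizes Y V" for V using * eqm_sym commute_stabilizes by blast
  show ?thesis
  proof (cases "central X")
    case False
    then show ?thesis using common_line_solvable[OF assms(1,2) False stabilizes_self Y] by blast
  next
    case True
    then obtain l where l: "X \<approx> l *s 1" unfolding central_def by blast
    have X: "X * V \<approx> V * X" for V
    proof -
      have "X * V \<approx> (l *s 1) * V" by (rule eqm_mult[OF l eqm_refl])
      also have "(l *s 1) * V = V * (l *s 1)" by simp
      also have "\<dots> \<approx> V * X" by (rule eqm_mult[OF eqm_refl eqm_sym[OF l]])
      finally show ?thesis .
    qed
    have "\<not> central (Mat 0 1 0 0)" by (simp add: central_iff)
    then show ?thesis using common_line_solvable[OF assms(1,2) _ commute_stabilizes[OF X] Y] by blast
  qed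
qed

lemma generic_solvable_iff:
  assumes "generic X" "SL Y" "\<not> central Y" shows "gen_solvable X Y \<longleftrightarrow> special X Y"
  using assms special_solvable[of X Y] solvable_cases[of X Y] by (auto simp: generic_def)

lemma generic_tr: "generic X \<Longrightarrow> \<not> p dvd tr X" by (auto simp: generic_def small_order_def)

text \<open>For a generic matrix commuting with \<open>V\<close>, this condition describes when it generates a solvable
  group together with \<open>X\<close>; so it is determined by the solvabilizer of \<open>X\<close>.\<close>

definition axis_test :: "mat \<Rightarrow> mat \<Rightarrow> bool" where
  "axis_test X V \<longleftrightarrow> p dvd dt (bracket X V) \<or> (p dvd tr X \<and> p dvd tr (X * V))"

lemma dt_bracket_sym: "dt (bracket X Y) = dt (bracket Y X)" by (simp add: bracket_swap[of X Y])

lemma special_test: "\<not> p dvd tr Y \<Longrightarrow> special X Y \<longleftrightarrow> axis_test X Y"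
  by (auto simp: special_def axis_test_def)

lemma bracket_affine: "X \<approx> k *s V + l *s 1 \<Longrightarrow> bracket X Y \<approx> k *s bracket V Y"
proof -
  assume "X \<approx> k *s V + l *s 1"
  then have "bracket X Y \<approx> bracket (k *s V + l *s 1) Y" by (rule eqm_bracket[OF _ eqm_refl])
  also have "bracket (k *s V + l *s 1) Y = k *s bracket V Y" by (simp add: bracket_def algebra_simps sm_distrib)
  finally show ?thesis .
qed

lemma affine_unit: "X \<approx> k *s V + l *s 1 \<Longrightarrow> \<not> central X \<Longrightarrow> \<not> p dvd k"
  using central_eqm central_affine by blast

text \<open>The test sees only the axis of its second argument, so a generic \<open>G\<close> may be
  replaced by any \<open>V\<close> on its axis, even one without an inverse.\<close>

lemma axis_test_affine:
  assumes "G \<approx> k *s V + l *s 1" "\<not> p dvd k" shows "axis_test X G \<longleftrightarrow> axis_test X V"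
proof -
  have "p dvd dt (bracket G X) \<longleftrightarrow> p dvd dt (bracket V X)"
    using p_dvd_eqm(2)[OF bracket_affine[OF assms(1), of X]] assms(2) by simp
  moreover have "p dvd tr (X * G) \<longleftrightarrow> p dvd tr (X * V)" if "p dvd tr X"
  proof -
    have "X * G \<approx> X * (k *s V + l *s 1)" by (rule eqm_mult[OF eqm_refl assms(1)])
    from p_dvd_eqm(1)[OF this] have "p dvd tr (X * G) \<longleftrightarrow> p dvd k * tr (X * V) + l * tr X" by (simp add: algebra_simps)
    also have "\<dots> \<longleftrightarrow> p dvd k * tr (X * V)" using that by (intro dvd_add_left_iff dvd_mult)
    finally show ?thesis using assms(2) by simp
  qed
  ultimately show ?thesis unfolding axis_test_def dt_bracket_sym[of X] by blast
qed

lemma generic_solvable_test: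
  assumes "SL X" "\<not> central X" "generic G" "\<not> central V" "G * V \<approx> V * G"
  shows "gen_solvable X G \<longleftrightarrow> axis_test X V"
proof -
  have nG: "SL G" "\<not> central G" "\<not> p dvd tr G" using assms(3) generic_tr by (auto simp: generic_def)
  obtain k l where kl: "G \<approx> k *s V + l *s 1" using commute_imp_affine[OF assms(4) eqm_sym[OF assms(5)]] .
  show ?thesis
    using generic_solvable_iff[OF assms(3,1,2)] special_test[OF nG(3), of X] axis_test_affine[OF kl affine_unit[OF kl nG(2)], of X]
      gen_solvable_sym[of X G] special_sym[of X G] by blast
qed

text \<open>Every axis carries a generic element, and its membership in the solvabilizer is the test
  on that axis.\<close>

lemma same_SolM_test:
  assumes "SL X" "SL X'" "\<not> central X" "\<not> central X'" "SolM X = SolM X'" "\<not> central V"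
  shows "axis_test X V \<longleftrightarrow> axis_test X' V"
proof -
  obtain G where G: "generic G" "G * V \<approx> V * G" using exists_generic[OF assms(6)] .
  then have "SL G" by (simp add: generic_def)
  then show ?thesis
    using generic_solvable_test[OF assms(1,3) G(1) assms(6) G(2)] generic_solvable_test[OF assms(2,4) G(1) assms(6) G(2)]
      in_SolM[of G X] in_SolM[of G X'] assms(5) by simp
qed

lemma dt_bracket: "dt (bracket X Y) = 4 * dt X * dt Y + tr X * tr Y * tr (X * Y) - tr X * tr X * dt Y - tr Y * tr Y * dt X - tr (X * Y) * tr (X * Y)"
  by (cases X; cases Y) (simp add: bracket_def algebra_simps)

section \<open>Recovering the axis from the solvabilizer\<close>

lemma trace_nondegenerate:
  assumes "\<And>A. p dvd tr (A * N)" shows "N \<approx> 0"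
proof (cases N)
  case (Mat a b c d)
  show ?thesis
    using assms[of "Mat 1 0 0 0"] assms[of "Mat 0 1 0 0"] assms[of "Mat 0 0 1 0"] assms[of "Mat 0 0 0 1"]
    by (simp add: Mat eqm_0_iff)
qed

text \<open>For null \<open>V\<close> the determinant of the bracket is minus the square of
  \<open>tr (X * V)\<close>, so on null lines the test is linear in \<open>X\<close>.\<close>

lemma null_test:
  assumes "p dvd tr V" "p dvd dt V" shows "axis_test X V \<longleftrightarrow> p dvd tr (X * V)"
proof -
  have "[dt (bracket X V) = 4 * dt X * 0 + tr X * 0 * tr (X * V) - tr X * tr X * 0 - 0 * 0 * dt X - tr (X * V) * tr (X * V)] (mod p)"
    unfolding dt_bracket using assms by (intro cong_arith) (simp_all add: cong_0_iff)
  then have "p dvd dt (bracket X V) \<longleftrightarrow> p dvd - (tr (X * V) * tr (X * V))" using cong_dvd_iff by fastforce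
  then show ?thesis unfolding axis_test_def by auto
qed

text \<open>If \<open>X\<close> has distinct eigenvalues \<open>l\<close>, \<open>l'\<close>, the null matrices \<open>(X - l) A (X - l')\<close> detect its eigenlines.\<close>

lemma split_commutes:
  assumes X: "SL X" "p dvd l\<^sup>2 - tr X * l + 1" "\<not> p dvd 2 * l - tr X"
    and same: "\<And>V. \<not> central V \<Longrightarrow> axis_test X V \<Longrightarrow> axis_test X' V"
  shows "X * X' \<approx> X' * X"
proof -
  have key: "(X - l' *s 1) * X' * (X - l *s 1) \<approx> 0"
    if l: "p dvd l\<^sup>2 - tr X * l + 1" and l': "l' = tr X - l" for l l'
  proof (rule trace_nondegenerate)
    fix A
    define V where "V = (X - l *s 1) * A * (X - l' *s 1)"
    have ll: "[l * l' = 1] (mod p)"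
    proof -
      have "p dvd - (l\<^sup>2 - tr X * l + 1)" using l by (simp only: dvd_minus_iff)
      then show ?thesis unfolding l' by (simp add: cong_iff_dvd_diff power2_eq_square algebra_simps)
    qed
    have "X * X - tr X *s X + (l * l') *s 1 \<approx> (tr X *s X - 1 *s 1) - tr X *s X + 1 *s 1"
      unfolding cayley_hamilton using X(1) ll unfolding SL_def by (intro eqm_add eqm_diff eqm_sm eqm_refl)
    then have z: "X * X - tr X *s X + (l * l') *s 1 \<approx> 0" by simp
    have tl: "tr X *s X = l *s X + l' *s X" unfolding l' by (simp add: sm_distrib)
    have z1: "(X - l' *s 1) * (X - l *s 1) \<approx> 0" and z2: "(X - l *s 1) * (X - l' *s 1) \<approx> 0"
      using z unfolding tl by (simp_all add: algebra_simps sm_distrib)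
    have xv: "X * V \<approx> l' *s V"
    proof -
      have "X * V - l' *s V = ((X - l' *s 1) * (X - l *s 1)) * (A * (X - l' *s 1))"
        unfolding V_def by (simp add: algebra_simps sm_distrib)
      also have "\<dots> \<approx> 0 * (A * (X - l' *s 1))" by (rule eqm_mult[OF z1 eqm_refl])
      finally show ?thesis by (subst eqm_diff_iff) simp
    qed
    have vx: "V * X \<approx> l *s V"
    proof -
      have "V * X - l *s V = ((X - l *s 1) * A) * ((X - l' *s 1) * (X - l *s 1))"
        unfolding V_def by (simp add: algebra_simps sm_distrib)
      also have "\<dots> \<approx> ((X - l *s 1) * A) * 0" by (rule eqm_mult[OF eqm_refl z1])
      finally show ?thesis by (subst eqm_diff_iff) simp
    qed
    have "dt (X - l *s 1) = dt X - l * tr X + l * l" by (cases X) (simp add: one_mat_def algebra_simps)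
    also have "[\<dots> = 1 - l * tr X + l * l] (mod p)"
      using X(1) unfolding SL_def by (intro cong_add cong_diff cong_refl)
    finally have "[dt (X - l *s 1) = l\<^sup>2 - tr X * l + 1] (mod p)" by (simp add: power2_eq_square algebra_simps)
    then have "p dvd dt (X - l *s 1)" using l cong_dvd_iff by blast
    then have dV: "p dvd dt V" by (simp add: V_def)
    have "tr V = tr (((X - l' *s 1) * (X - l *s 1)) * A)"
      unfolding V_def using tr_mult_commute[of "X - l' *s 1" "(X - l *s 1) * A"] by (simp only: mult.assoc)
    moreover have "((X - l' *s 1) * (X - l *s 1)) * A \<approx> 0 * A" by (rule eqm_mult[OF z1 eqm_refl])
    ultimately have tV: "p dvd tr V" using p_dvd_eqm(1) by fastforce
    have "bracket X V \<approx> l' *s V - l *s V" unfolding bracket_def by (rule eqm_diff[OF xv vx])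
    then have "bracket X V \<approx> (l' - l) *s V" by (simp add: sm_distrib)
    from p_dvd_eqm(2)[OF this] dV have t: "axis_test X V" by (simp add: axis_test_def)
    have "p dvd tr (X' * V)"
    proof (cases "central V")
      case True
      then have "V \<approx> 0" using traceless_central[OF tV] by blast
      then have "X' * V \<approx> X' * 0" by (rule eqm_mult[OF eqm_refl])
      from p_dvd_eqm(1)[OF this] show ?thesis by simp
    next
      case False
      then show ?thesis using same[OF False t] null_test[OF tV dV] by blast
    qed
    moreover have "tr (X' * V) = tr (A * ((X - l' *s 1) * X' * (X - l *s 1)))"
      unfolding V_def using tr_mult_commute[of "X' * (X - l *s 1)" "A * (X - l' *s 1)"] by (simp only: mult.assoc)
    ultimately show "p dvd tr (A * ((X - l' *s 1) * X' * (X - l *s 1)))" by simp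
  qed
  let ?l' = "tr X - l"
  have twice: "(l * 2) *s A = l *s A + l *s A" for A by (metis mult_2_right sm_distrib(2))
  have "?l'\<^sup>2 - tr X * ?l' + 1 = l\<^sup>2 - tr X * l + 1" by (simp add: power2_eq_square algebra_simps)
  then have "p dvd ?l'\<^sup>2 - tr X * ?l' + 1" using X(2) by (simp only:)
  then have "(X - l *s 1) * X' * (X - ?l' *s 1) \<approx> 0" by (rule key) simp
  \<comment> \<open>Swapping the two eigenvalues and subtracting leaves the bracket of
    \<open>X\<close> and \<open>X'\<close> times their difference, a unit.\<close>
  from eqm_diff[OF this key[OF X(2) refl]]
  have "(X - l *s 1) * X' * (X - ?l' *s 1) - (X - ?l' *s 1) * X' * (X - l *s 1) \<approx> 0" by simp
  moreover have "(X - l *s 1) * X' * (X - ?l' *s 1) - (X - ?l' *s 1) * X' * (X - l *s 1) = (l - ?l') *s (X * X' - X' * X)"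
    by (simp add: algebra_simps sm_distrib twice)
  moreover have "l - ?l' = 2 * l - tr X" by simp
  ultimately have "(2 * l - tr X) *s (X * X' - X' * X) \<approx> 0" by simp
  then have "X * X' - X' * X \<approx> 0" using X(3) by (simp add: sm_eqm_0)
  then show ?thesis by (subst eqm_diff_iff)
qed

text \<open>The trace form on traceless matrices has no isotropic plane. Here W is an eigenvector of
  left multiplication by V, and V V = 0 forces the eigenvalue 0; by anticommutation both products
  vanish.\<close>

lemma null_orthogonal_commute:
  assumes "p dvd tr V" "p dvd tr W" "p dvd dt V" "p dvd dt W" "p dvd tr (V * W)"
  shows "V * W \<approx> W * V"
proof (cases "W \<approx> 0")
  case True
  have "V * W \<approx> V * 0" "W * V \<approx> 0 * V" by (intro eqm_mult eqm_refl True)+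
  then have "V * W \<approx> 0" "0 \<approx> W * V" using eqm_sym by simp_all
  then show ?thesis by (rule eqm_trans)
next
  case False
  obtain l where l: "V * W \<approx> l *s W" using null_eigen[OF assms(2,4) False assms(5)] .
  have "V * (V * W) \<approx> V * (l *s W)" by (rule eqm_mult[OF eqm_refl l])
  also have "V * (l *s W) = l *s (V * W)" by simp
  also have "\<dots> \<approx> l *s l *s W" by (rule eqm_sm[OF l cong_refl])
  finally have 1: "V * (V * W) \<approx> l *s l *s W" .
  have "V * V \<approx> 0 - 0"
    unfolding cayley_hamilton by (intro eqm_diff sm_cong_0 assms)
  then have "(V * V) * W \<approx> 0 * W" by (intro eqm_mult eqm_refl) simp
  then have "l *s l *s W \<approx> 0" using eqm_trans[OF eqm_sym[OF 1]] by (simp add: mult.assoc)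
  then have "p dvd l" using False by (simp add: sm_eqm_0)
  then have vw: "V * W \<approx> 0" using l sm_cong_0 eqm_trans by blast
  have "V * W \<approx> - (W * V)" by (rule anticommute[OF assms(1,2,5)])
  then have "- (W * V) \<approx> 0" using vw eqm_sym eqm_trans by blast
  from eqm_uminus[OF this] have "W * V \<approx> 0" by simp
  then show ?thesis using vw eqm_sym eqm_trans by blast
qed

text \<open>If the bracket is nonsingular, testing \<open>X\<close> and \<open>X'\<close> on each
  other makes them orthogonal involutions, and a further vector separates them. If it is singular,
  both have eigenvalues modulo p; \<open>split_commutes\<close> excludes distinct ones, and in the
  remaining case the traceless parts are orthogonal null vectors, hence proportional.\<close>

lemma axis_test_eq_commute:
  assumes D: "SL X" "SL X'" and c: "\<not> central X" "\<not> central X'"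
    and same: "\<And>V. \<not> central V \<Longrightarrow> axis_test X V \<longleftrightarrow> axis_test X' V"
  shows "X * X' \<approx> X' * X"
proof (rule ccontr)
  assume neg: "\<not> X * X' \<approx> X' * X"
  let ?U = "bracket X X'"
  have U: "\<not> ?U \<approx> 0" using neg bracket_eqm_0 by blast
  show False
  proof (cases "p dvd dt ?U")
    case False
    have "axis_test X X" "axis_test X' X'" by (simp_all add: axis_test_def bracket_def)
    then have "axis_test X X'" "axis_test X' X" using same c by blast+
    then have t: "p dvd tr X" "p dvd tr X'" "p dvd tr (X * X')"
      using False dt_bracket_sym[of X X'] by (auto simp: axis_test_def)
    have "X * ?U \<approx> - (?U * X)" using t by (intro anticommute) simp_all
    then have "bracket X ?U \<approx> - (?U * X) - ?U * X" unfolding bracket_def[of X ?U] by (rule eqm_diff[OF _ eqm_refl])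
    also have "- (?U * X) - ?U * X = (- 2) *s (?U * X)" by (cases "?U * X") simp
    finally have "p dvd dt (bracket X ?U) \<longleftrightarrow> p dvd dt ((- 2) *s (?U * X))" by (rule p_dvd_eqm(2))
    then have d: "\<not> p dvd dt (bracket X ?U)" using False SL_not_dvd[OF D(1)] by simp
    \<comment> \<open>The separating vector \<open>X + ?U\<close> is orthogonal to \<open>X'\<close>
      but not to \<open>X\<close>, as tr(X X) = -2 dt X, and its bracket with \<open>X\<close> is
      nonsingular.\<close>
    have e: "bracket X (X + ?U) = bracket X ?U" by (simp add: bracket_def algebra_simps)
    have "\<not> central (X + ?U)"
    proof
      assume "central (X + ?U)"
      then obtain k where "X + ?U \<approx> k *s 1" unfolding central_def by blast
      then have "bracket X (X + ?U) \<approx> bracket X (k *s 1)" by (rule eqm_bracket[OF eqm_refl])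
      from p_dvd_eqm(2)[OF this] d show False by (simp add: e) (simp add: bracket_def)
    qed
    moreover have "axis_test X' (X + ?U)" using t by (simp add: axis_test_def algebra_simps tr_mult_commute[of X' X])
    ultimately have "axis_test X (X + ?U)" using same by blast
    then have "p dvd tr (X * (X + ?U))" using d e by (simp add: axis_test_def)
    then have "p dvd tr (X * X)" by (simp add: algebra_simps)
    then have "p dvd tr X * tr X - dt X * 2" unfolding cayley_hamilton by simp
    then have "p dvd dt X * 2" using t(1) by (metis dvd_diff_right_iff dvd_mult)
    then show False using SL_not_dvd[OF D(1)] by simp
  next
    case True
    obtain l where l: "p dvd l\<^sup>2 - tr X * l + 1"
      using null_stabilizes[OF D(1) _ True U] by (metis dvd_0_right tr_bracket(1,2))
    obtain l' where l': "p dvd l'\<^sup>2 - tr X' * l' + 1"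
      using null_stabilizes[OF D(2) _ True U] by (metis dvd_0_right tr_bracket(1,3))
    have ne: "p dvd 2 * l - tr X" using split_commutes[OF D(1) l] same neg by blast
    have ne': "p dvd 2 * l' - tr X'" using split_commutes[OF D(2) l'] same neg eqm_sym by blast
    \<comment> \<open>The determinant of twice the traceless part is minus the discriminant of the
      characteristic polynomial, so a double root makes it vanish.\<close>
    have null: "p dvd dt (2 *s Z - tr Z *s 1)" if Z: "SL Z" and l: "p dvd l\<^sup>2 - tr Z * l + 1" "p dvd 2 * l - tr Z" for Z l
    proof -
      have dt: "dt (2 *s Z - tr Z *s 1) = 4 * dt Z - tr Z * tr Z"
        by (cases Z) (simp add: one_mat_def algebra_simps)
      have "4 * dt Z - tr Z * tr Z = 4 * (dt Z - 1) + 4 * (l\<^sup>2 - tr Z * l + 1) - (2 * l - tr Z) * (2 * l - tr Z)"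
        by (simp add: power2_eq_square algebra_simps)
      moreover have "p dvd dt Z - 1" using Z by (simp add: SL_def cong_iff_dvd_diff)
      ultimately show ?thesis unfolding dt using l by (metis dvd_add dvd_diff dvd_mult)
    qed
    let ?W = "2 *s X - tr X *s 1" and ?W' = "2 *s X' - tr X' *s 1"
    have W: "p dvd dt ?W" "p dvd dt ?W'" using null D l l' ne ne' by blast+
    have cW: "bracket ?W ?W' = 4 *s ?U" by (simp add: bracket_def algebra_simps sm_distrib)
    have tW: "tr ?W = 0" "tr ?W' = 0" by simp_all
    have "p dvd dt (bracket ?W ?W')" unfolding cW using True by simp
    moreover have "dt (bracket ?W ?W') = 4 * dt ?W * dt ?W' - tr (?W * ?W') * tr (?W * ?W')"
      unfolding dt_bracket tW by simp
    ultimately have "p dvd 4 * dt ?W * dt ?W' - tr (?W * ?W') * tr (?W * ?W')" by (simp only:)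
    then have "p dvd tr (?W * ?W') * tr (?W * ?W')" using W(2) by (metis dvd_diff_right_iff dvd_mult)
    then have "p dvd tr (?W * ?W')" unfolding p_dvd_mult by blast
    then have "?W * ?W' \<approx> ?W' * ?W" using W tW by (intro null_orthogonal_commute) simp_all
    then have "4 *s ?U \<approx> 0" using bracket_eqm_0 cW by metis
    then show False using U by (simp add: sm_eqm_0)
  qed
qed

lemma p_dvd_square_cong: "p dvd t * t - c \<Longrightarrow> p dvd t * t - d \<Longrightarrow> p dvd c - d"
proof -
  assume "p dvd t * t - c" "p dvd t * t - d"
  then have "p dvd (t * t - d) - (t * t - c)" by (rule dvd_diff[rotated])
  then show ?thesis by simp
qed

section \<open>Recovering the orders 2, 3 and 4 on an axis\<close>

lemma commuting_affine:
  assumes "\<not> central X" "\<not> central X'" "X * X' \<approx> X' * X"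
  obtains k l where "X' \<approx> k *s X + l *s 1" "\<not> p dvd k"
  using commute_imp_affine[OF assms(1,3)] affine_unit[OF _ assms(2)] by metis

text \<open>The partner \<open>Y\<close> separates the solvabilizers of commuting elements \<open>X\<close>, \<open>X'\<close>: the pair
  \<open>X'\<close>, \<open>Y\<close> can only generate a solvable group if it normalizes a Klein four-group.\<close>

lemma partner_small_order:
  assumes D: "SL X" "SL X'" "SL Y" and c: "\<not> central X" "\<not> central X'" and comm: "X * X' \<approx> X' * X"
    and t: "\<not> p dvd tr X'" "\<not> p dvd dt (bracket X Y)" "\<not> p dvd tr Y \<or> \<not> p dvd tr (X * Y)"
    and solv: "gen_solvable X' Y"
  shows "small_order (tr X')" "small_order (tr Y)" "small_order (tr (X' * Y)) \<or> central (X' * Y)"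
proof -
  obtain k l where kl: "X' \<approx> k *s X + l *s 1" "\<not> p dvd k" using commuting_affine[OF c comm] .
  have Y: "\<not> central Y"
  proof
    assume "central Y"
    then obtain m where "Y \<approx> m *s 1" unfolding central_def by blast
    then have "bracket X Y \<approx> bracket X (m *s 1)" by (rule eqm_bracket[OF eqm_refl])
    from p_dvd_eqm(2)[OF this] t(2) show False by (simp add: bracket_def)
  qed
  have "\<not> p dvd dt (bracket X' Y)" using p_dvd_eqm(2)[OF bracket_affine[OF kl(1), of Y]] t(2) kl(2) by simp
  moreover have "\<not> p dvd tr (X' * Y)" if "p dvd tr Y"
  proof -
    have "X' * Y \<approx> (k *s X + l *s 1) * Y" by (rule eqm_mult[OF kl(1) eqm_refl])
    from p_dvd_eqm(1)[OF this] have "p dvd tr (X' * Y) \<longleftrightarrow> p dvd k * tr (X * Y) + l * tr Y" by (simp add: algebra_simps)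
    also have "\<dots> \<longleftrightarrow> p dvd k * tr (X * Y)" using that by (intro dvd_add_left_iff dvd_mult)
    finally show ?thesis using kl(2) t(3) that by simp
  qed
  ultimately have "\<not> special X' Y" using t(1) unfolding special_def by blast
  then show "small_order (tr X')" "small_order (tr Y)" "small_order (tr (X' * Y)) \<or> central (X' * Y)"
    using solvable_cases[OF D(2,3) c(2) Y solv] by blast+
qed

text \<open>Three explicit null matrices span the traceless matrices, and a nonscalar
  \<open>X\<close> is not orthogonal to all of them.\<close>

lemma exists_null_vector:
  assumes "\<not> central X" obtains N where "tr N = 0" "dt N = 0" "\<not> p dvd tr (X * N)"
proof -
  obtain x y z w where X: "X = Mat x y z w" by (cases X)
  have "tr (X * Mat 0 1 0 0) = z" "tr (X * Mat 0 0 1 0) = y" "tr (X * Mat 1 1 (-1) (-1)) = (x - w) + (z - y)" by (simp_all add: X)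
  moreover have "\<not> p dvd z \<or> \<not> p dvd y \<or> (p dvd z - y \<and> \<not> p dvd x - w)" using assms by (auto simp: X central_iff)
  ultimately have "\<not> p dvd tr (X * Mat 0 1 0 0) \<or> \<not> p dvd tr (X * Mat 0 0 1 0) \<or> \<not> p dvd tr (X * Mat 1 1 (-1) (-1))"
    using dvd_add_left_iff by metis
  then show thesis using that[of "Mat 0 1 0 0"] that[of "Mat 0 0 1 0"] that[of "Mat 1 1 (-1) (-1)"] by auto
qed

context
  fixes X X' :: mat
  assumes D: "SL X" "SL X'" and c: "\<not> central X" "\<not> central X'" and comm: "X * X' \<approx> X' * X"
    and same: "SolM X = SolM X'"
begin

lemma same_gen_solvable: "SL Y \<Longrightarrow> gen_solvable X Y \<Longrightarrow> gen_solvable X' Y"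
  using in_SolM same by metis

text \<open>An involution passes the test on every line orthogonal to it. On the nonsingular
  orthogonal vector \<open>?V\<close>, its bracket with \<open>?V\<close> is
  \<open>2 *s (X * ?V)\<close>, also nonsingular, so an \<open>X'\<close> on the same axis with
  nonzero trace fails.\<close>

lemma same_involution: assumes "p dvd tr X" shows "p dvd tr X'"
proof (rule ccontr)
  assume neg: "\<not> p dvd tr X'"
  obtain k l where kl: "X' \<approx> k *s X + l *s 1" "\<not> p dvd k" using commuting_affine[OF c comm] .
  obtain N where N: "tr N = 0" "dt N = 0" "\<not> p dvd tr (X * N)" using exists_null_vector[OF c(1)] .
  let ?V = "bracket X N"
  have dV: "\<not> p dvd dt ?V" using null_test[of N X] N assms by (simp add: axis_test_def dt_bracket)
  have nV: "\<not> central ?V"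
  proof
    assume "central ?V"
    then have "?V \<approx> 0" using traceless_central[of ?V] by simp
    from p_dvd_eqm(2)[OF this] dV show False by simp
  qed
  have "axis_test X ?V" using assms by (simp add: axis_test_def)
  then have "axis_test X' ?V" using same_SolM_test[OF D c same nV] by blast
  then have "p dvd dt (bracket X' ?V)" using neg by (simp add: axis_test_def)
  then have "p dvd dt (bracket X ?V)" using p_dvd_eqm(2)[OF bracket_affine[OF kl(1), of ?V]] kl(2) by simp
  moreover have "bracket X ?V \<approx> 2 *s (X * ?V)"
  proof -
    have "?V * X \<approx> - (X * ?V)" using assms by (intro anticommute) (simp_all add: tr_mult_commute[of ?V X])
    then have "X * ?V - ?V * X \<approx> X * ?V - - (X * ?V)" by (rule eqm_diff[OF eqm_refl])
    also have "X * ?V - - (X * ?V) = 2 *s (X * ?V)" by (cases "X * ?V") simp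
    finally show ?thesis unfolding bracket_def[of X ?V] .
  qed
  ultimately have "p dvd dt (2 *s (X * ?V))" using p_dvd_eqm(2) by blast
  then show False using dV SL_not_dvd[OF D(1)] by simp
qed

text \<open>A tetrahedral partner of \<open>X\<close> must also be solvable with \<open>X'\<close>,
  and \<open>partner_small_order\<close> applies to it. The auxiliary \<open>Z\<close> is
  \<open>X\<close> or its negative, whichever has trace 1.\<close>

lemma same_order_three:
  assumes t: "p dvd tr X * tr X - 1" "\<not> p dvd tr X'" shows "small_order (tr X')"
proof -
  have *: thesis if Z: "SL Z" "\<not> central Z" "[tr Z = 1] (mod p)" "Z * X' \<approx> X' * Z" "cl p Z = cl p X"
    and th: "\<And>Y. \<lbrakk>SL Y; gen_solvable X' Y; \<not> p dvd dt (bracket Z Y); \<not> p dvd tr (Z * Y)\<rbrakk> \<Longrightarrow> thesis" for Z thesis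
  proof -
    obtain Y where Y: "SL Y" "[tr Y = 0] (mod p)" "[tr (Z * Y) = 1] (mod p)"
      using tetrahedral_partner[OF Z(1-3)] .
    have "gen_solvable Z Y" by (rule tetrahedral_solvable[OF Z(1) Y(1) Z(3) Y(2,3)])
    then have "gen_solvable X' Y" using same_gen_solvable[OF Y(1)] Z(5) by simp
    \<comment> \<open>The determinant of the bracket is 2 for tetrahedral traces.\<close>
    moreover have "[dt (bracket Z Y) = 4 * 1 * 1 + 1 * 0 * 1 - 1 * 1 * 1 - 0 * 0 * 1 - 1 * 1] (mod p)"
      unfolding dt_bracket using Z(1,3) Y unfolding SL_def by (intro cong_arith)
    then have "\<not> p dvd dt (bracket Z Y)" using cong_dvd_iff not_p_dvd_numerals(2) by fastforce
    moreover have "\<not> p dvd tr (Z * Y)" using cong_dvd_iff[OF Y(3)] by simp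
    ultimately show thesis using th Y(1) by blast
  qed
  have "tr X * tr X - 1 = (tr X - 1) * (tr X + 1)" by (simp add: algebra_simps)
  then have "[tr X = 1] (mod p) \<or> [tr (- X) = 1] (mod p)"
    using t(1) by (simp add: cong_iff_dvd_diff) (metis add.commute dvd_minus_iff minus_add_distrib uminus_add_conv_diff)
  then show ?thesis
  proof
    assume "[tr X = 1] (mod p)"
    then show ?thesis
      using *[OF D(1) c(1) _ comm refl] partner_small_order(1)[OF D(1,2) _ c comm t(2)] by metis
  next
    assume a: "[tr (- X) = 1] (mod p)"
    have comm': "(- X) * X' \<approx> X' * (- X)" using eqm_uminus[OF comm] by simp
    have "cl p (- X) = cl p X" by (simp add: cl_eq_iff)
    with a show ?thesis
      using *[of "- X"] partner_small_order(1)[of "- X" X'] D c comm' t(2) by (metis SL_simps(2) central_uminus)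
  qed
qed

text \<open>An octahedral partner forces \<open>X'\<close> to have order 3 or 4. In the case of
  order 3, \<open>X'\<close> being affine in \<open>X\<close> gives r tr(X'Y) = tr X', so the square
  of tr(X'Y) is 1/2.\<close>

lemma same_order_four:
  assumes t: "p dvd tr X * tr X - 2" "\<not> p dvd tr X'" shows "p dvd tr X' * tr X' - 2"
proof -
  define r where "r = tr X"
  have r: "[r * r = 2] (mod p)" using t(1) by (simp add: r_def cong_iff_dvd_diff)
  obtain Y where Y: "SL Y" "[tr Y = r] (mod p)" "[tr (X * Y) = 1] (mod p)"
    using octahedral_partner[OF D(1) c(1) r] unfolding r_def by auto
  have "gen_solvable X Y" using octahedral_solvable[OF D(1) Y(1) r _ Y(2,3)] by (simp add: r_def)
  then have solv: "gen_solvable X' Y" by (rule same_gen_solvable[OF Y(1)])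
  have "[dt (bracket X Y) = 4 * 1 * 1 + r * r * 1 - r * r * 1 - r * r * 1 - 1 * 1] (mod p)"
    unfolding dt_bracket r_def[symmetric] using D(1) Y unfolding SL_def by (intro cong_arith)
  also have "4 * 1 * 1 + r * r * 1 - r * r * 1 - r * r * 1 - 1 * 1 = 3 - r * r" by simp
  also have "[3 - r * r = 3 - 2] (mod p)" by (intro cong_diff cong_refl r)
  finally have d: "\<not> p dvd dt (bracket X Y)" using cong_dvd_iff by fastforce
  have tXY: "\<not> p dvd tr (X * Y)" using cong_dvd_iff[OF Y(3)] by simp
  note small = partner_small_order[OF D Y(1) c comm t(2) d disjI2[OF tXY] solv]
  show ?thesis
  proof (rule ccontr)
    assume "\<not> ?thesis"
    then have t1: "p dvd tr X' * tr X' - 1" using small(1) t(2) unfolding small_order_def by blast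
    obtain k l where kl: "X' \<approx> k *s X + l *s 1" "\<not> p dvd k" using commuting_affine[OF c comm] .
    have "[tr X' = k * r + l * 2] (mod p)" using eqm_tr[OF kl(1)] by (simp add: r_def)
    moreover have "[tr (X' * Y) = k * tr (X * Y) + l * tr Y] (mod p)"
      using eqm_tr[OF eqm_mult[OF kl(1) eqm_refl[of Y]]] by (simp add: algebra_simps)
    then have "[r * tr (X' * Y) = r * (k * 1 + l * r)] (mod p)"
      using Y(2,3) by (meson cong_add cong_mult cong_refl cong_trans)
    moreover have "[k * r + l * (r * r) = k * r + l * 2] (mod p)" by (intro cong_add cong_mult cong_refl r)
    moreover have "r * (k * 1 + l * r) = k * r + l * (r * r)" by (simp add: algebra_simps)
    ultimately have e: "[r * tr (X' * Y) = tr X'] (mod p)" using cong_sym cong_trans by metis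
    let ?c = "tr (X' * Y)"
    have "[(r * r) * (?c * ?c) = tr X' * tr X'] (mod p)" using cong_mult[OF e e] by (simp add: mult_ac)
    moreover have "[tr X' * tr X' = 1] (mod p)" using t1 by (simp add: cong_iff_dvd_diff)
    moreover have "[(r * r) * (?c * ?c) = 2 * (?c * ?c)] (mod p)" by (intro cong_mult cong_refl r)
    ultimately have "[2 * (?c * ?c) = 1] (mod p)" using cong_sym cong_trans by metis
    then have c2: "p dvd 2 * (?c * ?c) - 1" by (simp add: cong_iff_dvd_diff)
    \<comment> \<open>A square 1/2 equal to 0, 1, 2 or 4 would make p divide one of -1, 1, 3,
      7.\<close>
    have excl: False if "p dvd ?c * ?c - s" "s \<in> {0, 1, 2, 4}" for s
    proof -
      have "p dvd 2 * (?c * ?c - s) - (2 * (?c * ?c) - 1)" by (rule dvd_diff[OF dvd_mult[OF that(1)] c2])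
      then have "p dvd 1 - 2 * s" by (simp add: algebra_simps)
      moreover have "p dvd 1 - 2 * s \<longleftrightarrow> p dvd 2 * s - 1" by (rule dvd_diff_commute)
      ultimately show False using that(2) by auto
    qed
    show False using small(3)
    proof
      assume "small_order ?c"
      then show False using excl[of 0] excl[of 1] excl[of 2] unfolding small_order_def by auto
    next
      assume "central (X' * Y)"
      then have "X' * Y \<approx> 1 \<or> X' * Y \<approx> - 1" using SL_central SL_mult D(2) Y(1) by blast
      then have "[?c = 2] (mod p) \<or> [?c = - 2] (mod p)" using eqm_tr by fastforce
      then have "[?c * ?c = 4] (mod p)" using cong_mult[of ?c 2 p ?c 2] cong_mult[of ?c "- 2" p ?c "- 2"] by auto
      then show False using excl[of 4] by (simp add: cong_iff_dvd_diff)
    qed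
  qed
qed

end

end

lemma (in group) generate_inv_pair:
  assumes "x \<in> carrier G" "y \<in> carrier G" shows "generate G {inv x, y} = generate G {x, y}"
proof -
  have *: "generate G {inv x, y} \<subseteq> generate G {x, y}" if "x \<in> carrier G" for x
  proof (rule generate_subgroup_incl)
    show "{inv x, y} \<subseteq> generate G {x, y}" by (auto intro: generate.incl generate.inv)
    show "subgroup (generate G {x, y}) G" using that assms by (intro generate_is_subgroup) simp
  qed
  show ?thesis using *[OF assms(1)] *[of "inv x"] assms by simp
qed

context psl
begin

lemma SolM_cong: "X \<approx> Y \<or> X \<approx> - Y \<Longrightarrow> SolM X = SolM Y"
  using cl_eq_iff[of X Y] by (auto simp: SolM_def)

lemma SolM_adj: assumes "SL X" shows "SolM (adj X) = SolM X"
proof -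
  interpret G: group "PSL2 p" by (rule group_PSL2)
  show ?thesis
    using assms by (intro SolM_eqI) (simp add: G.generate_inv_pair cl_in cl_inv[symmetric])
qed

lemma SolM_generic_commute:
  assumes "generic X" "generic X'" "X * X' \<approx> X' * X" shows "SolM X = SolM X'"
proof (rule SolM_eqI)
  fix Y assume Y: "SL Y"
  have D: "SL X" "SL X'" "\<not> central X" "\<not> central X'" using assms by (simp_all add: generic_def)
  obtain k l where kl: "X' \<approx> k *s X + l *s 1" "\<not> p dvd k" using commuting_affine[OF D(3,4) assms(3)] .
  show "gen_solvable X Y \<longleftrightarrow> gen_solvable X' Y"
  proof (cases "central Y")
    case True
    then show ?thesis using gen_solvable_central D Y by blast
  next
    case False
    have "special X Y \<longleftrightarrow> special X' Y"
      using special_test[OF generic_tr[OF assms(1)], of Y] special_test[OF generic_tr[OF assms(2)], of Y]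
        axis_test_affine[OF kl, of Y] special_sym by blast
    then show ?thesis using generic_solvable_iff assms(1,2) Y False by blast
  qed
qed

lemma SolM_central: "SL X \<Longrightarrow> central X \<Longrightarrow> SolM X = carrier (PSL2 p)"
proof (rule equalityI)
  assume X: "SL X" "central X"
  show "SolM X \<subseteq> carrier (PSL2 p)" using SolM_subset carrier_PSL2 by simp
  have "cl p Y \<in> SolM X" if "SL Y" for Y
    using gen_solvable_central[OF that X] gen_solvable_sym[of X Y] in_SolM[OF that] by simp
  then show "carrier (PSL2 p) \<subseteq> SolM X" unfolding carrier_PSL2 by blast
qed

text \<open>\<open>X\<close> fails the test on a null line not orthogonal to it, so a generic
  element of that axis lies outside the solvabilizer.\<close>

lemma SolM_noncentral: assumes "SL X" "\<not> central X" shows "SolM X \<noteq> carrier (PSL2 p)"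
proof -
  obtain N where N: "tr N = 0" "dt N = 0" "\<not> p dvd tr (X * N)" using exists_null_vector[OF assms(2)] .
  have nt: "\<not> axis_test X N" using null_test[of N X] N by simp
  have nN: "\<not> central N"
  proof
    assume "central N"
    then have "N \<approx> 0" using traceless_central[of N] N by simp
    then have "X * N \<approx> X * 0" by (rule eqm_mult[OF eqm_refl])
    from p_dvd_eqm(1)[OF this] N(3) show False by simp
  qed
  obtain G where G: "generic G" "G * N \<approx> N * G" using exists_generic[OF nN] .
  then have "SL G" by (simp add: generic_def)
  then show ?thesis
    using generic_solvable_test[OF assms G(1) nN G(2)] nt in_SolM[of G X] cl_in by blast
qed

text \<open>Order 3 is matched by elimination: \<open>same_order_three\<close> leaves the orders 2,
  3 and 4 for the other element, and 2 and 4 are matched already.\<close>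

lemma same_SolM:
  assumes D: "SL X" "SL X'" and c: "\<not> central X" "\<not> central X'" and same: "SolM X = SolM X'"
  shows "X * X' \<approx> X' * X" and "p dvd tr X \<longleftrightarrow> p dvd tr X'"
    and "p dvd tr X * tr X - 1 \<longleftrightarrow> p dvd tr X' * tr X' - 1" and "p dvd tr X * tr X - 2 \<longleftrightarrow> p dvd tr X' * tr X' - 2"
proof -
  show comm: "X * X' \<approx> X' * X"
    by (rule axis_test_eq_commute[OF D c]) (rule same_SolM_test[OF D c same])
  have comm': "X' * X \<approx> X * X'" by (rule eqm_sym[OF comm])
  note s = D c comm same and s' = D(2,1) c(2,1) comm' same[symmetric]
  show 0: "p dvd tr X \<longleftrightarrow> p dvd tr X'" using same_involution[OF s] same_involution[OF s'] by blast
  have nz: "\<not> p dvd t" if "p dvd t * t - c" "\<not> p dvd c" for t c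
  proof
    assume "p dvd t"
    then have "p dvd t * t" by simp
    then have "p dvd c" using that(1) by (metis dvd_diff_right_iff)
    with that(2) show False by simp
  qed
  have four: "p dvd tr X \<or> (p dvd tr X * tr X - 2 \<longleftrightarrow> p dvd tr X' * tr X' - 2)"
    using same_order_four[OF s] same_order_four[OF s'] 0 by blast
  moreover have "\<not> p dvd tr X * tr X - 2" "\<not> p dvd tr X' * tr X' - 2" if "p dvd tr X"
    using that 0 nz not_p_dvd_numerals(2) by blast+
  ultimately show 4: "p dvd tr X * tr X - 2 \<longleftrightarrow> p dvd tr X' * tr X' - 2" by blast
  have excl: "\<not> p dvd t * t - 2" if "p dvd t * t - 1" for t
  proof
    assume "p dvd t * t - 2"
    then have "p dvd (t * t - 1) - (t * t - 2)" using that by (rule dvd_diff[rotated])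
    then show False by simp
  qed
  have one: "p dvd t * t - 1 \<Longrightarrow> \<not> p dvd t" for t using nz[of t 1] not_p_dvd_numerals(1) by blast
  show "p dvd tr X * tr X - 1 \<longleftrightarrow> p dvd tr X' * tr X' - 1"
  proof
    assume a: "p dvd tr X * tr X - 1"
    then have "small_order (tr X')" using same_order_three[OF s] one 0 by blast
    then show "p dvd tr X' * tr X' - 1" using one[OF a] excl[OF a] 0 4 unfolding small_order_def by blast
  next
    assume a: "p dvd tr X' * tr X' - 1"
    then have "small_order (tr X)" using same_order_three[OF s'] one 0 by blast
    then show "p dvd tr X * tr X - 1" using one[OF a] excl[OF a] 0 4 unfolding small_order_def by blast
  qed
qed

text \<open>Writing \<open>X'\<close> as k X + l, equality of traces and of determinants gives (k -
  1)(k + 1)(t^2 - 4) = 0. Then k = 1 forces l = 0, and k = -1 forces l = t, which is the inverse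
  matrix.\<close>

lemma same_trace_commuting:
  assumes D: "SL X" "SL X'" and c: "\<not> central X" and comm: "X * X' \<approx> X' * X"
    and t: "[tr X' = tr X] (mod p)" "\<not> p dvd tr X * tr X - 4"
  shows "X' \<approx> X \<or> X' \<approx> adj X"
proof -
  obtain k l where kl: "X' \<approx> k *s X + l *s 1" using commute_imp_affine[OF c comm] .
  define t where "t = tr X"
  have "[tr X' = k * t + l * 2] (mod p)" using eqm_tr[OF kl] by (simp add: t_def)
  then have "[k * t + l * 2 = t] (mod p)" using t(1) unfolding t_def using cong_sym cong_trans by blast
  then have 1: "p dvd k * t + l * 2 - t" by (simp add: cong_iff_dvd_diff)
  have "dt (k *s X + l *s 1) = k * k * dt X + k * l * t + l * l"
    by (cases X) (simp add: one_mat_def t_def algebra_simps)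
  then have "[dt X' = k * k * dt X + k * l * t + l * l] (mod p)" using eqm_dt[OF kl] by simp
  also have "[k * k * dt X + k * l * t + l * l = k * k * 1 + k * l * t + l * l] (mod p)"
    using D(1) unfolding SL_def by (intro cong_add cong_mult cong_refl)
  finally have "[1 = k * k * 1 + k * l * t + l * l] (mod p)" using D(2) unfolding SL_def using cong_sym cong_trans by blast
  then have 2: "p dvd 1 - (k * k * 1 + k * l * t + l * l)" by (simp only: cong_iff_dvd_diff)
  have "(k - 1) * (k + 1) * (t * t - 4) = 4 * (1 - (k * k * 1 + k * l * t + l * l)) + (k * t + l * 2 - t) * (k * t + l * 2 + t)"
    by (simp add: algebra_simps)
  then have "p dvd (k - 1) * (k + 1) * (t * t - 4)" using 1 2 by (metis dvd_add dvd_mult dvd_mult2)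
  then have "p dvd k - 1 \<or> p dvd k + 1" using t(2) by (simp add: t_def)
  then show ?thesis
  proof
    assume k: "p dvd k - 1"
    have "(k * t + l * 2 - t) - (k - 1) * t = l * 2" by (simp add: algebra_simps)
    then have "p dvd l * 2" using 1 k by (metis dvd_diff dvd_mult2)
    then have "l *s 1 \<approx> 0" by (intro sm_cong_0) simp
    moreover have "k *s X \<approx> 1 *s X" using k by (intro eqm_sm) (simp_all add: cong_iff_dvd_diff)
    ultimately have "k *s X + l *s 1 \<approx> 1 *s X" using eqm_add_0 by blast
    then show ?thesis using kl eqm_trans by auto
  next
    assume k: "p dvd k + 1"
    have "(k * t + l * 2 - t) - (k + 1) * t = 2 * (l - t)" by (simp add: algebra_simps)
    then have "p dvd 2 * (l - t)" using 1 k by (metis dvd_diff dvd_mult2)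
    then have "p dvd l - t" unfolding p_dvd_mult by simp
    then have "l *s 1 \<approx> t *s 1" by (intro eqm_sm) (simp_all add: cong_iff_dvd_diff)
    moreover have "k *s X \<approx> (- 1) *s X" using k by (intro eqm_sm) (simp_all add: cong_iff_dvd_diff)
    ultimately have "k *s X + l *s 1 \<approx> (- 1) *s X + t *s 1" by (intro eqm_add)
    also have "(- 1) *s X + t *s 1 = adj X" by (simp add: adj_eq t_def sm_distrib)
    finally show ?thesis using kl eqm_trans by blast
  qed
qed

section \<open>Matrices of given trace\<close>

lemma SL_red: "x \<in> carrier (SL2 p) \<Longrightarrow> SL (unred x) \<and> red p (unred x) = x"
  by (auto simp: carrier_SL2)

definition with_trace :: "int \<Rightarrow> mat2 set" where
  "with_trace t = {x \<in> carrier (SL2 p). [tr (unred x) = t] (mod p)}"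

lemma finite_with_trace: "finite (with_trace t)"
proof -
  have "carrier (SL2 p) \<subseteq> {0..<p} \<times> {0..<p} \<times> {0..<p} \<times> {0..<p}" by (auto simp: SL2_def)
  then have "finite (carrier (SL2 p))" by (rule finite_subset) simp
  then show ?thesis by (simp add: with_trace_def)
qed

lemma inverse_set_card: "card {c \<in> {0..<p}. p dvd b * c - e} = 1" if b: "\<not> p dvd b"
proof -
  obtain i where "[b * i = 1] (mod p)" using inverse_mod_p[OF b] .
  then have i: "p dvd b * i - 1" by (simp add: cong_iff_dvd_diff)
  have "{c \<in> {0..<p}. p dvd b * c - e} = {(i * e) mod p}"
  proof (intro equalityI subsetI)
    fix c assume c: "c \<in> {c \<in> {0..<p}. p dvd b * c - e}"
    then have "p dvd c - i * e" using divide_mod_p[OF i, of c e 1] by (simp add: mult.commute)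
    then have "c mod p = (i * e) mod p" by (simp only: mod_eq_dvd_iff)
    then show "c \<in> {(i * e) mod p}" using c by simp
  next
    fix c assume "c \<in> {(i * e) mod p}"
    then have c: "c = (i * e) mod p" by simp
    have "[b * c - e = b * (i * e) - e] (mod p)" unfolding c by (intro cong_diff cong_mult cong_refl) simp
    moreover have "b * (i * e) - e = e * (b * i - 1)" by (simp add: algebra_simps)
    then have "p dvd b * (i * e) - e" using i by (metis dvd_mult)
    ultimately have "p dvd b * c - e" using cong_dvd_iff by blast
    then show "c \<in> {c \<in> {0..<p}. p dvd b * c - e}" using p_gt by (simp add: c)
  qed
  then show ?thesis by simp
qed

lemma card_product_eq:
  "card {(b, c) \<in> {0..<p} \<times> {0..<p}. p dvd b * c - e} = nat (p - 1) + (if p dvd e then nat p else 0)"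
proof -
  define F where "F b = {c \<in> {0..<p}. p dvd b * c - e}" for b
  have fin: "finite (F b)" for b unfolding F_def by (rule finite_subset[of _ "{0..<p}"]) auto
  have 1: "card (F b) = 1" if "b \<in> {1..<p}" for b
  proof -
    have "\<not> p dvd b" using that by (intro not_p_dvd) simp_all
    then show ?thesis unfolding F_def by (rule inverse_set_card)
  qed
  have "F 0 = (if p dvd e then {0..<p} else {})" by (auto simp: F_def)
  then have 0: "card (F 0) = (if p dvd e then nat p else 0)" by simp
  have I: "{0..<p} = insert 0 {1..<p}" using p_gt by auto
  have "{(b, c) \<in> {0..<p} \<times> {0..<p}. p dvd b * c - e} = Sigma {0..<p} F" by (auto simp: F_def)
  then have "card {(b, c) \<in> {0..<p} \<times> {0..<p}. p dvd b * c - e} = (\<Sum>b\<in>{0..<p}. card (F b))"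
    using fin by (simp add: card_SigmaI)
  also have "\<dots> = card (F 0) + (\<Sum>b\<in>{1..<p}. card (F b))" unfolding I by simp
  also have "(\<Sum>b\<in>{1..<p}. card (F b)) = (\<Sum>b\<in>{1..<p}. 1)" using 1 by (intro sum.cong refl)
  finally show ?thesis using 0 by simp
qed

text \<open>The eigenvalues modulo p of a matrix of determinant 1 and trace
  \<open>t\<close>.\<close>

definition unit_roots :: "int \<Rightarrow> int set" where
  "unit_roots t = {a \<in> {0..<p}. p dvd a * a - t * a + 1}"

text \<open>The upper left entry \<open>a\<close> determines the lower right one and the product b c
  of the others. This product equation has p - 1 solutions, and p more exactly if the product is 0,
  that is, if \<open>a\<close> is an eigenvalue.\<close>

lemma card_with_trace:
  "card (with_trace t) = nat p * nat (p - 1) + nat p * card (unit_roots t)"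
proof -
  let ?P = "\<lambda>a. {(b, c) \<in> {0..<p} \<times> {0..<p}. p dvd b * c - (a * (t - a) - 1)}"
  let ?f = "\<lambda>(a, b, c). (a, b, c, (t - a) mod p)"
  have fin: "finite (?P a)" for a by (rule finite_subset[of _ "{0..<p} \<times> {0..<p}"]) auto
  have mem: "(a, b, c, d) \<in> with_trace t \<longleftrightarrow> (a, b, c) \<in> Sigma {0..<p} ?P \<and> d = (t - a) mod p" for a b c d
  proof -
    have p1: "1 < p" using p_gt by simp
    have "(a, b, c, d) \<in> with_trace t \<longleftrightarrow> a \<in> {0..<p} \<and> b \<in> {0..<p} \<and> c \<in> {0..<p} \<and> d \<in> {0..<p}
      \<and> [a * d - b * c = 1] (mod p) \<and> [a + d = t] (mod p)"
      using p1 by (auto simp: with_trace_def SL2_def unred_def cong_def)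
    also have "d \<in> {0..<p} \<and> [a * d - b * c = 1] (mod p) \<and> [a + d = t] (mod p) \<longleftrightarrow> d = (t - a) mod p \<and> p dvd b * c - (a * (t - a) - 1)"
    proof (intro iffI conjI; elim conjE)
      assume d: "d \<in> {0..<p}" "[a * d - b * c = 1] (mod p)" "[a + d = t] (mod p)"
      have "[a + d - a = t - a] (mod p)" by (intro cong_diff d(3) cong_refl)
      then show "d = (t - a) mod p" using d(1) by (simp add: cong_def)
      have "[a * d - b * c = a * (t - a) - b * c] (mod p)"
        using \<open>[a + d - a = t - a] (mod p)\<close> by (intro cong_diff cong_mult cong_refl) simp
      then have "[1 = a * (t - a) - b * c] (mod p)" using d(2) cong_sym cong_trans by blast
      then have "p dvd 1 - (a * (t - a) - b * c)" by (simp only: cong_iff_dvd_diff)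
      then show "p dvd b * c - (a * (t - a) - 1)" by (simp add: algebra_simps)
    next
      assume d: "d = (t - a) mod p" "p dvd b * c - (a * (t - a) - 1)"
      then show "d \<in> {0..<p}" using p1 by simp
      have da: "[d = t - a] (mod p)" by (simp add: d(1))
      have "[a + d = a + (t - a)] (mod p)" by (intro cong_add cong_refl da)
      then show "[a + d = t] (mod p)" by simp
      have "[a * d - b * c = a * (t - a) - b * c] (mod p)" by (intro cong_diff cong_mult cong_refl da)
      moreover have "[a * (t - a) - b * c = 1] (mod p)"
      proof -
        have "p dvd - (b * c - (a * (t - a) - 1))" using d(2) by (simp only: dvd_minus_iff)
        then show ?thesis by (simp add: cong_iff_dvd_diff algebra_simps)
      qed
      ultimately show "[a * d - b * c = 1] (mod p)" using cong_trans by blast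
    qed
    finally show ?thesis by auto
  qed
  have "with_trace t = ?f ` Sigma {0..<p} ?P"
  proof (intro equalityI subsetI)
    fix x assume x: "x \<in> with_trace t"
    obtain a b c d where abcd: "x = (a, b, c, d)" by (cases x)
    show "x \<in> ?f ` Sigma {0..<p} ?P" using x mem[of a b c d] unfolding abcd by (intro image_eqI[of _ _ "(a, b, c)"]) auto
  next
    fix x assume "x \<in> ?f ` Sigma {0..<p} ?P"
    then obtain a b c where "(a, b, c) \<in> Sigma {0..<p} ?P" "x = (a, b, c, (t - a) mod p)" by auto
    then show "x \<in> with_trace t" using mem[of a b c] by simp
  qed
  moreover have "inj_on ?f (Sigma {0..<p} ?P)" by (auto intro!: inj_onI)
  ultimately have "card (with_trace t) = card (Sigma {0..<p} ?P)" by (simp only: card_image)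
  also have "\<dots> = (\<Sum>a\<in>{0..<p}. card (?P a))" using fin by (intro card_SigmaI) auto
  also have "\<dots> = (\<Sum>a\<in>{0..<p}. nat (p - 1) + (if a \<in> unit_roots t then nat p else 0))"
  proof (intro sum.cong refl)
    fix a assume "a \<in> {0..<p}"
    moreover have "p dvd a * (t - a) - 1 \<longleftrightarrow> p dvd a * a - t * a + 1"
    proof -
      have "a * (t - a) - 1 = - (a * a - t * a + 1)" by (simp add: algebra_simps)
      then show ?thesis by (simp only: dvd_minus_iff)
    qed
    ultimately show "card (?P a) = nat (p - 1) + (if a \<in> unit_roots t then nat p else 0)"
      unfolding card_product_eq by (simp add: unit_roots_def)
  qed
  also have "\<dots> = nat p * nat (p - 1) + (\<Sum>a\<in>{0..<p}. if a \<in> unit_roots t then nat p else 0)"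
    by (simp add: sum.distrib)
  also have "(\<Sum>a\<in>{0..<p}. if a \<in> unit_roots t then nat p else 0) = (\<Sum>a\<in>unit_roots t. nat p)"
    by (intro sum.mono_neutral_cong_right) (auto simp: unit_roots_def)
  finally show ?thesis by simp
qed

lemma card_two_to_one:
  assumes "finite A" "\<And>x. x \<in> A \<Longrightarrow> card {y \<in> A. f y = f x} = 2"
  shows "card A = 2 * card (f ` A)"
proof -
  have "(\<Sum>x\<in>A. 1::nat) = (\<Sum>z\<in>f ` A. \<Sum>x\<in>{x \<in> A. f x = z}. 1)" by (rule sum.image_gen[OF assms(1)])
  also have "\<dots> = (\<Sum>z\<in>f ` A. 2)" using assms(2) by (intro sum.cong) auto
  finally show ?thesis by simp
qed

lemma unred_noncentral:
  assumes "x \<in> with_trace t" "\<not> p dvd t * t - 4" shows "\<not> central (unred x)"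
proof
  assume c: "central (unred x)"
  have x: "SL (unred x)" "[tr (unred x) = t] (mod p)" using assms(1) SL_red by (auto simp: with_trace_def)
  have "[tr (unred x) = 2] (mod p) \<or> [tr (unred x) = - 2] (mod p)"
    using SL_central[OF x(1) c] eqm_tr by fastforce
  then have "[tr (unred x) * tr (unred x) = 4] (mod p)"
    using cong_mult[of _ 2 p _ 2] cong_mult[of _ "- 2" p _ "- 2"] by auto
  then have "[t * t = 4] (mod p)" using cong_mult[OF x(2) x(2)] cong_sym cong_trans by blast
  then show False using assms(2) by (simp add: cong_iff_dvd_diff)
qed

text \<open>By \<open>same_SolM\<close> and \<open>same_trace_commuting\<close> a fibre consists of
  a matrix and its inverse. They differ, since otherwise twice the matrix would be scalar.\<close>

lemma card_SolM_with_trace: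
  assumes t4: "\<not> p dvd t * t - 4"
  shows "card (with_trace t) = 2 * card ((\<lambda>x. SolM (unred x)) ` with_trace t)"
proof (rule card_two_to_one[OF finite_with_trace])
  fix x assume x: "x \<in> with_trace t"
  let ?X = "unred x"
  let ?y = "red p (adj ?X)"
  have X: "SL ?X" "red p ?X = x" "[tr ?X = t] (mod p)" using x SL_red by (auto simp: with_trace_def)
  have nc: "\<not> central ?X" by (rule unred_noncentral[OF x t4])
  have tX: "\<not> p dvd tr ?X * tr ?X - 4"
    using cong_dvd_iff[OF cong_diff[OF cong_mult[OF X(3) X(3)] cong_refl[of 4]]] t4 by simp
  have y: "?y \<in> with_trace t"
  proof -
    have "[tr (unred ?y) = tr ?X] (mod p)" using eqm_tr[OF unred_red[of "adj ?X"]] by simp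
    then have "[tr (unred ?y) = t] (mod p)" using X(3) cong_trans by blast
    then show ?thesis using X(1) by (simp add: with_trace_def carrier_SL2)
  qed
  have "{z \<in> with_trace t. SolM (unred z) = SolM ?X} = {x, ?y}"
  proof (intro equalityI subsetI)
    fix z assume "z \<in> {z \<in> with_trace t. SolM (unred z) = SolM ?X}"
    then have z: "z \<in> with_trace t" "SolM (unred z) = SolM ?X" by auto
    have Z: "SL (unred z)" "red p (unred z) = z" "[tr (unred z) = t] (mod p)" using z SL_red by (auto simp: with_trace_def)
    have "[tr (unred z) = tr ?X] (mod p)" using Z(3) X(3) cong_sym cong_trans by blast
    then have "unred z \<approx> ?X \<or> unred z \<approx> adj ?X"
      using same_trace_commuting[OF X(1) Z(1) nc same_SolM(1)[OF X(1) Z(1) nc unred_noncentral[OF z(1) t4] z(2)[symmetric]]] tX by blast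
    then show "z \<in> {x, ?y}" using Z(2) X(2) red_eqI by fastforce
  next
    fix z assume "z \<in> {x, ?y}"
    moreover have "SolM (unred ?y) = SolM ?X" using SolM_cong[of "unred ?y" "adj ?X"] unred_red SolM_adj[OF X(1)] by simp
    ultimately show "z \<in> {z \<in> with_trace t. SolM (unred z) = SolM ?X}" using x y by auto
  qed
  moreover have "x \<noteq> ?y"
  proof
    assume "x = ?y"
    then have "?X \<approx> adj ?X" using X(2) by (simp add: eqm_def)
    then have "?X + ?X \<approx> adj ?X + ?X" by (rule eqm_add[OF _ eqm_refl])
    moreover have "?X + ?X = 2 *s ?X" by (cases ?X) simp
    ultimately have "2 *s ?X \<approx> tr ?X *s 1" by (simp add: adj_eq)
    moreover have "central (tr ?X *s 1)" unfolding central_def by blast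
    ultimately have "central (2 *s ?X)" using central_eqm by blast
    then show False using central_affine[of 2 ?X 0] nc by simp
  qed
  ultimately show "card {z \<in> with_trace t. SolM (unred z) = SolM ?X} = 2" by simp
qed

section \<open>Counting solvabilizers\<close>

text \<open>One normalized representative per point of the projective plane of matrices modulo
  scalars. The lower right entry is made 0, rather than the trace, so that no halves appear.\<close>

definition axis_reps :: "mat set" where
  "axis_reps = (\<lambda>(b, c). Mat 1 b c 0) ` ({0..<p} \<times> {0..<p}) \<union> (\<lambda>c. Mat 0 1 c 0) ` {0..<p} \<union> {Mat 0 0 1 0}"

lemma card_axis_reps: "card axis_reps = nat p * nat p + nat p + 1"
proof -
  have "card ((\<lambda>(b, c). Mat 1 b c 0) ` ({0..<p} \<times> {0..<p})) = nat p * nat p"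
    by (subst card_image) (auto simp: inj_on_def card_cartesian_product)
  moreover have "card ((\<lambda>c. Mat 0 1 c 0) ` {0..<p}) = nat p"
    by (subst card_image) (auto simp: inj_on_def)
  ultimately show ?thesis
    unfolding axis_reps_def by (subst card_Un_disjoint; (subst card_Un_disjoint)?) auto
qed

lemma axis_reps_noncentral: "V \<in> axis_reps \<Longrightarrow> \<not> central V"
  by (auto simp: axis_reps_def central_iff)

lemma axis_reps_cases:
  assumes "V \<in> axis_reps"
  obtains b c where "V = Mat 1 b c 0" "b \<in> {0..<p}" "c \<in> {0..<p}" | c where "V = Mat 0 1 c 0" "c \<in> {0..<p}" | "V = Mat 0 0 1 0"
  using assms unfolding axis_reps_def by auto

lemma range_eqI: "x \<in> {0..<p} \<Longrightarrow> y \<in> {0..<p} \<Longrightarrow> p dvd x - y \<Longrightarrow> x = y"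
  by (simp flip: mod_eq_dvd_iff)

lemma axis_reps_commute:
  assumes V: "V \<in> axis_reps" and W: "W \<in> axis_reps" and VW: "V * W \<approx> W * V" shows "V = W"
  using V
proof (cases rule: axis_reps_cases)
  case (1 b c)
  show ?thesis using W
  proof (cases rule: axis_reps_cases)
    case (1 b' c')
    have "p dvd b' - b" "p dvd c - c'"
      using VW by (simp_all add: 1 \<open>V = Mat 1 b c 0\<close> eqm_iff)
    then show ?thesis using 1 \<open>V = Mat 1 b c 0\<close> \<open>b \<in> _\<close> \<open>c \<in> _\<close> range_eqI by blast
  next
    case (2 c')
    then show ?thesis using VW 1 by (simp add: eqm_iff)
  next
    case 3
    then show ?thesis using VW 1 by (simp add: eqm_iff)
  qed
next
  case (2 c)
  show ?thesis using W
  proof (cases rule: axis_reps_cases)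
    case (1 b' c')
    then show ?thesis using VW 2 by (simp add: eqm_iff)
  next
    case (2 c')
    have "p dvd c' - c"
      using VW by (simp add: 2 \<open>V = Mat 0 1 c 0\<close> eqm_iff)
    then show ?thesis using 2 \<open>V = Mat 0 1 c 0\<close> \<open>c \<in> _\<close> range_eqI by blast
  next
    case 3
    then show ?thesis using VW 2 by (simp add: eqm_iff)
  qed
next
  case 3
  show ?thesis using W
  proof (cases rule: axis_reps_cases)
    case (1 b' c')
    then show ?thesis using VW 3 by (simp add: eqm_iff)
  next
    case (2 c')
    then show ?thesis using VW 3 by (simp add: eqm_iff)
  qed (simp add: 3)
qed

lemma axis_reps_cover:
  assumes "\<not> central X" obtains V where "V \<in> axis_reps" "X * V \<approx> V * X"
proof -
  obtain x y z w where X: "X = Mat x y z w" by (cases X)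
  have comm: "X * V \<approx> V * X" if "V \<approx> i *s X + l *s 1" for V i l
  proof -
    have "X * V \<approx> X * (i *s X + l *s 1)" by (rule eqm_mult[OF eqm_refl that])
    also have "X * (i *s X + l *s 1) = (i *s X + l *s 1) * X" by (simp add: algebra_simps)
    also have "\<dots> \<approx> V * X" by (rule eqm_mult[OF eqm_sym[OF that] eqm_refl])
    finally show ?thesis .
  qed
  have inv: "\<exists>i. p dvd u * i - 1" if "\<not> p dvd u" for u
    using inverse_mod_p[OF that] by (metis cong_iff_dvd_diff)
  have modd: "p dvd u mod p - u" for u by (simp flip: mod_eq_dvd_iff)
  note sw = dvd_diff_commute[THEN iffD1]
  have expand: "i *s X + (- i * w) *s 1 = Mat (i * (x - w)) (i * y) (i * z) 0" for i
    by (simp add: X one_mat_def algebra_simps)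
  consider "\<not> p dvd x - w" | "p dvd x - w" "\<not> p dvd y" | "p dvd x - w" "p dvd y" "\<not> p dvd z"
    using assms by (auto simp: X central_iff)
  then show thesis
  proof cases
    case 1
    obtain i where i: "p dvd (x - w) * i - 1" using inv[OF 1] by blast
    let ?V = "Mat 1 (i * y mod p) (i * z mod p) 0"
    have "?V \<approx> i *s X + (- i * w) *s 1"
      unfolding expand using sw[OF i] modd by (simp add: eqm_iff mult.commute)
    moreover have "?V \<in> axis_reps"
      using p_gt unfolding axis_reps_def by (intro UnI1 image_eqI[of _ _ "(i * y mod p, i * z mod p)"]) auto
    ultimately show thesis using comm that by blast
  next
    case 2
    obtain i where i: "p dvd y * i - 1" using inv[OF 2(2)] by blast
    let ?V = "Mat 0 1 (i * z mod p) 0"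
    have "p dvd - (i * (x - w))" using 2(1) by simp
    then have "?V \<approx> i *s X + (- i * w) *s 1"
      unfolding expand using sw[OF i] modd by (simp add: eqm_iff mult.commute)
    moreover have "?V \<in> axis_reps"
      using p_gt unfolding axis_reps_def by auto
    ultimately show thesis using comm that by blast
  next
    case 3
    obtain i where i: "p dvd z * i - 1" using inv[OF 3(3)] by blast
    let ?V = "Mat 0 0 1 0"
    have "?V \<approx> i *s X + (- i * w) *s 1"
      unfolding expand using sw[OF i] 3 by (simp add: eqm_iff mult.commute)
    moreover have "?V \<in> axis_reps" unfolding axis_reps_def by auto
    ultimately show thesis using comm that by blast
  qed
qed

text \<open>One generic element is chosen on each axis: equal solvabilizers give equal axes, and
  generic elements of one axis share their solvabilizer.\<close>

lemma card_SolM_generic: "card (SolM ` Collect generic) = nat p * nat p + nat p + 1"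
proof -
  define g where "g V = (SOME G. generic G \<and> G * V \<approx> V * G)" for V
  have g: "generic (g V) \<and> g V * V \<approx> V * g V" if "\<not> central V" for V
    unfolding g_def using exists_generic[OF that] by (intro someI_ex[of "\<lambda>G. generic G \<and> G * V \<approx> V * G"]) blast
  have gnc: "SL (g V)" "\<not> central (g V)" if "\<not> central V" for V using g[OF that] by (auto simp: generic_def)
  have "inj_on (\<lambda>V. SolM (g V)) axis_reps"
  proof (rule inj_onI)
    fix V W assume V: "V \<in> axis_reps" and W: "W \<in> axis_reps" and eq: "SolM (g V) = SolM (g W)"
    have nV: "\<not> central V" and nW: "\<not> central W" using V W axis_reps_noncentral by blast+
    have "g V * g W \<approx> g W * g V" using same_SolM(1)[OF gnc(1)[OF nV] gnc(1)[OF nW] gnc(2)[OF nV] gnc(2)[OF nW] eq] .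
    then have "g W * V \<approx> V * g W"
      using centralizer_abelian[OF gnc(2)[OF nV], of "g W" V] g[OF nV] by blast
    then have "V * W \<approx> W * V"
      using centralizer_abelian[OF gnc(2)[OF nW], of V W] g[OF nW] by blast
    then show "V = W" by (rule axis_reps_commute[OF V W])
  qed
  moreover have "SolM ` Collect generic = (\<lambda>V. SolM (g V)) ` axis_reps"
  proof (intro equalityI subsetI)
    fix s assume "s \<in> SolM ` Collect generic"
    then obtain X where X: "generic X" "s = SolM X" by blast
    then have nX: "\<not> central X" by (simp add: generic_def)
    obtain V where V: "V \<in> axis_reps" "X * V \<approx> V * X" using axis_reps_cover[OF nX] .
    have nV: "\<not> central V" using V(1) by (rule axis_reps_noncentral)
    have "X * g V \<approx> g V * X"
      using centralizer_abelian[OF nV eqm_sym[OF V(2)]] g[OF nV] eqm_sym by blast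
    then have "SolM X = SolM (g V)" using SolM_generic_commute X(1) g[OF nV] by blast
    then show "s \<in> (\<lambda>V. SolM (g V)) ` axis_reps" using V(1) X(2) by blast
  next
    fix s assume "s \<in> (\<lambda>V. SolM (g V)) ` axis_reps"
    then show "s \<in> SolM ` Collect generic" using g axis_reps_noncentral by blast
  qed
  ultimately show ?thesis using card_axis_reps by (simp add: card_image)
qed

lemma Solv_PSL2: "Solv (PSL2 p) = SolM ` Collect SL"
  by (simp add: Solv_def carrier_PSL2 SolM_def image_image)

text \<open>\<open>T\<close> represents the small traces up to sign, with distinct squares so that
  the families for different traces are disjoint. The term p^2 + p + 2 counts the axes and the whole
  group, which is the solvabilizer of the identity. Doubling both sides avoids halving the number of
  matrices.\<close>

lemma card_Solv:
  assumes T: "finite T" "\<And>t. t \<in> T \<Longrightarrow> \<exists>c \<in> {0, 1, 2}. p dvd t * t - c"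
    "\<And>t t'. \<lbrakk>t \<in> T; t' \<in> T; p dvd t * t - t' * t'\<rbrakk> \<Longrightarrow> t = t'"
    "\<And>s. small_order s \<Longrightarrow> \<exists>t \<in> T. [s = t] (mod p) \<or> [- s = t] (mod p)"
  shows "2 * card (Solv (PSL2 p)) = 2 * (nat p * nat p + nat p + 2)
    + (\<Sum>t\<in>T. nat p * nat (p - 1) + nat p * card (unit_roots t))"
proof -
  let ?B = "\<lambda>t. (\<lambda>x. SolM (unred x)) ` with_trace t"
  let ?A = "SolM ` Collect generic"
  have t4: "\<not> p dvd t * t - 4" if "t \<in> T" for t
  proof
    assume 4: "p dvd t * t - 4"
    obtain c where c: "c \<in> {0, 1, 2}" "p dvd t * t - c" using T(2)[OF \<open>t \<in> T\<close>] by blast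
    have "p dvd 4 - c" using p_dvd_square_cong[OF 4 c(2)] .
    then show False using c(1) by auto
  qed
  have B: "SL (unred x)" "\<not> central (unred x)" "[tr (unred x) = t] (mod p)" if "t \<in> T" "x \<in> with_trace t" for t x
    using that SL_red unred_noncentral[OF that(2) t4[OF that(1)]] by (auto simp: with_trace_def)
  have Bc: "p dvd tr (unred x) * tr (unred x) - c \<longleftrightarrow> p dvd t * t - c" if "t \<in> T" "x \<in> with_trace t" for t x c
    by (intro cong_dvd_iff cong_diff cong_mult cong_refl B(3)[OF that])
  have sq_same: "p dvd tr X * tr X - c \<longleftrightarrow> p dvd tr Y * tr Y - c"
    if "SL X" "SL Y" "\<not> central X" "\<not> central Y" "SolM X = SolM Y" "c \<in> {0, 1, 2}" for X Y c
    using same_SolM(2-4)[OF that(1-5)] that(6) by auto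
  have small: "\<exists>c \<in> {0, 1, 2}. p dvd tr X * tr X - c \<Longrightarrow> small_order (tr X)" for X
    unfolding small_order_def by auto
  have AB: "?A \<inter> ?B t = {}" if t: "t \<in> T" for t
  proof (rule ccontr)
    assume "?A \<inter> ?B t \<noteq> {}"
    then obtain X x where X: "generic X" "x \<in> with_trace t" "SolM X = SolM (unred x)" by blast
    obtain c where c: "c \<in> {0, 1, 2}" "p dvd t * t - c" using T(2)[OF t] by blast
    have "p dvd tr X * tr X - c"
      using sq_same[of X "unred x" c] X B[OF t X(2)] Bc[OF t X(2), of c] c by (auto simp: generic_def)
    then have "small_order (tr X)" using c(1) small by blast
    then show False using X(1) by (simp add: generic_def)
  qed
  have BB: "?B t \<inter> ?B t' = {}" if t: "t \<in> T" "t' \<in> T" "t \<noteq> t'" for t t'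
  proof (rule ccontr)
    assume "?B t \<inter> ?B t' \<noteq> {}"
    then obtain x y where xy: "x \<in> with_trace t" "y \<in> with_trace t'" "SolM (unred x) = SolM (unred y)" by blast
    obtain c where c: "c \<in> {0, 1, 2}" "p dvd t * t - c" using T(2)[OF t(1)] by blast
    have "p dvd t' * t' - c"
      using sq_same[of "unred x" "unred y" c] xy B[OF t(1) xy(1)] B[OF t(2) xy(2)] Bc[OF t(1) xy(1), of c] Bc[OF t(2) xy(2), of c] c
      by auto
    then have "p dvd (t * t - c) - (t' * t' - c)" by (rule dvd_diff[OF c(2)])
    then have "p dvd t * t - t' * t'" by simp
    then show False using T(3) t by blast
  qed
  have C: "carrier (PSL2 p) \<notin> ?A \<union> (\<Union>t\<in>T. ?B t)"
  proof
    assume "carrier (PSL2 p) \<in> ?A \<union> (\<Union>t\<in>T. ?B t)"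
    then show False
    proof (elim UnE UN_E imageE)
      fix X assume "carrier (PSL2 p) = SolM X" "X \<in> Collect generic"
      then show False using SolM_noncentral[of X] by (simp add: generic_def)
    next
      fix t x assume "carrier (PSL2 p) = SolM (unred x)" "t \<in> T" "x \<in> with_trace t"
      then show False using SolM_noncentral[OF B(1,2)[of t x]] by simp
    qed
  qed
  have "Solv (PSL2 p) = insert (carrier (PSL2 p)) (?A \<union> (\<Union>t\<in>T. ?B t))"
  proof (intro equalityI subsetI)
    fix s assume "s \<in> Solv (PSL2 p)"
    then obtain X where X: "SL X" "s = SolM X" unfolding Solv_PSL2 by blast
    consider "central X" | "generic X" | "\<not> central X" "small_order (tr X)" using X(1) by (auto simp: generic_def)
    then show "s \<in> insert (carrier (PSL2 p)) (?A \<union> (\<Union>t\<in>T. ?B t))"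
    proof cases
      case 1 then show ?thesis using SolM_central X by blast
    next
      case 2 then show ?thesis using X(2) by blast
    next
      case 3
      then obtain t where t: "t \<in> T" "[tr X = t] (mod p) \<or> [tr (- X) = t] (mod p)" using T(4) by fastforce
      have *: "SolM Z \<in> ?B t" if "SL Z" "[tr Z = t] (mod p)" for Z
      proof (rule image_eqI)
        show "SolM Z = SolM (unred (red p Z))" using SolM_cong[of "unred (red p Z)" Z] unred_red by simp
        show "red p Z \<in> with_trace t"
          using that eqm_tr[OF unred_red[of Z]] cong_trans by (auto simp: with_trace_def carrier_SL2)
      qed
      have "SolM (- X) = SolM X" by (rule SolM_cong) simp
      then have "SolM X \<in> ?B t" using t(2) *[of X] *[of "- X"] X(1) by auto
      then show ?thesis using t(1) X(2) by blast
    qed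
  next
    fix s assume "s \<in> insert (carrier (PSL2 p)) (?A \<union> (\<Union>t\<in>T. ?B t))"
    then show "s \<in> Solv (PSL2 p)"
    proof (elim insertE UnE UN_E)
      assume s: "s = carrier (PSL2 p)"
      have "central 1" unfolding central_def by (intro exI[of _ 1]) simp
      then show ?thesis using SolM_central[of 1] unfolding Solv_PSL2 s by (metis SL_simps(3) imageI mem_Collect_eq)
    qed (auto simp: Solv_PSL2 generic_def with_trace_def SL_red)
  qed
  moreover have finA: "finite ?A" by (rule card_ge_0_finite) (simp add: card_SolM_generic)
  ultimately have "card (Solv (PSL2 p)) = Suc (card (?A \<union> (\<Union>t\<in>T. ?B t)))"
    using C T(1) finite_with_trace by simp
  also have "card (?A \<union> (\<Union>t\<in>T. ?B t)) = card ?A + card (\<Union>t\<in>T. ?B t)"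
    using AB by (intro card_Un_disjoint finA finite_UN_I T(1) finite_imageI finite_with_trace) blast
  also have "card (\<Union>t\<in>T. ?B t) = (\<Sum>t\<in>T. card (?B t))"
    using BB T(1) finite_with_trace by (intro card_UN_disjoint) auto
  finally have "2 * card (Solv (PSL2 p)) = 2 * Suc (card ?A) + (\<Sum>t\<in>T. 2 * card (?B t))"
    by (simp add: sum_distrib_left)
  also have "(\<Sum>t\<in>T. 2 * card (?B t)) = (\<Sum>t\<in>T. nat p * nat (p - 1) + nat p * card (unit_roots t))"
    using card_SolM_with_trace[OF t4] card_with_trace by (intro sum.cong refl) simp
  finally show ?thesis by (simp add: card_SolM_generic)
qed

section \<open>Eigenvalues and square roots of 2 by residue class of p\<close>

text \<open>The roots are \<open>a\<close> and \<open>t - a\<close>; they differ because the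
  discriminant t^2 - 4 is nonzero.\<close>

lemma card_unit_roots:
  assumes "\<not> p dvd t * t - 4"
  shows "card (unit_roots t) = (if \<exists>a. p dvd a * a - t * a + 1 then 2 else 0)"
proof (cases "\<exists>a. p dvd a * a - t * a + 1")
  case True
  then obtain a where a: "p dvd a * a - t * a + 1" by blast
  have "unit_roots t = {a mod p, (t - a) mod p}"
  proof (intro equalityI subsetI)
    fix x assume x: "x \<in> unit_roots t"
    then have "p dvd (x * x - t * x + 1) - (a * a - t * a + 1)" using a by (intro dvd_diff) (simp_all add: unit_roots_def)
    moreover have "(x * x - t * x + 1) - (a * a - t * a + 1) = (x - a) * (x - (t - a))" by (simp add: algebra_simps)
    ultimately have "x mod p = a mod p \<or> x mod p = (t - a) mod p" by (simp only: p_dvd_mult mod_eq_dvd_iff)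
    then show "x \<in> {a mod p, (t - a) mod p}" using x by (auto simp: unit_roots_def)
  next
    fix x assume "x \<in> {a mod p, (t - a) mod p}"
    then have x: "[x = a] (mod p) \<or> [x = t - a] (mod p)" "x \<in> {0..<p}" using p_gt by auto
    have "[x * x - t * x + 1 = b * b - t * b + 1] (mod p)" if "[x = b] (mod p)" for b
      by (intro cong_arith that)
    moreover have "(t - a) * (t - a) - t * (t - a) + 1 = a * a - t * a + 1" by (simp add: algebra_simps)
    ultimately have "[x * x - t * x + 1 = a * a - t * a + 1] (mod p)" using x(1) by metis
    then show "x \<in> unit_roots t" using a x(2) cong_dvd_iff by (simp add: unit_roots_def)
  qed
  moreover have "a mod p \<noteq> (t - a) mod p"
  proof
    assume "a mod p = (t - a) mod p"
    then have "p dvd a - (t - a)" by (simp only: mod_eq_dvd_iff)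
    then have "p dvd (a - (t - a)) * (a - (t - a)) - 4 * (a * a - t * a + 1)" by (rule dvd_diff[OF dvd_mult dvd_mult[OF a]])
    moreover have "(a - (t - a)) * (a - (t - a)) - 4 * (a * a - t * a + 1) = t * t - 4" by (simp add: algebra_simps)
    ultimately show False using assms by (simp only:)
  qed
  ultimately show ?thesis using True by simp
next
  case False
  then have "unit_roots t = {}" by (auto simp: unit_roots_def)
  then show ?thesis using False by simp
qed

text \<open>The number of units of order \<open>n\<close> is the totient of \<open>n\<close>, which
  is positive.\<close>

lemma exists_order:
  assumes "n dvd nat p - 1" "n > 0" obtains a :: int where "\<And>k. [a ^ k = 1] (mod p) \<longleftrightarrow> n dvd k"
proof -
  have P: "prime (nat p)" "1 < nat p" using prime_p p_gt by (simp_all add: prime_int_nat_transfer[symmetric])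
  have "card {x \<in> totatives (nat p). ord (nat p) x = n} = totient n"
    using prime_card_elements_with_ord_eq_totient[OF P(2,1), of n] assms(1) by simp
  also have "totient n > 0" using assms(2) by simp
  finally obtain x where x: "ord (nat p) x = n" by (metis (mono_tags, lifting) card.empty empty_iff less_irrefl mem_Collect_eq subsetI subset_empty)
  have "[int x ^ k = 1] (mod p) \<longleftrightarrow> n dvd k" for k
  proof -
    have "[int x ^ k = 1] (mod p) \<longleftrightarrow> [int (x ^ k) = int 1] (mod int (nat p))" using p_gt by simp
    also have "\<dots> \<longleftrightarrow> n dvd k" unfolding cong_int_iff ord_divides x ..
    finally show ?thesis .
  qed
  then show thesis by (rule that)
qed

lemma order_of_unit:
  assumes "\<not> p dvd a" obtains n where "n dvd nat p - 1" "\<And>k. [a ^ k = 1] (mod p) \<longleftrightarrow> n dvd k"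
proof -
  have P: "prime (nat p)" using prime_p by (simp add: prime_int_nat_transfer[symmetric])
  define x where "x = nat (a mod p)"
  have x: "int x = a mod p" using p_gt by (simp add: x_def)
  have k: "[a ^ k = 1] (mod p) \<longleftrightarrow> ord (nat p) x dvd k" for k
  proof -
    have "[a ^ k = int x ^ k] (mod p)" by (intro cong_pow) (simp add: x)
    then have "[a ^ k = 1] (mod p) \<longleftrightarrow> [int x ^ k = 1] (mod p)" using cong_sym cong_trans by blast
    also have "\<dots> \<longleftrightarrow> [int (x ^ k) = int 1] (mod int (nat p))" using p_gt by simp
    also have "\<dots> \<longleftrightarrow> ord (nat p) x dvd k" unfolding cong_int_iff ord_divides ..
    finally show ?thesis .
  qed
  have "\<not> nat p dvd x"
  proof
    assume "nat p dvd x"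
    then have "int (nat p) dvd int x" by (simp only: int_dvd_int_iff)
    then have "p dvd a mod p" using p_gt x by simp
    then show False using assms by (simp add: dvd_mod_iff)
  qed
  then have "coprime (nat p) x" using P by (simp add: prime_imp_coprime)
  then have "ord (nat p) x dvd nat p - 1" using order_divides_totient[of "nat p" x] P by (simp add: totient_prime)
  then show thesis using k by (rule that)
qed

lemma dvd_p_minus_1: "n > 0 \<Longrightarrow> n dvd nat p - 1 \<longleftrightarrow> p mod int n = 1 mod int n"
proof -
  have "n dvd nat p - 1 \<longleftrightarrow> int n dvd int (nat p - 1)" by simp
  also have "int (nat p - 1) = p - 1" using p_gt by simp
  also have "int n dvd p - 1 \<longleftrightarrow> p mod int n = 1 mod int n" by (simp add: mod_eq_dvd_iff)
  finally show ?thesis .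
qed

lemma minus_one_not_one: "\<not> [- 1 = 1] (mod p)"
proof
  assume "[- 1 = 1] (mod p)"
  then have "p dvd - 1 - 1" by (simp only: cong_iff_dvd_diff)
  then show False by simp
qed

lemma square_root_cases: "[a * a = 1] (mod p) \<Longrightarrow> \<not> [a = 1] (mod p) \<Longrightarrow> p dvd a + 1"
proof -
  assume a: "[a * a = 1] (mod p)" "\<not> [a = 1] (mod p)"
  have "a * a - 1 = (a - 1) * (a + 1)" by (simp add: algebra_simps)
  then have "p dvd (a - 1) * (a + 1)" using a(1) by (simp add: cong_iff_dvd_diff)
  then show ?thesis using a(2) unfolding p_dvd_mult by (simp add: cong_iff_dvd_diff)
qed

text \<open>The divisor condition holds when \<open>n\<close> is a power of 2. Then a^n = -1 forces
  order exactly 2 n, and conversely the n-th power of an element of that order is a square root of 1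
  other than 1.\<close>

lemma power_minus_one_root_iff:
  assumes "n > 0"
    and n: "\<And>m. \<lbrakk>m dvd 2 * n; \<not> m dvd n\<rbrakk> \<Longrightarrow> m = 2 * n"
  shows "(\<exists>a. p dvd a ^ n + 1) \<longleftrightarrow> p mod int (2 * n) = 1"
proof -
  have one: "(1::int) mod int (2 * n) = 1" using assms(1) by simp
  show ?thesis
  proof
    assume "\<exists>a. p dvd a ^ n + 1"
    then obtain a where a: "[a ^ n = - 1] (mod p)" by (auto simp: cong_iff_dvd_diff)
    have "\<not> p dvd a"
    proof
      assume "p dvd a"
      then have "p dvd a ^ n" using assms(1) by (simp add: dvd_power_le[of p a 1 n, simplified])
      then show False using cong_dvd_iff[OF a] by simp
    qed
    then obtain m where m: "m dvd nat p - 1" "\<And>k. [a ^ k = 1] (mod p) \<longleftrightarrow> m dvd k" using order_of_unit by blast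
    have "[a ^ (2 * n) = 1] (mod p)" using cong_mult[OF a a] by (simp add: mult_2 power_add)
    moreover have "\<not> [a ^ n = 1] (mod p)" using a minus_one_not_one cong_sym cong_trans by blast
    ultimately have "m = 2 * n" using m(2) n by blast
    then show "p mod int (2 * n) = 1" using m(1) dvd_p_minus_1[of "2 * n"] assms(1) one by simp
  next
    assume "p mod int (2 * n) = 1"
    then have "2 * n dvd nat p - 1" using dvd_p_minus_1[of "2 * n"] assms(1) one by simp
    then obtain a where a: "\<And>k. [a ^ k = 1] (mod p) \<longleftrightarrow> 2 * n dvd k" using exists_order[of "2 * n"] assms(1) by auto
    have "[a ^ n * a ^ n = 1] (mod p)" using a[of "2 * n"] by (simp add: mult_2 power_add)
    moreover have "\<not> [a ^ n = 1] (mod p)" using a[of n] assms(1) by (auto dest: dvd_imp_le)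
    ultimately show "\<exists>a. p dvd a ^ n + 1" using square_root_cases by blast
  qed
qed

lemma root_trace_0: "(\<exists>a. p dvd a * a - 0 * a + 1) \<longleftrightarrow> p mod 4 = 1"
proof -
  have "m = 4" if "m dvd 4" "\<not> m dvd 2" for m :: nat
  proof -
    have "m \<le> 4" using that(1) by (rule dvd_imp_le) simp
    then have "m \<in> {0, 1, 2, 3, 4}" by auto
    then show ?thesis using that by auto
  qed
  then show ?thesis using power_minus_one_root_iff[of 2] by (simp add: power2_eq_square)
qed

text \<open>Modulo p, a^4 + 1 factors as (a^2 - r a + 1)(a^2 + r a + 1), and the factors are
  exchanged by a -> -a.\<close>

lemma root_trace_sqrt2:
  assumes "[r * r = 2] (mod p)" shows "(\<exists>a. p dvd a * a - r * a + 1) \<longleftrightarrow> p mod 8 = 1"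
proof -
  have "m = 8" if "m dvd 8" "\<not> m dvd 4" for m :: nat
  proof -
    have "m \<le> 8" using that(1) by (rule dvd_imp_le) simp
    then have "m \<in> {0, 1, 2, 3, 4, 5, 6, 7, 8}" by auto
    then show ?thesis using that by auto
  qed
  then have 8: "(\<exists>a. p dvd a ^ 4 + 1) \<longleftrightarrow> p mod 8 = 1" using power_minus_one_root_iff[of 4] by simp
  have f: "p dvd (a * a - r * a + 1) * ((- a) * (- a) - r * (- a) + 1) \<longleftrightarrow> p dvd a ^ 4 + 1" for a
  proof -
    have "(a * a - r * a + 1) * ((- a) * (- a) - r * (- a) + 1) = a ^ 4 + 1 + (2 - r * r) * (a * a)"
      by (simp add: power4_eq_xxxx algebra_simps)
    moreover have "p dvd 2 - r * r" using assms cong_sym cong_iff_dvd_diff by blast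
    ultimately show ?thesis by (simp add: dvd_add_left_iff)
  qed
  show ?thesis unfolding 8[symmetric] using f by (metis p_dvd_mult)
qed

text \<open>The polynomial is the sixth cyclotomic polynomial, so its roots are the elements of
  order 6; for odd p, being 1 mod 6 and 1 mod 3 agree.\<close>

lemma root_trace_1: "(\<exists>a. p dvd a * a - 1 * a + 1) \<longleftrightarrow> p mod 3 = 1"
proof -
  have cube: "a * (a * a) + 1 = (a + 1) * (a * a - 1 * a + 1)" for a :: int by (simp add: algebra_simps)
  have m6: "p mod 6 = 1 \<longleftrightarrow> p mod 3 = 1" using odd_p by presburger
  show ?thesis
  proof
    assume "\<exists>a. p dvd a * a - 1 * a + 1"
    then obtain a where a: "p dvd a * a - 1 * a + 1" by blast
    have "p dvd a * (a * a) + 1" unfolding cube using a by simp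
    then have a3: "[a ^ 3 = - 1] (mod p)" by (simp add: cong_iff_dvd_diff power3_eq_cube mult.assoc)
    have "\<not> p dvd a"
    proof
      assume "p dvd a"
      then have "p dvd a * (a - 1)" by simp
      moreover have "a * a - 1 * a + 1 = a * (a - 1) + 1" by (simp add: algebra_simps)
      ultimately show False using a dvd_add_right_iff by (metis not_p_dvd_numerals(1))
    qed
    then obtain m where m: "m dvd nat p - 1" "\<And>k. [a ^ k = 1] (mod p) \<longleftrightarrow> m dvd k" using order_of_unit by blast
    have "[a ^ 6 = 1] (mod p)" using cong_mult[OF a3 a3] by (simp flip: power_add)
    then have 1: "m dvd 6" using m(2) by blast
    have 2: "\<not> m dvd 3" using m(2) a3 minus_one_not_one cong_sym cong_trans by blast
    have 3: "\<not> m dvd 2"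
    proof
      assume "m dvd 2"
      then have a2: "p dvd a * a - 1" using m(2)[of 2] by (simp add: cong_iff_dvd_diff power2_eq_square)
      have "p dvd (a * a - 1 * a + 1) - (a * a - 1)" by (rule dvd_diff[OF a a2])
      then have "p dvd (a * a - 1) + ((a * a - 1 * a + 1) - (a * a - 1)) * (a + 2)" using a2 by (intro dvd_add dvd_mult2)
      moreover have "(a * a - 1) + ((a * a - 1 * a + 1) - (a * a - 1)) * (a + 2) = 3" by (simp add: algebra_simps)
      ultimately show False using not_p_dvd_numerals(3) by (simp only:)
    qed
    have "m \<le> 6" using 1 by (rule dvd_imp_le) simp
    then have "m \<in> {0, 1, 2, 3, 4, 5, 6}" by auto
    then have "m = 6" using 1 2 3 by auto
    then show "p mod 3 = 1" using m(1) dvd_p_minus_1[of 6] m6 by simp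
  next
    assume "p mod 3 = 1"
    then have "6 dvd nat p - 1" using dvd_p_minus_1[of 6] m6 by simp
    then obtain a where a: "\<And>k. [a ^ k = 1] (mod p) \<longleftrightarrow> 6 dvd k" using exists_order[of 6] by auto
    have "[a ^ 3 * a ^ 3 = 1] (mod p)" using a[of 6] by (simp flip: power_add)
    moreover have "\<not> [a ^ 3 = 1] (mod p)" using a[of 3] by simp
    ultimately have "p dvd a ^ 3 + 1" by (rule square_root_cases)
    then have "p dvd (a + 1) * (a * a - 1 * a + 1)" unfolding cube[symmetric] by (simp add: power3_eq_cube mult.assoc)
    moreover have "\<not> p dvd a + 1"
    proof
      assume "p dvd a + 1"
      then have "p dvd (a + 1) * (a - 1)" by (rule dvd_mult2)
      then have "[a ^ 2 = 1] (mod p)" by (simp add: cong_iff_dvd_diff power2_eq_square algebra_simps)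
      then show False using a[of 2] by simp
    qed
    ultimately show "\<exists>a. p dvd a * a - 1 * a + 1" unfolding p_dvd_mult by blast
  qed
qed

text \<open>Gauss's lemma: \<open>G.E\<close> consists of the numbers 2 k with k at most h = (p -
  1)/2 that exceed h, so 2 is a square exactly if h - h div 2 is even.\<close>

lemma two_square_iff: "(\<exists>r. [r * r = 2] (mod p)) \<longleftrightarrow> p mod 8 = 1 \<or> p mod 8 = 7"
proof -
  have P: "prime (nat p)" "2 < nat p" "int (nat p) = p"
    using prime_p p_gt by (simp_all add: prime_int_nat_transfer[symmetric])
  interpret G: GAUSS "nat p" 2
    using P p_gt by unfold_locales (simp_all add: cong_0_iff)
  define h where "h = (p - 1) div 2"
  have h: "p = 2 * h + 1" "0 \<le> h" using odd_p p_gt by (auto simp: h_def)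
  have A: "G.A = {0<..h}" by (simp add: G.A_def P h_def)
  have "G.C = (\<lambda>k. 2 * k) ` {0<..h}"
    unfolding G.C_def G.B_def A image_image P(3) using h by (intro image_cong refl) auto
  then have "G.E = (\<lambda>k. 2 * k) ` {h div 2<..h}"
    unfolding G.E_def P(3) h_def[symmetric] by auto
  moreover have "inj_on (\<lambda>k. 2 * k) {h div 2<..h}" by (auto intro: inj_onI)
  ultimately have E: "card G.E = nat (h - h div 2)" by (simp only: card_image card_greaterThanAtMost_int)
  have ne: "\<not> [2 = 0] (mod p)" by (simp add: cong_0_iff)
  have "(\<exists>r. [r * r = 2] (mod p)) \<longleftrightarrow> Legendre 2 p = 1"
    using ne by (auto simp: Legendre_def QuadRes_def power2_eq_square)
  also have "\<dots> \<longleftrightarrow> even (card G.E)" using G.gauss_lemma unfolding P(3) by (cases "even (card G.E)") simp_all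
  also have "\<dots> \<longleftrightarrow> even (h - h div 2)" unfolding E using h(2) by (simp add: even_nat_iff)
  also have "\<dots> \<longleftrightarrow> p mod 8 = 1 \<or> p mod 8 = 7" using h by presburger
  finally show ?thesis .
qed

text \<open>The traces are 0 and 1, joined by a square root of 2 when there is one; \<open>n\<close>
  gives the number of eigenvalues modulo p for each.\<close>

lemma card_Solv_formula:
  defines "n \<equiv> \<lambda>b. if b then 2 else (0::int)"
  shows "2 * int (card (Solv (PSL2 p))) = 2 * (p * p + p + 2)
    + (p * (p - 1) + p * n (p mod 4 = 1)) + (p * (p - 1) + p * n (p mod 3 = 1))
    + (if p mod 8 = 1 \<or> p mod 8 = 7 then p * (p - 1) + p * n (p mod 8 = 1) else 0)"
proof -
  have n0: "card (unit_roots 0) = (if p mod 4 = 1 then 2 else 0)"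
    using card_unit_roots[of 0] root_trace_0 by simp
  have n1: "card (unit_roots 1) = (if p mod 3 = 1 then 2 else 0)"
    using card_unit_roots[of 1] root_trace_1 by simp
  have P: "int (nat p) = p" "int (nat (p - 1)) = p - 1" using p_gt by simp_all
  have small: "[s = 0] (mod p) \<or> [s = 1] (mod p) \<or> [- s = 1] (mod p) \<or> p dvd s * s - 2" if "small_order s" for s
  proof -
    have "s * s - 1 = (s - 1) * (s + 1)" by (simp add: algebra_simps)
    then have "p dvd s * s - 1 \<Longrightarrow> p dvd s - 1 \<or> p dvd s + 1" by (simp only: p_dvd_mult)
    moreover have "p dvd s + 1 \<Longrightarrow> p dvd - s - 1" by (metis dvd_minus_iff minus_add_distrib uminus_add_conv_diff add.commute)
    ultimately show ?thesis using that unfolding small_order_def by (auto simp: cong_0_iff cong_iff_dvd_diff)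
  qed
  show ?thesis
  proof (cases "p mod 8 = 1 \<or> p mod 8 = 7")
    case False
    then have no: "\<not> p dvd s * s - 2" for s using two_square_iff by (simp add: cong_iff_dvd_diff)
    have "2 * card (Solv (PSL2 p)) = 2 * (nat p * nat p + nat p + 2)
      + (\<Sum>t\<in>{0, 1}. nat p * nat (p - 1) + nat p * card (unit_roots t))"
    proof (rule card_Solv)
      fix s assume "small_order s"
      then show "\<exists>t\<in>{0, 1}. [s = t] (mod p) \<or> [- s = t] (mod p)" using small no by blast
    qed auto
    then have "int (2 * card (Solv (PSL2 p))) = int (2 * (nat p * nat p + nat p + 2)
      + (nat p * nat (p - 1) + nat p * card (unit_roots 0) + (nat p * nat (p - 1) + nat p * card (unit_roots 1))))"
      by simp
    then have "2 * int (card (Solv (PSL2 p))) = 2 * (p * p + p + 2)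
      + (p * (p - 1) + p * int (card (unit_roots 0)) + (p * (p - 1) + p * int (card (unit_roots 1))))"
      by (simp only: of_nat_add of_nat_mult P of_nat_numeral of_nat_1)
    then show ?thesis using False by (simp add: n0 n1 n_def)
  next
    case True
    then obtain r where r: "[r * r = 2] (mod p)" using two_square_iff by blast
    then have r2: "p dvd r * r - 2" by (simp add: cong_iff_dvd_diff)
    have rc: "p dvd r * r - c \<longleftrightarrow> p dvd 2 - c" for c
      by (rule cong_dvd_iff) (intro cong_diff r cong_refl)
    have n2: "card (unit_roots r) = (if p mod 8 = 1 then 2 else 0)"
      using card_unit_roots[of r] root_trace_sqrt2[OF r] rc[of 4] by simp
    have rn: "r \<noteq> 0" "r \<noteq> 1" using r2 by auto
    have sw: "p dvd c - r * r \<longleftrightarrow> p dvd r * r - c" for c by (rule dvd_diff_commute)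
    have "2 * card (Solv (PSL2 p)) = 2 * (nat p * nat p + nat p + 2)
      + (\<Sum>t\<in>{0, 1, r}. nat p * nat (p - 1) + nat p * card (unit_roots t))"
    proof (rule card_Solv)
      fix s assume "small_order s"
      moreover have "[s = r] (mod p) \<or> [- s = r] (mod p)" if "p dvd s * s - 2"
      proof -
        have "p dvd (s * s - 2) - (r * r - 2)" by (rule dvd_diff[OF that r2])
        moreover have "(s * s - 2) - (r * r - 2) = (s - r) * (s + r)" by (simp add: algebra_simps)
        ultimately have "p dvd s - r \<or> p dvd s + r" by (simp only: p_dvd_mult)
        moreover have "p dvd s + r \<longleftrightarrow> p dvd - s - r" by (metis dvd_minus_iff minus_add_distrib uminus_add_conv_diff add.commute)
        ultimately show ?thesis by (simp add: cong_iff_dvd_diff)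
      qed
      ultimately show "\<exists>t\<in>{0, 1, r}. [s = t] (mod p) \<or> [- s = t] (mod p)" using small[of s] by blast
    next
      fix t assume "t \<in> {0, 1, r}"
      then show "\<exists>c\<in>{0, 1, 2}. p dvd t * t - c" using r2 by auto
    next
      fix t t' assume "t \<in> {0, 1, r}" "t' \<in> {0, 1, r}" "p dvd t * t - t' * t'"
      then show "t = t'" using rc[of 0] rc[of 1] sw[of 0] sw[of 1] by (elim insertE emptyE) (simp_all del: p_dvd_mult)
    qed simp
    then have "int (2 * card (Solv (PSL2 p))) = int (2 * (nat p * nat p + nat p + 2)
      + (nat p * nat (p - 1) + nat p * card (unit_roots 0) + (nat p * nat (p - 1) + nat p * card (unit_roots 1)
      + (nat p * nat (p - 1) + nat p * card (unit_roots r)))))"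
      using rn by simp
    then have "2 * int (card (Solv (PSL2 p))) = 2 * (p * p + p + 2)
      + (p * (p - 1) + p * int (card (unit_roots 0)) + (p * (p - 1) + p * int (card (unit_roots 1))
      + (p * (p - 1) + p * int (card (unit_roots r)))))"
      by (simp only: of_nat_add of_nat_mult P of_nat_numeral of_nat_1)
    then show ?thesis using True by (simp add: n0 n1 n2 n_def)
  qed
qed

end

theorem theorem3p10:
  fixes p :: int
  assumes "prime p" and "p > 7" and "p mod 5 = 2 \<or> p mod 5 = 3"
  shows "(p mod 24 = 1 \<longrightarrow> real (card (Solv (PSL2 p))) = 5/2 * (real_of_int p)^2 + 5/2 * real_of_int p + 2)
       \<and> (p mod 24 = 5 \<longrightarrow> real (card (Solv (PSL2 p))) = 2 * (real_of_int p)^2 + real_of_int p + 2)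
       \<and> (p mod 24 = 7 \<longrightarrow> real (card (Solv (PSL2 p))) = 5/2 * (real_of_int p)^2 + 1/2 * real_of_int p + 2)
       \<and> (p mod 24 = 11 \<longrightarrow> real (card (Solv (PSL2 p))) = 2 * (real_of_int p)^2 + 2)
       \<and> (p mod 24 = 13 \<longrightarrow> real (card (Solv (PSL2 p))) = 2 * (real_of_int p)^2 + 2 * real_of_int p + 2)
       \<and> (p mod 24 = 17 \<longrightarrow> real (card (Solv (PSL2 p))) = 5/2 * (real_of_int p)^2 + 3/2 * real_of_int p + 2)
       \<and> (p mod 24 = 19 \<longrightarrow> real (card (Solv (PSL2 p))) = 2 * (real_of_int p)^2 + real_of_int p + 2)
       \<and> (p mod 24 = 23 \<longrightarrow> real (card (Solv (PSL2 p))) = 5/2 * (real_of_int p)^2 - 1/2 * real_of_int p + 2)"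
proof -
  interpret psl p using assms by unfold_locales
  define N where "N = real (card (Solv (PSL2 p)))"
  define x where "x = real_of_int p"
  define n where "n b = (if b then 2 else (0::int))" for b
  have f: "2 * N = 2 * (x * x + x + 2) + (x * (x - 1) + x * of_int (n (p mod 4 = 1)))
      + (x * (x - 1) + x * of_int (n (p mod 3 = 1)))
      + (if p mod 8 = 1 \<or> p mod 8 = 7 then x * (x - 1) + x * of_int (n (p mod 8 = 1)) else 0)"
    using arg_cong[OF card_Solv_formula, of real_of_int] unfolding N_def x_def n_def by (simp split: if_splits)
  \<comment> \<open>The formula depends on p modulo 3, 4 and 8 only, and 24 is their least common
    multiple.\<close>
  have m: "p mod 24 mod 4 = p mod 4" "p mod 24 mod 3 = p mod 3" "p mod 24 mod 8 = p mod 8"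
    by (simp_all add: mod_mod_cancel)
  have r: "p mod 24 = c \<Longrightarrow> 2 * N = 2 * (x * x + x + 2) + (x * (x - 1) + x * of_int (n (c mod 4 = 1)))
      + (x * (x - 1) + x * of_int (n (c mod 3 = 1)))
      + (if c mod 8 = 1 \<or> c mod 8 = 7 then x * (x - 1) + x * of_int (n (c mod 8 = 1)) else 0)" for c
    using f m by metis
  show ?thesis unfolding N_def[symmetric] x_def[symmetric]
    by (intro conjI impI; drule r; simp add: n_def power2_eq_square algebra_simps)
qed

end
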